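(* Let $n\ge1$, let $\mathcal L\subset\mathbb R^n$ be any lattice such that $\det(\mathcal L')\ge1$ for all sublattices $\mathcal L'\subseteq\mathcal L$, and let $s>0$ be such that either $s\le\sqrt{2\pi/(n+2)}$ or $s\ge\sqrt{(n+2)/(2\pi)}$. Then $\rho_s(\mathcal L)\le\rho_s(\mathbb Z^n)$.
   Context: A lattice $\mathcal L\subset\mathbb R^n$ is the set of all integer linear combinations of $n$ linearly independent vectors of $\mathbb R^n$. A sublattice of $\mathcal L$ is an additive subgroup $\mathcal L'\subseteq\mathcal L$ (possibly of lower rank). If $\mathcal L'$ has a $\mathbb Z$-basis given by the columns of a matrix $B'$, then $\det(\mathcal L'):=\sqrt{\det(B'^TB')}$, and $\det(\{0\}):=1$. For $s>0$, $\rho_s(\mathcal L):=\sum_{y\in\mathcal L}e^{-\pi\|y\|^2/s^2}$, with $\|\cdot\|$ the Euclidean norm. *)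

theory Defs
  imports "HOL-Analysis.Analysis" "Jordan_Normal_Form.Determinant"
begin

no_notation vec_index (infixl "$" 100)

definition int_span :: "'a::real_vector list \<Rightarrow> 'a set" where
  "int_span bs = {\<Sum>i<length bs. real_of_int (c i) *\<^sub>R (bs ! i) | c :: nat \<Rightarrow> int. True}"

definition is_lattice :: "(real ^ 'n) set \<Rightarrow> bool" where
  "is_lattice L \<longleftrightarrow> (\<exists>bs. length bs = CARD('n) \<and> distinct bs \<and>
     independent (set bs) \<and> L = int_span bs)"

definition is_sublattice :: "'a::real_vector set \<Rightarrow> 'a set \<Rightarrow> bool" where
  "is_sublattice M L \<longleftrightarrow> M \<subseteq> L \<and> 0 \<in> M \<and> (\<forall>x\<in>M. \<forall>y\<in>M. x + y \<in> M) \<and> (\<forall>x\<in>M. - x \<in> M)"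

definition is_int_basis :: "'a::real_vector list \<Rightarrow> 'a set \<Rightarrow> bool" where
  "is_int_basis bs M \<longleftrightarrow> M = int_span bs \<and>
     (\<forall>c :: nat \<Rightarrow> int. (\<Sum>i<length bs. real_of_int (c i) *\<^sub>R (bs ! i)) = 0 \<longrightarrow>
        (\<forall>i<length bs. c i = 0))"

text \<open>If \<open>B\<close> is the matrix with columns \<open>bs\<close>, this is the product of the transpose of \<open>B\<close>
  with \<open>B\<close>.\<close>

definition gram_mat :: "'a::real_inner list \<Rightarrow> real mat" where
  "gram_mat bs = Matrix.mat (length bs) (length bs) (\<lambda>(i, j). (bs ! i) \<bullet> (bs ! j))"

text \<open>Any two integral bases of a sublattice of a lattice differ by a unimodular matrix, so the
  value does not depend on the chosen basis. The trivial group has the empty basis, whose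
  \<open>0 \<times> 0\<close> Gram matrix has determinant 1.\<close>

definition lattice_det :: "'a::real_inner set \<Rightarrow> real" where
  "lattice_det M = sqrt (Determinant.det (gram_mat (SOME bs. is_int_basis bs M)))"

definition gauss_mass :: "real \<Rightarrow> 'a::real_normed_vector set \<Rightarrow> real" where
  "gauss_mass s L = (\<Sum>\<^sub>\<infinity>y\<in>L. exp (- pi * (norm y)\<^sup>2 / s\<^sup>2))"

definition int_lattice :: "(real ^ 'n) set" where
  "int_lattice = {x. \<forall>i. x $ i \<in> \<int>}"

lemma lattice_det_zero: "lattice_det {0 :: 'a::real_inner} = 1"
proof -
  have ex: "is_int_basis [] {0 :: 'a}"
    by (simp add: is_int_basis_def int_span_def)
  have empty: "bs = []" if "is_int_basis bs {0 :: 'a}" for bs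
  proof (rule ccontr)
    assume "bs \<noteq> []"
    then have len: "0 < length bs" by simp
    let ?c = "\<lambda>_ :: nat. 1 :: int"
    have "(\<Sum>i<length bs. real_of_int (?c i) *\<^sub>R (bs ! i)) \<in> int_span bs"
      unfolding int_span_def by (intro CollectI exI[of _ ?c]) simp
    moreover have "int_span bs = {0}"
      using that unfolding is_int_basis_def by simp
    ultimately have zero: "(\<Sum>i<length bs. real_of_int (?c i) *\<^sub>R (bs ! i)) = 0"
      by simp
    have "\<forall>c :: nat \<Rightarrow> int. (\<Sum>i<length bs. real_of_int (c i) *\<^sub>R (bs ! i)) = 0 \<longrightarrow>
        (\<forall>i<length bs. c i = 0)"
      using that unfolding is_int_basis_def by (rule conjunct2)
    from spec[OF this, of ?c] have "\<forall>i<length bs. ?c i = 0"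
      using zero by (rule mp)
    from spec[OF this, of 0] len have "?c 0 = 0" by (rule mp)
    then show False by simp
  qed
  have "(SOME bs. is_int_basis bs {0 :: 'a}) = []"
    using ex by (rule empty[OF someI])
  then show ?thesis
    by (simp add: lattice_det_def gram_mat_def)
qed

end

theory Submission
  imports Defs "HOL-Probability.Probability"
begin

text \<open>Write \<open>\<rho>(L)\<close> for the Gaussian mass and argue by induction on the rank. Contracting a lattice
  increases its mass, so one may assume that some sublattice \<open>L'\<close> has determinant exactly one. If
  \<open>L'\<close> has smaller rank, then the projection of \<open>L\<close> orthogonal to \<open>L'\<close> again satisfies the hypothesis and
  \<open>\<rho>(L) \<le> \<rho>(L') \<rho>(L/L')\<close>, because by Poisson summation no shift of \<open>L'\<close> has larger mass than \<open>L'\<close>.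
  Otherwise \<open>det L = 1\<close>; such lattices have bases in a compact set, so \<open>\<rho>\<close> has a maximum. If at the maximum
  no proper sublattice has determinant one, then all small volume-preserving deformations are
  admissible. With \<open>t = \<pi> / s\<^sup>2\<close>, the average of the second derivative of \<open>\<rho>\<close> over the traceless symmetric
  directions is a positive multiple of the sum of
  \<open>exp (- t \<bar>y\<bar>\<^sup>2) t \<bar>y\<bar>\<^sup>2 (t \<bar>y\<bar>\<^sup>2 - (n + 2) / 2)\<close> over \<open>y\<close>, which is positive when \<open>t \<ge> (n + 2) / 2\<close> since
  nonzero vectors have norm at least one; this is a contradiction. For large \<open>s\<close>, the case of lattices
  of determinant one follows from the case of small \<open>s\<close> applied to the dual lattice.\<close>

no_notation Matrix.scalar_prod (infix "\<bullet>" 70)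

section \<open>Gram determinants\<close>

text \<open>In terms of \<open>t\<close> the two ranges of \<open>s\<close> are
  \<open>t \<ge> (n + 2) / 2\<close> and \<open>pi\<^sup>2 / t \<ge> (n + 2) / 2\<close>, which
  Poisson summation exchanges. The threshold for \<open>n\<close> dominates that for every smaller
  rank, so a single \<open>t\<close> serves the whole induction. What obstructs a direct variational
  argument is that a deformation may push some sublattice below determinant one. A lattice of
  maximal mass therefore sits either on that boundary, where it splits, or in the interior, where a
  maximum is impossible. Splitting loses nothing because covolumes multiply: dividing by a
  sublattice of determinant exactly one turns determinants of the projection into determinants of
  tuples of the lattice. Determinant one also matters for duality: it makes the dual inherit the
  hypothesis, and it reduces the Poisson factor to that of the integer lattice. Rank one has no
  traceless direction and is handled separately: determinant one leaves an isometric copy of the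
  integers. All lattices live in one Euclidean space and may have lower rank, so that sublattices,
  projections and duals keep the same type.\<close>

definition zspan :: "nat \<Rightarrow> (nat \<Rightarrow> 'a::real_vector) \<Rightarrow> 'a set" where
  "zspan k b = range (\<lambda>c::nat \<Rightarrow> int. \<Sum>i<k. of_int (c i) *\<^sub>R b i)"

text \<open>The squared covolume, without the square root of \<open>lattice_det\<close>. Dependent
  tuples are allowed and get the value zero. Tuples are functions on \<open>nat\<close> with a
  separate length, so extending, truncating and taking limits of tuples need no conversion.\<close>

definition gdet :: "nat \<Rightarrow> (nat \<Rightarrow> 'a::real_inner) \<Rightarrow> real" where
  "gdet k b = Determinant.det (Matrix.mat k k (\<lambda>(i,j). b i \<bullet> b j))"

lemma gdet_cong: "(\<And>i. i < k \<Longrightarrow> b i = d i) \<Longrightarrow> gdet k b = gdet k d"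
  unfolding gdet_def by (rule arg_cong[where f=Determinant.det], rule eq_matI) auto

lemma gdet_0 [simp]: "gdet 0 b = 1"
  unfolding gdet_def by simp

lemma gdet_1 [simp]: "gdet (Suc 0) b = (norm (b 0))\<^sup>2"
  unfolding gdet_def
  by (subst det_single) (auto simp: power2_norm_eq_inner)

lemma gdet_base_change:
  fixes b d :: "nat \<Rightarrow> 'a::real_inner"
  assumes A: "A \<in> carrier_mat k k"
    and b: "\<And>i. i < k \<Longrightarrow> b i = (\<Sum>j<k. A $$ (i,j) *\<^sub>R d j)"
  shows "gdet k b = (Determinant.det A)\<^sup>2 * gdet k d"
proof -
  let ?D = "Matrix.mat k k (\<lambda>(i,j). d i \<bullet> d j)"
  have "Matrix.mat k k (\<lambda>(i,j). b i \<bullet> b j) = A * ?D * transpose_mat A"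
  proof (rule eq_matI)
    fix i j assume ij: "i < dim_row (A * ?D * transpose_mat A)" "j < dim_col (A * ?D * transpose_mat A)"
    then have ij': "i < k" "j < k" using A by auto
    have "(A * ?D * transpose_mat A) $$ (i,j)
        = (\<Sum>l<k. (\<Sum>m<k. A $$ (i,m) * (d m \<bullet> d l)) * A $$ (j,l))"
      using A ij' by (simp add: scalar_prod_def atLeast0LessThan)
    also have "\<dots> = b i \<bullet> b j"
      using ij' by (simp add: b inner_sum_left inner_sum_right sum_distrib_left sum_distrib_right mult_ac)
    finally show "Matrix.mat k k (\<lambda>(i,j). b i \<bullet> b j) $$ (i,j) = (A * ?D * transpose_mat A) $$ (i,j)"
      using ij' by simp
  qed (use A in auto)
  then have "gdet k b = Determinant.det A * gdet k d * Determinant.det (transpose_mat A)"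
    unfolding gdet_def using A by (simp add: det_mult[where n=k])
  then show ?thesis using A by (simp add: det_transpose power2_eq_square)
qed

lemma span_range_tuple: "span (b ` {..<k::nat}) = range (\<lambda>u. \<Sum>i<k. u i *\<^sub>R b i)"
proof
  show "span (b ` {..<k}) \<subseteq> range (\<lambda>u. \<Sum>i<k. u i *\<^sub>R b i)"
  proof (rule span_minimal)
    show "b ` {..<k} \<subseteq> range (\<lambda>u. \<Sum>i<k. u i *\<^sub>R b i)"
    proof clarify
      fix i assume "i < k"
      then have "(\<Sum>j<k. (if j = i then 1 else 0) *\<^sub>R b j) = b i"
        by (simp add: if_distrib[of "\<lambda>x. x *\<^sub>R _"] sum.delta cong: if_cong)
      then show "b i \<in> range (\<lambda>u. \<Sum>i<k. u i *\<^sub>R b i)"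
        by (intro range_eqI[of _ _ "\<lambda>j. if j = i then 1 else 0"]) simp
    qed
    show "subspace (range (\<lambda>u. \<Sum>i<k. u i *\<^sub>R b i))"
    proof (rule subspaceI)
      show "0 \<in> range (\<lambda>u. \<Sum>i<k. u i *\<^sub>R b i)" by (rule range_eqI[of _ _ "\<lambda>_. 0"]) simp
    next
      fix x y assume "x \<in> range (\<lambda>u. \<Sum>i<k. u i *\<^sub>R b i)" "y \<in> range (\<lambda>u. \<Sum>i<k. u i *\<^sub>R b i)"
      then obtain u v where "x = (\<Sum>i<k. u i *\<^sub>R b i)" "y = (\<Sum>i<k. v i *\<^sub>R b i)" by auto
      then show "x + y \<in> range (\<lambda>u. \<Sum>i<k. u i *\<^sub>R b i)"
        by (intro range_eqI[of _ _ "\<lambda>i. u i + v i"]) (simp add: scaleR_add_left sum.distrib)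
    next
      fix c x assume "x \<in> range (\<lambda>u. \<Sum>i<k. u i *\<^sub>R b i)"
      then obtain u where "x = (\<Sum>i<k. u i *\<^sub>R b i)" by auto
      then show "c *\<^sub>R x \<in> range (\<lambda>u. \<Sum>i<k. u i *\<^sub>R b i)"
        by (intro range_eqI[of _ _ "\<lambda>i. c * u i"]) (simp add: scaleR_sum_right)
    qed
  qed
  show "range (\<lambda>u. \<Sum>i<k. u i *\<^sub>R b i) \<subseteq> span (b ` {..<k})"
    by (intro subsetI, elim rangeE, simp) (intro span_sum span_scale span_base, simp)
qed

text \<open>Base times height, in blocks: passing to components orthogonal to the first
  \<open>m\<close> vectors is a unipotent change of tuple, and it makes the Gram matrix block
  diagonal. This is the multiplicativity of covolumes along a quotient.\<close>

lemma gdet_split: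
  fixes b c :: "nat \<Rightarrow> 'a::real_inner"
  assumes c: "\<And>i. i < q \<Longrightarrow> b (m + i) - c i \<in> span (b ` {..<m})"
    and o: "\<And>i j. i < q \<Longrightarrow> j < m \<Longrightarrow> c i \<bullet> b j = 0"
  shows "gdet (m + q) b = gdet m b * gdet q c"
proof -
  have "\<exists>u. \<forall>i<q. b (m + i) - c i = (\<Sum>j<m. u i j *\<^sub>R b j)"
    using c unfolding span_range_tuple image_iff by (intro choice) blast
  then obtain u where u: "\<And>i. i < q \<Longrightarrow> b (m + i) - c i = (\<Sum>j<m. u i j *\<^sub>R b j)" by blast
  define d where "d i = (if i < m then b i else c (i - m))" for i
  define A where "A = Matrix.mat (m+q) (m+q) (\<lambda>(i,j). if i = j then 1 else if i \<ge> m \<and> j < m then u (i - m) j else 0 :: real)"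
  have A: "A \<in> carrier_mat (m+q) (m+q)" by (simp add: A_def)
  have detA: "Determinant.det A = 1"
    by (subst det_lower_triangular[OF _ A]) (auto simp: A_def prod_list_diag_prod)
  have bd: "b i = (\<Sum>j<m+q. A $$ (i,j) *\<^sub>R d j)" if i: "i < m + q" for i
  proof (cases "i < m")
    case True
    have "(\<Sum>j<m+q. A $$ (i,j) *\<^sub>R d j) = (\<Sum>j<m+q. if j = i then d i else 0)"
      using True i by (intro sum.cong) (auto simp: A_def)
    then show ?thesis using True by (simp add: d_def)
  next
    case False
    have "(\<Sum>j<m+q. A $$ (i,j) *\<^sub>R d j)
        = (\<Sum>j<m+q. (if j < m then u (i-m) j *\<^sub>R b j else 0) + (if j = i then d i else 0))"
      using False i by (intro sum.cong) (auto simp: A_def d_def)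
    also have "\<dots> = (\<Sum>j<m+q. (if j < m then u (i-m) j *\<^sub>R b j else 0)) + d i"
      using i by (simp add: sum.distrib)
    also have "(\<Sum>j<m+q. (if j < m then u (i-m) j *\<^sub>R b j else 0)) = (\<Sum>j<m. u (i-m) j *\<^sub>R b j)"
      by (intro sum.mono_neutral_cong_right) auto
    also have "\<dots> = b i - c (i - m)" using u[of "i-m"] i False by simp
    finally show ?thesis using False by (simp add: d_def)
  qed
  have "gdet (m+q) b = gdet (m+q) d"
    using gdet_base_change[OF A bd] detA by simp
  also have "Matrix.mat (m+q) (m+q) (\<lambda>(i,j). d i \<bullet> d j) = four_block_mat
     (Matrix.mat m m (\<lambda>(i,j). b i \<bullet> b j)) (0\<^sub>m m q) (0\<^sub>m q m) (Matrix.mat q q (\<lambda>(i,j). c i \<bullet> c j))"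
    by (rule eq_matI) (auto simp: d_def o o[unfolded inner_commute[of "c _"]])
  then have "gdet (m+q) d = gdet m b * gdet q c"
    unfolding gdet_def by (subst \<open>Matrix.mat (m+q) (m+q) _ = _\<close>, subst det_four_block_mat_lower_left_zero) auto
  finally show ?thesis .
qed

lemma gdet_Suc:
  fixes b :: "nat \<Rightarrow> 'a::real_inner"
  assumes "b k - c \<in> span (b ` {..<k})" "\<And>j. j < k \<Longrightarrow> c \<bullet> b j = 0"
  shows "gdet (Suc k) b = gdet k b * (norm c)\<^sup>2"
  using gdet_split[of 1 b k "\<lambda>_. c"] assms by simp

lemma orth_component:
  fixes x :: "'a::euclidean_space"
  obtains c where "x - c \<in> span S" "\<And>y. y \<in> span S \<Longrightarrow> c \<bullet> y = 0"
proof -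
  obtain y z where "y \<in> span S" "\<And>w. w \<in> span S \<Longrightarrow> Linear_Algebra.orthogonal z w" "x = y + z"
    using orthogonal_subspace_decomp_exists[of S x] by metis
  then show ?thesis using that[of z] by (auto simp: Linear_Algebra.orthogonal_def)
qed

lemma gdet_SucE:
  fixes b :: "nat \<Rightarrow> 'a::euclidean_space"
  obtains c where "b k - c \<in> span (b ` {..<k})" "\<And>y. y \<in> span (b ` {..<k}) \<Longrightarrow> c \<bullet> y = 0"
    "gdet (Suc k) b = gdet k b * (norm c)\<^sup>2"
proof -
  obtain c where c: "b k - c \<in> span (b ` {..<k})" "\<And>y. y \<in> span (b ` {..<k}) \<Longrightarrow> c \<bullet> y = 0"
    using orth_component by blast
  then show ?thesis using that gdet_Suc[of b k c] by (auto intro: span_base)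
qed

lemma gdet_nonneg: "gdet k b \<ge> 0" for b :: "nat \<Rightarrow> 'a::euclidean_space"
proof (induction k)
  case (Suc k)
  obtain c :: "'a" where "gdet (Suc k) b = gdet k b * (norm c)\<^sup>2" using gdet_SucE[of b k] by metis
  then show ?case using Suc by simp
qed simp

lemma gdet_Suc_eq_0_iff:
  fixes b :: "nat \<Rightarrow> 'a::euclidean_space"
  shows "gdet (Suc k) b = 0 \<longleftrightarrow> gdet k b = 0 \<or> b k \<in> span (b ` {..<k})"
proof -
  obtain c where c: "b k - c \<in> span (b ` {..<k})" "\<And>y. y \<in> span (b ` {..<k}) \<Longrightarrow> c \<bullet> y = 0"
    "gdet (Suc k) b = gdet k b * (norm c)\<^sup>2" using gdet_SucE by blast
  have "c = 0 \<longleftrightarrow> b k \<in> span (b ` {..<k})"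
  proof
    assume "b k \<in> span (b ` {..<k})"
    then have "c \<in> span (b ` {..<k})" using c(1) by (metis diff_diff_eq2 diff_add_cancel add_diff_cancel_left' span_diff)
    then have "c \<bullet> c = 0" by (rule c(2))
    then show "c = 0" by simp
  qed (use c in auto)
  then show ?thesis using c(3) by simp
qed

lemma gdet_nz_imp_independent:
  fixes b :: "nat \<Rightarrow> 'a::euclidean_space"
  assumes "gdet k b \<noteq> 0"
  shows "inj_on b {..<k}" "independent (b ` {..<k})"
proof -
  have "inj_on b {..<k} \<and> independent (b ` {..<k})" using assms
  proof (induction k)
    case (Suc k)
    then have *: "gdet k b \<noteq> 0" "b k \<notin> span (b ` {..<k})" by (auto simp: gdet_Suc_eq_0_iff)
    then have "b k \<notin> b ` {..<k}" by (meson span_base)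
    then show ?case using * Suc.IH by (simp add: lessThan_Suc independent_insert)
  qed (simp add: independent_empty)
  then show "inj_on b {..<k}" "independent (b ` {..<k})" by auto
qed

lemma independent_imp_gdet_nz:
  fixes b :: "nat \<Rightarrow> 'a::euclidean_space"
  assumes "inj_on b {..<k}" "independent (b ` {..<k})"
  shows "gdet k b \<noteq> 0"
  using assms
proof (induction k)
  case (Suc k)
  then have "inj_on b {..<k}" "b k \<notin> b ` {..<k}" by (auto simp: lessThan_Suc)
  moreover from this Suc.prems have "independent (b ` {..<k})" "b k \<notin> span (b ` {..<k})"
    by (auto simp: lessThan_Suc independent_insert)
  ultimately show ?case using Suc.IH by (auto simp: gdet_Suc_eq_0_iff)
qed simp

lemma dim_span_tuple:
  fixes b :: "nat \<Rightarrow> 'a::euclidean_space"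
  assumes "gdet k b \<noteq> 0"
  shows "dim (span (b ` {..<k})) = k"
  using gdet_nz_imp_independent[OF assms] by (simp add: dim_eq_card_independent card_image)

lemma gdet_nz_le_dim:
  fixes b :: "nat \<Rightarrow> 'a::euclidean_space"
  assumes "gdet k b \<noteq> 0" "\<And>i. i < k \<Longrightarrow> b i \<in> span S"
  shows "k \<le> dim S"
proof -
  have "span (b ` {..<k}) \<subseteq> span S" using assms(2) by (intro span_minimal) auto
  then show ?thesis using dim_span_tuple[OF assms(1)] dim_subset[of "span (b ` {..<k})" "span S"] by simp
qed

lemma gdet_nz_coeff:
  fixes b :: "nat \<Rightarrow> 'a::euclidean_space"
  assumes "gdet k b \<noteq> 0" "(\<Sum>i<k. u i *\<^sub>R b i) = 0" "i < k"
  shows "u i = 0"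
  using assms
proof (induction k arbitrary: i)
  case (Suc k)
  have nz: "gdet k b \<noteq> 0" "b k \<notin> span (b ` {..<k})" using Suc.prems(1) by (auto simp: gdet_Suc_eq_0_iff)
  have s: "(\<Sum>i<k. u i *\<^sub>R b i) \<in> span (b ` {..<k})" by (auto simp: span_range_tuple)
  have uk: "u k = 0"
  proof (rule ccontr)
    assume "u k \<noteq> 0"
    then have "b k = (1 / u k) *\<^sub>R (u k *\<^sub>R b k)" by simp
    also have "u k *\<^sub>R b k = - (\<Sum>i<k. u i *\<^sub>R b i)" using Suc.prems(2)
      by (simp add: eq_neg_iff_add_eq_0 add.commute)
    finally have "b k = (1 / u k) *\<^sub>R - (\<Sum>i<k. u i *\<^sub>R b i)" .
    then show False using nz s by (metis span_scale span_neg)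
  qed
  then have "(\<Sum>i<k. u i *\<^sub>R b i) = 0" using Suc.prems(2) by simp
  then show ?case using Suc.IH nz uk Suc.prems(3) by (cases "i = k") auto
qed simp

lemma gdet_nz_coeff_unique:
  fixes b :: "nat \<Rightarrow> 'a::euclidean_space"
  assumes "gdet k b \<noteq> 0" "(\<Sum>i<k. u i *\<^sub>R b i) = (\<Sum>i<k. v i *\<^sub>R b i)" "i < k"
  shows "u i = v i"
proof -
  have "(\<Sum>i<k. (u i - v i) *\<^sub>R b i) = 0"
    by (simp only: scaleR_diff_left sum_subtractf assms(2) diff_self)
  from gdet_nz_coeff[OF assms(1) this assms(3)] show ?thesis by simp
qed

lemma norm_add_orth:
  fixes x y :: "'a::real_inner"
  assumes "x \<bullet> y = 0"
  shows "(norm (x + y))\<^sup>2 = (norm x)\<^sup>2 + (norm y)\<^sup>2"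
  using assms by (simp add: power2_norm_eq_inner inner_add_left inner_add_right inner_commute)

lemma norm_le_add_orth:
  fixes x y :: "'a::real_inner"
  assumes "x \<bullet> y = 0"
  shows "norm x \<le> norm (x + y)"
  by (rule power2_le_imp_le) (simp_all add: norm_add_orth[OF assms])

text \<open>The squared covolume is a product of squared heights. The height of
  \<open>T (b k)\<close> over the image span is the norm of \<open>T\<close> at the old height
  vector \<open>d\<close> plus an element of the old span, hence at least \<open>c\<close> times the
  old height.\<close>

lemma gdet_linear_lower:
  fixes b :: "nat \<Rightarrow> 'a::euclidean_space"
  assumes T: "linear (T :: 'a \<Rightarrow> 'a)" and c: "c \<ge> 0" "\<And>x. c * norm x \<le> norm (T x)"
  shows "gdet k (\<lambda>i. T (b i)) \<ge> (c^2)^k * gdet k b"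
proof (induction k)
  case (Suc k)
  obtain d where d: "b k - d \<in> span (b ` {..<k})" "\<And>y. y \<in> span (b ` {..<k}) \<Longrightarrow> d \<bullet> y = 0"
    "gdet (Suc k) b = gdet k b * (norm d)\<^sup>2" by (rule gdet_SucE[of b k]) blast
  define e where "e i = T (b i)" for i
  obtain f where f: "e k - f \<in> span (e ` {..<k})" "\<And>y. y \<in> span (e ` {..<k}) \<Longrightarrow> f \<bullet> y = 0"
    "gdet (Suc k) e = gdet k e * (norm f)\<^sup>2" by (rule gdet_SucE[of e k]) blast
  have "e ` {..<k} = T ` (b ` {..<k})" by (auto simp: e_def)
  then have sp: "span (e ` {..<k}) = T ` span (b ` {..<k})"
    by (simp only: linear_span_image[OF T])
  have "e k - f \<in> T ` span (b ` {..<k})" using f(1) by (simp only: sp)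
  then obtain y where y: "e k - f = T y" "y \<in> span (b ` {..<k})" by (rule imageE)
  have "f = e k - (e k - f)" by simp
  also have "\<dots> = e k - T y" by (simp only: y(1))
  also have "\<dots> = T (b k - y)" by (simp only: e_def linear_diff[OF T])
  also have "b k - y = d + (b k - d - y)" by simp
  finally have fT: "f = T (d + (b k - d - y))" .
  have orth: "d \<bullet> (b k - d - y) = 0" by (rule d(2), rule span_diff, rule d(1), rule y(2))
  have "c * norm d \<le> c * norm (d + (b k - d - y))"
    by (intro mult_left_mono norm_le_add_orth orth c(1))
  also have "\<dots> \<le> norm f" unfolding fT by (rule c(2))
  finally have "(c * norm d)\<^sup>2 \<le> (norm f)\<^sup>2" using c(1) by (intro power_mono) auto
  then have "c\<^sup>2 * (norm d)\<^sup>2 \<le> (norm f)\<^sup>2" by (simp add: power_mult_distrib)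
  then have "((c^2)^k * gdet k b) * (c\<^sup>2 * (norm d)\<^sup>2) \<le> gdet k e * (norm f)\<^sup>2"
    using Suc.IH gdet_nonneg[of k b] unfolding e_def[abs_def]
    by (intro mult_mono) (auto simp: gdet_nonneg)
  then show ?case using d(3) f(3) by (simp add: e_def[abs_def] mult_ac)
qed simp

section \<open>Integral bases\<close>

definition agroup :: "'a::real_vector set \<Rightarrow> bool" where
  "agroup G \<longleftrightarrow> 0 \<in> G \<and> (\<forall>x\<in>G. \<forall>y\<in>G. x + y \<in> G) \<and> (\<forall>x\<in>G. - x \<in> G)"

lemma agroupD:
  assumes "agroup G"
  shows "0 \<in> G" "x \<in> G \<Longrightarrow> y \<in> G \<Longrightarrow> x + y \<in> G" "x \<in> G \<Longrightarrow> - x \<in> G" "x \<in> G \<Longrightarrow> y \<in> G \<Longrightarrow> x - y \<in> G"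
proof -
  show "0 \<in> G" "x \<in> G \<Longrightarrow> y \<in> G \<Longrightarrow> x + y \<in> G" "x \<in> G \<Longrightarrow> - x \<in> G"
    using assms by (auto simp: agroup_def)
  show "x \<in> G \<Longrightarrow> y \<in> G \<Longrightarrow> x - y \<in> G"
    using assms unfolding agroup_def by (metis diff_conv_add_uminus)
qed

lemma agroup_scaleR_int:
  assumes "agroup G" "x \<in> G"
  shows "of_int c *\<^sub>R x \<in> G"
proof -
  have nat: "of_nat n *\<^sub>R x \<in> G" for n
    by (induction n) (auto simp: scaleR_add_left intro: agroupD[OF assms(1)] assms(2))
  show ?thesis
  proof (cases c)
    case (nonneg n) then show ?thesis using nat by simp
  next
    case (neg n)
    have "of_int c *\<^sub>R x = - (of_nat (Suc n) *\<^sub>R x)"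
      by (simp only: neg of_int_minus of_int_of_nat_eq scaleR_minus_left)
    then show ?thesis using agroupD(3)[OF assms(1) nat[of "Suc n"]] by simp
  qed
qed

lemma agroup_sum:
  assumes "agroup G" "\<And>i. i \<in> I \<Longrightarrow> f i \<in> G"
  shows "sum f I \<in> G"
  using assms(2) by (induction I rule: infinite_finite_induct) (auto intro: agroupD[OF assms(1)])

lemma zspanI: "x = (\<Sum>i<k. of_int (c i) *\<^sub>R b i) \<Longrightarrow> x \<in> zspan k b"
  unfolding zspan_def by blast

lemma zspanE:
  assumes "x \<in> zspan k b"
  obtains c :: "nat \<Rightarrow> int" where "x = (\<Sum>i<k. of_int (c i) *\<^sub>R b i)"
  using assms unfolding zspan_def by blast

lemma zspan_cong: "(\<And>i. i < k \<Longrightarrow> b i = d i) \<Longrightarrow> zspan k b = zspan k d"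
  unfolding zspan_def by (intro image_cong refl sum.cong) auto

lemma zspan_base: "i < k \<Longrightarrow> b i \<in> zspan k b"
  by (rule zspanI[where c="\<lambda>j. if j = i then 1 else 0"]) (simp add: if_distrib[of of_int] if_distrib[of "\<lambda>x. x *\<^sub>R _"] cong: if_cong)

lemma agroup_zspan: "agroup (zspan k b)"
  unfolding agroup_def
proof (intro conjI ballI)
  show "0 \<in> zspan k b" by (rule zspanI[where c="\<lambda>_. 0"]) simp
next
  fix x y assume "x \<in> zspan k b" "y \<in> zspan k b"
  then obtain c d where "x = (\<Sum>i<k. of_int (c i) *\<^sub>R b i)" "y = (\<Sum>i<k. of_int (d i) *\<^sub>R b i)"
    by (auto elim!: zspanE)
  then show "x + y \<in> zspan k b"
    by (intro zspanI[where c="\<lambda>i. c i + d i"]) (simp add: scaleR_add_left sum.distrib)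
next
  fix x assume "x \<in> zspan k b"
  then obtain c where "x = (\<Sum>i<k. of_int (c i) *\<^sub>R b i)" by (auto elim!: zspanE)
  then show "- x \<in> zspan k b"
    by (intro zspanI[where c="\<lambda>i. - c i"]) (simp add: sum_negf)
qed

lemma zspan_subset: "agroup G \<Longrightarrow> (\<And>i. i < k \<Longrightarrow> b i \<in> G) \<Longrightarrow> zspan k b \<subseteq> G"
  by (auto elim!: zspanE intro!: agroup_sum agroup_scaleR_int)

lemma zspan_subset_span: "zspan k b \<subseteq> span (b ` {..<k})"
  by (auto elim!: zspanE simp: span_range_tuple)

lemma zspan_Suc: "zspan (Suc k) b = {x + of_int m *\<^sub>R b k | x m. x \<in> zspan k b}"
proof (intro subset_antisym subsetI)
  fix y assume "y \<in> zspan (Suc k) b"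
  then obtain c where "y = (\<Sum>i<Suc k. of_int (c i) *\<^sub>R b i)" by (rule zspanE)
  then have "y = (\<Sum>i<k. of_int (c i) *\<^sub>R b i) + of_int (c k) *\<^sub>R b k" by simp
  moreover have "(\<Sum>i<k. of_int (c i) *\<^sub>R b i) \<in> zspan k b" by (rule zspanI) (rule refl)
  ultimately show "y \<in> {x + of_int m *\<^sub>R b k | x m. x \<in> zspan k b}" by blast
next
  fix y assume "y \<in> {x + of_int m *\<^sub>R b k | x m. x \<in> zspan k b}"
  then obtain m c where "y = (\<Sum>i<k. of_int (c i) *\<^sub>R b i) + of_int m *\<^sub>R b k"
    by (auto elim!: zspanE)
  then show "y \<in> zspan (Suc k) b"
    by (intro zspanI[where c="\<lambda>i. if i = k then m else c i"]) simp
qed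

lemma zspan_append:
  assumes "\<And>i. i < q \<Longrightarrow> b (m + i) = c i"
  shows "zspan (m + q) b = {x + y | x y. x \<in> zspan m b \<and> y \<in> zspan q c}"
  using assms
proof (induction q)
  case 0
  then show ?case by (auto simp: zspan_def)
next
  case (Suc q)
  then show ?case by (auto simp: zspan_Suc) (metis add.assoc)+
qed

text \<open>\<open>z\<close> is the determinant of the integer coefficient matrix; for independent
  tuples it is, up to sign, the index of the sublattice.\<close>

lemma gdet_int_coeffs:
  fixes b d :: "nat \<Rightarrow> 'a::real_inner"
  assumes "\<And>i. i < k \<Longrightarrow> d i \<in> zspan k b"
  obtains z :: int where "gdet k d = of_int (z\<^sup>2) * gdet k b"
proof -
  have "\<exists>C. \<forall>i<k. d i = (\<Sum>j<k. of_int (C i j :: int) *\<^sub>R b j)"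
    using assms unfolding zspan_def image_iff by (intro choice) blast
  then obtain C where C: "\<And>i. i < k \<Longrightarrow> d i = (\<Sum>j<k. of_int (C i j :: int) *\<^sub>R b j)" by blast
  define A where "A = Matrix.mat k k (\<lambda>(i,j). C i j)"
  have "gdet k d = (Determinant.det (map_mat of_int A))\<^sup>2 * gdet k b"
    by (rule gdet_base_change) (auto simp: A_def C)
  also have "Determinant.det (map_mat of_int A) = (of_int (Determinant.det A) :: real)"
    by (simp add: of_int_hom.hom_det)
  finally show ?thesis using that[of "Determinant.det A"] by simp
qed

lemma gdet_int_ge:
  fixes b d :: "nat \<Rightarrow> 'a::euclidean_space"
  assumes "\<And>i. i < k \<Longrightarrow> d i \<in> zspan k b" "gdet k d \<noteq> 0"
  shows "gdet k d \<ge> gdet k b"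
proof -
  obtain z :: int where z: "gdet k d = of_int (z\<^sup>2) * gdet k b" by (rule gdet_int_coeffs[OF assms(1)]) blast
  then have "z\<^sup>2 \<noteq> 0" using assms(2) by auto
  then have "z\<^sup>2 \<ge> 1" by (metis zero_le_power2 int_one_le_iff_zero_less order_le_less)
  then have "(of_int (z\<^sup>2) :: real) \<ge> 1" by (metis of_int_1 of_int_le_iff)
  then show ?thesis using z gdet_nonneg[of k b] mult_right_mono[of 1 "of_int (z\<^sup>2)" "gdet k b"] by simp
qed

text \<open>Each tuple has integer coefficients in the other, so the two Gram determinants bound
  each other. Dependent tuples are included: if one value vanishes, so does the other.\<close>

lemma gdet_basis_unique:
  fixes b d :: "nat \<Rightarrow> 'a::euclidean_space"
  assumes "zspan k b = zspan k d"
  shows "gdet k b = gdet k d"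
proof -
  have "gdet k b \<le> gdet k d" if eq: "zspan k b = zspan k d" for b d :: "nat \<Rightarrow> 'a"
  proof (cases "gdet k d = 0")
    case True
    obtain z :: int where "gdet k b = of_int (z\<^sup>2) * gdet k d"
      by (rule gdet_int_coeffs[of k b d]) (use eq zspan_base in blast)+
    then show ?thesis using True by simp
  next
    case False
    show ?thesis by (rule gdet_int_ge[OF _ False]) (use eq zspan_base in blast)
  qed
  from this[of b d] this[of d b] assms show ?thesis by simp
qed

definition zbasis :: "nat \<Rightarrow> (nat \<Rightarrow> 'a::real_inner) \<Rightarrow> 'a set \<Rightarrow> bool" where
  "zbasis k b G \<longleftrightarrow> gdet k b \<noteq> 0 \<and> G = zspan k b"

lemma zbasis_rank_unique:
  fixes b d :: "nat \<Rightarrow> 'a::euclidean_space"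
  assumes "zbasis k b G" "zbasis m d G"
  shows "k = m"
proof -
  have "k \<le> m" if "zbasis k b G" "zbasis m d G" for k m and b d :: "nat \<Rightarrow> 'a"
  proof -
    have "\<And>i. i < k \<Longrightarrow> b i \<in> span (d ` {..<m})"
      using that zspan_base[of _ k b] zspan_subset_span[of m d] unfolding zbasis_def by blast
    then have "k \<le> dim (d ` {..<m})" using that by (intro gdet_nz_le_dim) (auto simp: zbasis_def)
    then show ?thesis using that dim_span_tuple[of m d] by (simp add: zbasis_def)
  qed
  then show ?thesis using assms by (meson antisym)
qed

text \<open>The determinant hypothesis of the theorem, expressed through the squared covolumes of tuples
  instead of sublattices.\<close>

definition good :: "'a::real_inner set \<Rightarrow> bool" where
  "good G \<longleftrightarrow> agroup G \<and> (\<forall>k b. (\<forall>i<k. b i \<in> G) \<longrightarrow> gdet k b = 0 \<or> gdet k b \<ge> 1)"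

lemma goodD: "good G \<Longrightarrow> (\<And>i. i < k \<Longrightarrow> b i \<in> G) \<Longrightarrow> gdet k b \<noteq> 0 \<Longrightarrow> gdet k b \<ge> 1"
  unfolding good_def by blast

lemma good_norm_ge: "good G \<Longrightarrow> x \<in> G \<Longrightarrow> x \<noteq> 0 \<Longrightarrow> norm x \<ge> 1"
  using goodD[of G "Suc 0" "\<lambda>_. x"] by (intro power2_le_imp_le[of 1 "norm x"]) auto

lemma good_subset: "good G \<Longrightarrow> agroup H \<Longrightarrow> H \<subseteq> G \<Longrightarrow> good H"
  unfolding good_def by blast

text \<open>An accumulation point would have two distinct elements of the group within
  \<open>m / 2\<close> of it, hence a nonzero difference shorter than \<open>m\<close>.\<close>

lemma discrete_finite_ball:
  fixes G :: "'a::euclidean_space set"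
  assumes "agroup G" "m > 0" "\<And>x. x \<in> G \<Longrightarrow> x \<noteq> 0 \<Longrightarrow> norm x \<ge> m"
  shows "finite {x \<in> G. norm x \<le> R}"
proof (rule ccontr)
  assume inf: "infinite {x \<in> G. norm x \<le> R}"
  have "{x \<in> G. norm x \<le> R} \<subseteq> cball 0 R" by auto
  then obtain l where "l islimpt {x \<in> G. norm x \<le> R}"
    using inf compact_cball[of "0::'a" R] unfolding compact_eq_Bolzano_Weierstrass by blast
  then have inf': "infinite ({x \<in> G. norm x \<le> R} \<inter> ball l (m/2))"
    using assms(2) by (simp add: islimpt_eq_infinite_ball)
  define S where "S = {x \<in> G. norm x \<le> R} \<inter> ball l (m/2)"
  have S: "infinite S" unfolding S_def by (rule inf')
  then obtain x where x: "x \<in> S" by (cases "S = {}") auto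
  have "infinite (S - {x})" using S by simp
  then obtain y where y: "y \<in> S" "x \<noteq> y" by (cases "S - {x} = {}") auto
  have "m \<le> norm (x - y)" using x y by (intro assms(3) agroupD(4)[OF assms(1)]) (auto simp: S_def)
  also have "norm (x - y) = dist x y" by (rule dist_norm[symmetric])
  also have "\<dots> \<le> dist l x + dist l y" by (rule dist_triangle3)
  also have "\<dots> < m" using x y by (simp add: S_def)
  finally show False by simp
qed

section \<open>Reduced bases\<close>

text \<open>The component of \<open>x\<close> orthogonal to \<open>span S\<close>. The argument is a
  generating set, so that bases can be inserted directly; existence comes from
  \<open>orth_component\<close>, uniqueness is \<open>perp_unique\<close>.\<close>

definition perp :: "'a::euclidean_space set \<Rightarrow> 'a \<Rightarrow> 'a" where
  "perp S x = (SOME c. x - c \<in> span S \<and> (\<forall>y\<in>span S. c \<bullet> y = 0))"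

lemma perp: "x - perp S x \<in> span S" "y \<in> span S \<Longrightarrow> perp S x \<bullet> y = 0"
proof -
  have "\<exists>c. x - c \<in> span S \<and> (\<forall>y\<in>span S. c \<bullet> y = 0)" by (rule orth_component[of x S]) blast
  from someI_ex[OF this] show "x - perp S x \<in> span S" "y \<in> span S \<Longrightarrow> perp S x \<bullet> y = 0"
    unfolding perp_def by auto
qed

lemma perp_unique:
  assumes "x - c \<in> span S" "\<And>y. y \<in> span S \<Longrightarrow> c \<bullet> y = 0"
  shows "perp S x = c"
proof -
  have "(x - c) - (x - perp S x) \<in> span S" by (intro span_diff assms perp)
  then have d: "perp S x - c \<in> span S" by simp
  have "(perp S x - c) \<bullet> (perp S x - c) = 0"
    using perp(2)[OF d, of x] assms(2)[OF d] by (simp add: inner_diff_left)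
  then show ?thesis by simp
qed

lemma linear_perp: "linear (perp S)"
proof (rule linearI)
  fix x y :: 'a and r :: real
  have "(x + y) - (perp S x + perp S y) = (x - perp S x) + (y - perp S y)" by simp
  then show "perp S (x + y) = perp S x + perp S y"
    by (intro perp_unique) (simp_all only: span_add perp inner_add_left add_0)
  have "r *\<^sub>R x - r *\<^sub>R perp S x = r *\<^sub>R (x - perp S x)" by (simp add: scaleR_diff_right)
  then show "perp S (r *\<^sub>R x) = r *\<^sub>R perp S x"
    by (intro perp_unique) (simp_all only: span_scale perp inner_scaleR_left mult_zero_right)
qed

lemma perp_eq_0_iff: "perp S x = 0 \<longleftrightarrow> x \<in> span S"
proof
  show "perp S x = 0 \<Longrightarrow> x \<in> span S" using perp(1)[of x S] by simp
  show "x \<in> span S \<Longrightarrow> perp S x = 0" by (rule perp_unique) auto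
qed

lemma norm_perp_split: "(norm x)\<^sup>2 = (norm (perp S x))\<^sup>2 + (norm (x - perp S x))\<^sup>2"
proof -
  have "perp S x \<bullet> (x - perp S x) = 0" by (intro perp)
  from norm_add_orth[OF this] show ?thesis by simp
qed

lemma agroup_linear_image:
  assumes "linear f" "agroup G" shows "agroup (f ` G)"
  using assms(2) unfolding agroup_def
  by (auto simp: image_iff linear_0[OF assms(1)] simp flip: linear_add[OF assms(1)] linear_neg[OF assms(1)])
    (metis linear_0[OF assms(1)])

lemma agroup_Int: "agroup G \<Longrightarrow> agroup H \<Longrightarrow> agroup (G \<inter> H)"
  unfolding agroup_def by auto

lemma agroup_span: "agroup (span S)"
  unfolding agroup_def by (auto intro: span_zero span_add span_neg)

lemma zspan_image: "linear f \<Longrightarrow> f ` zspan k b = zspan k (\<lambda>i. f (b i))"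
  unfolding zspan_def image_image by (simp add: linear_sum linear_scale)

text \<open>After subtracting a combination of the lifts \<open>c\<close> with the same projection,
  an element of \<open>G\<close> lies in the kernel of \<open>p\<close>, which is the span of
  \<open>b\<close>, and there \<open>b\<close> is a basis. The covolumes multiply by
  \<open>gdet_split\<close>.\<close>

lemma zbasis_glue:
  fixes b c :: "nat \<Rightarrow> 'a::euclidean_space" and G m
  defines "p \<equiv> perp (b ` {..<m})"
  assumes G: "agroup G" and b: "zbasis m b (G \<inter> span (b ` {..<m}))"
    and d: "zbasis q (\<lambda>i. p (c i)) (p ` G)" and c: "\<And>i. i < q \<Longrightarrow> c i \<in> G"
  defines "e \<equiv> (\<lambda>i. if i < m then b i else c (i - m))"
  shows "zbasis (m + q) e G" "gdet (m + q) e = gdet m b * gdet q (\<lambda>i. p (c i))"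
proof -
  have eb: "e ` {..<m} = b ` {..<m}" by (auto simp: e_def)
  have "gdet (m + q) e = gdet m e * gdet q (\<lambda>i. p (c i))"
  proof (rule gdet_split)
    show "e (m + i) - p (c i) \<in> span (e ` {..<m})" for i
      unfolding eb p_def by (simp add: e_def perp)
    show "p (c i) \<bullet> e j = 0" if "j < m" for i j
      unfolding p_def by (rule perp) (use that in \<open>auto simp: e_def intro: span_base\<close>)
  qed
  moreover have "gdet m e = gdet m b" by (rule gdet_cong) (simp add: e_def)
  ultimately show gd: "gdet (m + q) e = gdet m b * gdet q (\<lambda>i. p (c i))" by simp
  have bG: "b i \<in> G" if "i < m" for i using b that zspan_base unfolding zbasis_def by blast
  have app: "zspan (m + q) e = {x + y | x y. x \<in> zspan m e \<and> y \<in> zspan q c}"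
    by (rule zspan_append) (simp add: e_def)
  have zm: "zspan m e = G \<inter> span (b ` {..<m})"
    using b zspan_cong[of m e b] by (simp add: zbasis_def e_def)
  have "G = zspan (m + q) e"
  proof
    show "zspan (m + q) e \<subseteq> G" using bG c by (intro zspan_subset G) (simp add: e_def)
    show "G \<subseteq> zspan (m + q) e"
    proof
      fix x assume x: "x \<in> G"
      have lp: "linear p" unfolding p_def by (rule linear_perp)
      have "p x \<in> zspan q (\<lambda>i. p (c i))" using x d by (auto simp: zbasis_def)
      then obtain y where y: "y \<in> zspan q c" "p x = p y" using zspan_image[OF lp, of q c] by auto
      have "y \<in> G" using zspan_subset[OF G, of q c] y c by auto
      then have "x - y \<in> G" using x agroupD[OF G] by auto
      moreover have "x - y \<in> span (b ` {..<m})"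
        using y(2) linear_diff[OF lp, of x y] perp_eq_0_iff[of "b ` {..<m}" "x - y"] by (simp add: p_def)
      ultimately have "x - y \<in> zspan m e" using zm by simp
      then show "x \<in> zspan (m + q) e" unfolding app using y(1) by (metis (mono_tags, lifting) diff_add_cancel mem_Collect_eq)
    qed
  qed
  then show "zbasis (m + q) e G" using gd b d by (simp add: zbasis_def)
qed

lemma shortest_vector:
  fixes G :: "'a::euclidean_space set"
  assumes "agroup G" "m > 0" "\<And>x. x \<in> G \<Longrightarrow> x \<noteq> 0 \<Longrightarrow> norm x \<ge> m" "G \<noteq> {0}"
  obtains v where "v \<in> G" "v \<noteq> 0" "\<forall>x\<in>G. x \<noteq> 0 \<longrightarrow> norm v \<le> norm x"
proof -
  obtain x0 where x0: "x0 \<in> G" "x0 \<noteq> 0" using assms(4) agroupD(1)[OF assms(1)] by auto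
  let ?F = "{x \<in> G. norm x \<le> norm x0} - {0}"
  have "finite ?F" "?F \<noteq> {}" using discrete_finite_ball[OF assms(1-3)] x0 by auto
  from ex_min_if_finite[of "norm ` ?F"] this obtain r where r: "r \<in> norm ` ?F" "\<not> (\<exists>x\<in>norm ` ?F. x < r)" by auto
  then obtain v where v: "v \<in> ?F" "r = norm v" by auto
  show ?thesis
  proof (rule that[of v])
    show "v \<in> G" "v \<noteq> 0" using v by auto
    have "norm v \<le> norm x" if x: "x \<in> G" "x \<noteq> 0" for x
    proof (cases "norm x \<le> norm x0")
      case True
      then have "norm x \<in> norm ` ?F" using x by (intro imageI) auto
      then have "\<not> norm x < r" using r(2) by blast
      then show ?thesis using v by simp
    qed (use v in auto)
    then show "\<forall>x\<in>G. x \<noteq> 0 \<longrightarrow> norm v \<le> norm x" by blast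
  qed
qed

text \<open>Subtracting the nearest integer multiple of \<open>v\<close> leaves a coefficient along
  \<open>v\<close> of absolute value at most \<open>1 / 2\<close>; its square gives the
  \<open>1 / 4\<close>.\<close>

lemma size_reduce:
  fixes v x :: "'a::euclidean_space"
  assumes "agroup G" "v \<in> G" "x \<in> G"
  obtains y where "y \<in> G" "perp {v} y = perp {v} x" "(norm y)\<^sup>2 \<le> (norm (perp {v} x))\<^sup>2 + (norm v)\<^sup>2 / 4"
proof -
  let ?p = "perp {v}"
  obtain r where r: "x - ?p x = r *\<^sub>R v" using perp(1)[of x "{v}"] by (auto simp: span_singleton)
  define y where "y = x - of_int (round r) *\<^sub>R v"
  have yG: "y \<in> G" unfolding y_def by (intro agroupD(4)[OF assms(1)] agroup_scaleR_int assms)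
  have "?p v = 0" by (simp add: perp_eq_0_iff span_base)
  then have py: "?p y = ?p x" unfolding y_def
    by (simp add: linear_diff[OF linear_perp] linear_scale[OF linear_perp])
  have "y - ?p y = (r - of_int (round r)) *\<^sub>R v"
    unfolding py using r by (simp add: y_def scaleR_diff_left algebra_simps)
  then have "(norm (y - ?p y))\<^sup>2 = \<bar>r - of_int (round r)\<bar>\<^sup>2 * (norm v)\<^sup>2" by (simp add: power_mult_distrib)
  also have "\<dots> \<le> (1/2)\<^sup>2 * (norm v)\<^sup>2"
    using of_int_round_abs_le[of r] by (intro mult_right_mono power_mono) (auto simp: abs_minus_commute)
  finally have "(norm y)\<^sup>2 \<le> (norm (?p x))\<^sup>2 + (norm v)\<^sup>2 / 4"
    using norm_perp_split[of y "{v}"] py by (simp add: power_divide)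
  then show ?thesis using that[OF yG py] by blast
qed

text \<open>Korkine-Zolotarev style reduction: take a shortest vector, reduce the projection
  orthogonal to it, and lift back with \<open>size_reduce\<close>. \<open>R\<close> is chosen before
  \<open>G\<close>, which is what compactness requires. The bound is an implication inside the
  existential, so the lemma also yields the bare existence of bases.\<close>

lemma reduced_basis:
  assumes "m > 0"
  shows "\<exists>R. \<forall>G :: 'a::euclidean_space set. agroup G \<and> (\<forall>x\<in>G. x \<noteq> 0 \<longrightarrow> norm x \<ge> m) \<and> dim G \<le> n \<longrightarrow>
    (\<exists>k b. zbasis k b G \<and> (gdet k b \<le> D \<longrightarrow> (\<forall>i<k. norm (b i) \<le> R)))"
  using assms
proof (induction n arbitrary: m D)
  case 0
  have "zbasis 0 (\<lambda>_. 0) G" if "agroup G" "dim G \<le> 0" for G :: "'a set"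
  proof -
    have "G = {0}" using that agroupD(1)[OF that(1)] by (auto simp: dim_eq_0)
    then show ?thesis by (auto simp: zbasis_def zspan_def)
  qed
  then show ?case by fastforce
next
  case (Suc n)
  \<comment> \<open>Projection may shorten the minimal norm by the factor \<open>sqrt 3 / 2\<close>,
    and it divides the squared covolume by \<open>(norm v)\<^sup>2 \<ge> m\<^sup>2\<close>. These
    are the parameters at which the induction hypothesis is taken.\<close>
  have "m * (sqrt 3 / 2) > 0" using Suc.prems by simp
  from Suc.IH[OF this, of "D / m\<^sup>2"] obtain R' where R0: "\<forall>G :: 'a set. agroup G \<and>
      (\<forall>x\<in>G. x \<noteq> 0 \<longrightarrow> norm x \<ge> m * (sqrt 3 / 2)) \<and> dim G \<le> n \<longrightarrow>
      (\<exists>k b. zbasis k b G \<and> (gdet k b \<le> D / m\<^sup>2 \<longrightarrow> (\<forall>i<k. norm (b i) \<le> R')))" by (rule exE)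
  have R': "\<exists>k b. zbasis k b G \<and> (gdet k b \<le> D / m\<^sup>2 \<longrightarrow> (\<forall>i<k. norm (b i) \<le> R'))"
    if "agroup G" "\<And>x. x \<in> G \<Longrightarrow> x \<noteq> 0 \<Longrightarrow> norm x \<ge> m * (sqrt 3 / 2)" "dim G \<le> n" for G :: "'a set"
    using R0[rule_format, of G] that by simp
  \<comment> \<open>\<open>sqrt D\<close> serves rank one, where the squared covolume is
    \<open>(norm v)\<^sup>2\<close>. In higher rank \<open>v\<close> is no longer than the first
    lift, which gives \<open>(norm v)\<^sup>2 \<le> 4/3 * R'\<^sup>2\<close>, and then every lift
    obeys the same bound.\<close>
  define R where "R = max (sqrt D) (2 * \<bar>R'\<bar>)"
  have "\<exists>k b. zbasis k b G \<and> (gdet k b \<le> D \<longrightarrow> (\<forall>i<k. norm (b i) \<le> R))"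
    if G: "agroup G" and m: "\<And>x. x \<in> G \<Longrightarrow> x \<noteq> 0 \<Longrightarrow> norm x \<ge> m" and dim: "dim G \<le> Suc n" for G :: "'a set"
  proof (cases "G = {0}")
    case True
    then have "zbasis 0 (\<lambda>_. 0) G" by (auto simp: zbasis_def zspan_def)
    then show ?thesis by blast
  next
    case False
    obtain v where v: "v \<in> G" "v \<noteq> 0" "\<forall>x\<in>G. x \<noteq> 0 \<longrightarrow> norm v \<le> norm x"
      using shortest_vector[OF G Suc.prems m False] by metis
    let ?p = "perp {v}"
    have red: "\<exists>y\<in>G. ?p y = ?p x \<and> (norm y)\<^sup>2 \<le> (norm (?p x))\<^sup>2 + (norm v)\<^sup>2 / 4" if "x \<in> G" for x
      by (rule size_reduce[OF G v(1) that]) blast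
    \<comment> \<open>A reduced lift \<open>y\<close> of a nonzero \<open>w\<close> is at least as
      long as the shortest vector \<open>v\<close>, while it exceeds \<open>w\<close> in squared
      norm by at most a quarter of \<open>(norm v)\<^sup>2\<close>. So three quarters of
      \<open>(norm v)\<^sup>2\<close> remain for \<open>w\<close>.\<close>
    have pdisc: "norm w \<ge> m * (sqrt 3 / 2)" if w: "w \<in> ?p ` G" "w \<noteq> 0" for w
    proof -
      obtain y where y: "y \<in> G" "?p y = w" "(norm y)\<^sup>2 \<le> (norm w)\<^sup>2 + (norm v)\<^sup>2 / 4"
        using w(1) red by blast
      have "y \<noteq> 0" using y w(2) linear_0[OF linear_perp, of "{v}"] by auto
      then have "(norm v)\<^sup>2 \<le> (norm y)\<^sup>2" using v(3) y(1) by (intro power_mono) auto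
      then have "(norm v)\<^sup>2 * 3 / 4 \<le> (norm w)\<^sup>2" using y(3) by linarith
      moreover have "m\<^sup>2 \<le> (norm v)\<^sup>2" using m v Suc.prems by (intro power_mono) auto
      ultimately have "(m * (sqrt 3 / 2))\<^sup>2 \<le> (norm w)\<^sup>2" by (simp add: power_mult_distrib power_divide)
      then show ?thesis by (rule power2_le_imp_le) simp
    qed
    \<comment> \<open>The projected group stays inside \<open>span G\<close> but is orthogonal to
      \<open>v\<close>, so it spans a proper subspace.\<close>
    have dimp: "dim (?p ` G) \<le> n"
    proof -
      have "?p x \<in> span G" if "x \<in> G" for x
      proof -
        have "x - ?p x \<in> span G" using perp(1)[of x "{v}"] v(1) span_mono[of "{v}" G] by auto
        then have "x - (x - ?p x) \<in> span G" by (rule span_diff[OF span_base[OF that]])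
        then show ?thesis by simp
      qed
      then have sub: "span (?p ` G) \<subseteq> span G" by (intro span_minimal) auto
      have sub0: "span (?p ` G) \<subseteq> {x. x \<bullet> v = 0}"
        by (rule span_minimal) (auto intro!: subspaceI perp simp: span_base inner_add_left)
      have "span (?p ` G) \<noteq> span G"
      proof
        assume "span (?p ` G) = span G"
        then have "v \<in> span (?p ` G)" using span_base[OF v(1)] by simp
        then have "v \<bullet> v = 0" using subsetD[OF sub0] by simp
        then show False using v(2) by simp
      qed
      then have "span (?p ` G) \<subset> span G" using sub by (rule psubsetI[rotated])
      then have "dim (?p ` G) < dim G" by (rule dim_psubset)
      then show ?thesis using dim by simp
    qed
    from R'[OF agroup_linear_image[OF linear_perp G] pdisc dimp] obtain q d where
      d: "zbasis q d (?p ` G)" "gdet q d \<le> D / m\<^sup>2 \<Longrightarrow> (\<forall>i<q. norm (d i) \<le> R')" by blast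
    have ex: "\<forall>i. \<exists>y. i < q \<longrightarrow> y \<in> G \<and> ?p y = d i \<and> (norm y)\<^sup>2 \<le> (norm (d i))\<^sup>2 + (norm v)\<^sup>2 / 4"
    proof
      fix i
      show "\<exists>y. i < q \<longrightarrow> y \<in> G \<and> ?p y = d i \<and> (norm y)\<^sup>2 \<le> (norm (d i))\<^sup>2 + (norm v)\<^sup>2 / 4"
      proof (cases "i < q")
        case True
        then have "d i \<in> ?p ` G" using d(1) zspan_base by (auto simp: zbasis_def)
        then obtain x where "x \<in> G" "d i = ?p x" by (rule imageE)
        then show ?thesis using red[of x] by auto
      qed simp
    qed
    from choice[OF ex] obtain c where
      c0: "\<forall>i. i < q \<longrightarrow> c i \<in> G \<and> ?p (c i) = d i \<and> (norm (c i))\<^sup>2 \<le> (norm (d i))\<^sup>2 + (norm v)\<^sup>2 / 4"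
      by (rule exE)
    then have c: "\<And>i. i < q \<Longrightarrow> c i \<in> G" "\<And>i. i < q \<Longrightarrow> ?p (c i) = d i"
      "\<And>i. i < q \<Longrightarrow> (norm (c i))\<^sup>2 \<le> (norm (d i))\<^sup>2 + (norm v)\<^sup>2 / 4" by simp_all
    let ?b = "\<lambda>_::nat. v"
    have im: "?b ` {..<Suc 0} = {v}" by auto
    \<comment> \<open>A shortest vector is primitive: the rounding remainder of an element of
      \<open>G\<close> on its line is shorter than \<open>v\<close>, hence zero.\<close>
    have "zspan (Suc 0) ?b = G \<inter> span {v}"
    proof
      show "zspan (Suc 0) ?b \<subseteq> G \<inter> span {v}"
        using zspan_subset[OF G, of "Suc 0" ?b] v(1) zspan_subset_span[of "Suc 0" ?b] by (auto simp: im)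
      show "G \<inter> span {v} \<subseteq> zspan (Suc 0) ?b"
      proof
        fix x assume x: "x \<in> G \<inter> span {v}"
        then obtain r where r: "x = r *\<^sub>R v" by (auto simp: span_singleton)
        let ?y = "x - of_int (round r) *\<^sub>R v"
        have yG: "?y \<in> G" using x by (intro agroupD(4)[OF G] agroup_scaleR_int G v) auto
        have "?y = (r - of_int (round r)) *\<^sub>R v" by (simp add: r scaleR_diff_left)
        then have "norm ?y = \<bar>r - of_int (round r)\<bar> * norm v" by simp
        also have "\<dots> \<le> 1/2 * norm v"
          using of_int_round_abs_le[of r] by (intro mult_right_mono) (auto simp: abs_minus_commute)
        also have "\<dots> < norm v" using v(2) by simp
        finally have "?y = 0" using v(3)[rule_format, OF yG] by linarith
        then show "x \<in> zspan (Suc 0) ?b" by (intro zspanI[where c="\<lambda>_. round r"]) simp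
      qed
    qed
    then have zb: "zbasis (Suc 0) ?b (G \<inter> span (?b ` {..<Suc 0}))" using v(2) by (simp add: zbasis_def im)
    have dc: "gdet q (\<lambda>i. ?p (c i)) = gdet q d" "zspan q (\<lambda>i. ?p (c i)) = zspan q d"
      by (rule gdet_cong zspan_cong, erule c(2))+
    have zd: "zbasis q (\<lambda>i. perp (?b ` {..<Suc 0}) (c i)) (perp (?b ` {..<Suc 0}) ` G)"
      using d(1) dc by (simp add: im zbasis_def)
    define e where "e = (\<lambda>i. if i < Suc 0 then v else c (i - Suc 0))"
    have e: "zbasis (Suc 0 + q) e G" "gdet (Suc 0 + q) e = (norm v)\<^sup>2 * gdet q d"
      using zbasis_glue[OF G zb zd c(1)] dc by (simp_all only: e_def im gdet_1)
    have "norm (e i) \<le> R" if D: "gdet (Suc 0 + q) e \<le> D" and i: "i < Suc 0 + q" for i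
    proof -
      have D0: "D \<ge> 0" by (rule order_trans[OF gdet_nonneg D])
      have mv: "m\<^sup>2 \<le> (norm v)\<^sup>2" using m v Suc.prems by (intro power_mono) auto
      have "m\<^sup>2 * gdet q d \<le> D" using D e(2) mult_right_mono[OF mv gdet_nonneg[of q d]] by linarith
      then have "gdet q d \<le> D / m\<^sup>2" using Suc.prems by (simp add: field_simps)
      from d(2)[OF this] have dR: "norm (d i) \<le> R'" if "i < q" for i using that by simp
      then have cR: "(norm (c i))\<^sup>2 \<le> R'\<^sup>2 + (norm v)\<^sup>2 / 4" if "i < q" for i
        using c(3)[OF that] power_mono[OF dR[OF that], of 2] by simp
      show ?thesis
      proof (cases "q = 0")
        case True
        then have "(norm v)\<^sup>2 \<le> D" using D e(2) by simp
        then have "norm v \<le> sqrt D" by (rule real_le_rsqrt)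
        then show ?thesis using i True by (simp add: e_def R_def)
      next
        case False
        have cn0: "c 0 \<noteq> 0"
        proof
          assume "c 0 = 0"
          then have "d 0 = 0" using c(2)[of 0] False linear_0[OF linear_perp, of "{v}"] by simp
          then have "gdet q d = 0"
            using d(1) gdet_nz_imp_independent(2)[of q d] False dependent_zero[of "d ` {..<q}"] by (auto simp: zbasis_def image_iff)
          then show False using d(1) by (simp add: zbasis_def)
        qed
        have "norm v \<le> norm (c 0)" using v(3)[rule_format, OF c(1)[of 0] cn0] False by simp
        then have "(norm v)\<^sup>2 \<le> (norm (c 0))\<^sup>2" by (intro power_mono) auto
        then have v2: "(norm v)\<^sup>2 \<le> 4/3 * R'\<^sup>2" using cR[of 0] False by linarith
        have "(norm (e i))\<^sup>2 \<le> 4/3 * R'\<^sup>2"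
        proof (cases "i = 0")
          case True
          then show ?thesis using v2 by (simp add: e_def)
        next
          case False
          then have iq: "i - Suc 0 < q" using i by simp
          have ei: "e i = c (i - Suc 0)" using False by (simp add: e_def)
          show ?thesis unfolding ei using v2 cR[OF iq] by linarith
        qed
        also have "\<dots> \<le> (2 * \<bar>R'\<bar>)\<^sup>2" by (simp add: power_mult_distrib)
        finally have "norm (e i) \<le> 2 * \<bar>R'\<bar>" by (rule power2_le_imp_le) simp
        then show ?thesis by (simp add: R_def)
      qed
    qed
    then show ?thesis using e(1) by blast
  qed
  then show ?case by blast
qed

section \<open>Poisson summation\<close>

lemma gauss_int_summable:
  fixes t :: real
  assumes "t > 0"
  shows "(\<lambda>m::int. exp (- t * (of_int m)\<^sup>2)) summable_on UNIV"
proof -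
  have "summable (\<lambda>n. exp (- t) ^ n)" using assms by (intro summable_geometric) simp
  then have geo: "(\<lambda>n. exp (- t) ^ n) summable_on (UNIV :: nat set)"
    by (simp add: summable_on_UNIV_nonneg_real_iff)
  have nat: "(\<lambda>n::nat. exp (- t * (of_nat n)\<^sup>2)) summable_on UNIV"
  proof (rule summable_on_comparison_test[OF geo])
    fix n :: nat
    have "real n \<le> (real n)\<^sup>2" by (cases n) (simp_all add: power2_eq_square)
    then have "- t * (real n)\<^sup>2 \<le> real n * (- t)" using assms by simp
    then show "exp (- t * (real n)\<^sup>2) \<le> exp (- t) ^ n" by (simp flip: exp_of_nat_mult)
  qed simp
  have "(\<lambda>m::int. exp (- t * (of_int m)\<^sup>2)) summable_on range int"
    using nat by (subst summable_on_reindex) (auto simp: o_def inj_on_def)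
  moreover have "(\<lambda>m::int. exp (- t * (of_int m)\<^sup>2)) summable_on range (\<lambda>n. - int n)"
    using nat by (subst summable_on_reindex) (auto simp: o_def inj_on_def)
  ultimately have "(\<lambda>m::int. exp (- t * (of_int m)\<^sup>2)) summable_on (range int \<union> range (\<lambda>n. - int n))"
    by (rule summable_on_union)
  moreover have "range int \<union> range (\<lambda>n. - int n) = UNIV"
  proof -
    have "m \<in> range int \<union> range (\<lambda>n. - int n)" for m :: int
      by (cases "m \<ge> 0") (auto simp: image_iff intro: exI[of _ "nat m"] exI[of _ "nat (- m)"])
    then show ?thesis by auto
  qed
  ultimately show ?thesis by simp
qed

text \<open>Equivalent to \<open>(m + 2 * x)\<^sup>2 \<ge> 0\<close>. The first factor depends on
  \<open>x\<close> only and the Gaussian on \<open>m\<close> only, which gives one majorant for all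
  \<open>x\<close> in a bounded interval.\<close>

lemma gauss_shift_bound:
  fixes t x m :: real
  assumes "t > 0"
  shows "exp (- t * (m + x)\<^sup>2) \<le> exp (t * x\<^sup>2) * exp (- (t/2) * m\<^sup>2)"
proof -
  have "0 \<le> (m + 2 * x)\<^sup>2" by simp
  then have "m\<^sup>2 / 2 - x\<^sup>2 \<le> (m + x)\<^sup>2" by (simp add: power2_eq_square algebra_simps)
  from mult_left_mono[OF this, of t] assms have "- t * (m + x)\<^sup>2 \<le> t * x\<^sup>2 + (- (t/2) * m\<^sup>2)"
    by (simp add: algebra_simps)
  then show ?thesis by (simp flip: exp_add)
qed

lemma gauss_int_shift_summable:
  fixes t x :: real
  assumes "t > 0"
  shows "(\<lambda>m::int. exp (- t * (of_int m + x)\<^sup>2)) summable_on UNIV"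
proof (rule summable_on_comparison_test)
  show "(\<lambda>m::int. exp (t * x\<^sup>2) * exp (- (t/2) * (of_int m)\<^sup>2)) summable_on UNIV"
    using assms by (intro summable_on_cmult_right gauss_int_summable) simp
  show "exp (- t * (of_int m + x)\<^sup>2) \<le> exp (t * x\<^sup>2) * exp (- (t/2) * (of_int m)\<^sup>2)" for m :: int
    by (rule gauss_shift_bound[OF assms])
qed simp

section \<open>Uniqueness of Fourier coefficients of continuous periodic functions\<close>

lemma continuous_on_poly_cis:
  assumes "real_polynomial_function (p :: complex \<Rightarrow> real)"
  shows "continuous_on S (\<lambda>x::real. p (cis (2 * pi * x)))"
proof -
  have p: "continuous_on UNIV p"
    using continuous_real_polymonial_function[OF assms] by (simp add: continuous_at_imp_continuous_on)
  show ?thesis by (rule continuous_on_compose2[OF p]) (auto intro!: continuous_intros)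
qed

text \<open>The induction works because a linear function of \<open>cis\<close> is a combination of \<open>cis\<close> and its conjugate, so that
  multiplying by it only shifts Fourier coefficients.\<close>

lemma fourier_coeff_polynomial:
  fixes p :: "complex \<Rightarrow> real" and u :: "real \<Rightarrow> complex"
  assumes "real_polynomial_function p" "continuous_on {0..1} u"
    and "\<And>l::int. integral {0..1} (\<lambda>x. u x * cis (2 * pi * of_int l * x)) = 0"
  shows "integral {0..1} (\<lambda>x. u x * of_real (p (cis (2 * pi * x))) * cis (2 * pi * of_int l * x)) = 0"
  using assms
proof (induction p arbitrary: u l rule: real_polynomial_function.induct)
  case (linear f)
  interpret bounded_linear f by (rule linear)
  have f: "f (cis y) = cos y * f 1 + sin y * f \<i>" for y
  proof -
    have "cis y = cos y *\<^sub>R 1 + sin y *\<^sub>R \<i>" by (simp add: complex_eq_iff)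
    then show ?thesis by (metis add scaleR real_scaleR_def)
  qed
  define A where "A = (of_real (f 1) - \<i> * of_real (f \<i>)) / 2"
  define B where "B = (of_real (f 1) + \<i> * of_real (f \<i>)) / 2"
  have fAB: "of_real (f (cis y)) = A * cis y + B * cis (- y)" for y
    unfolding f A_def B_def by (simp add: complex_eq_iff field_simps)
  have cont: "continuous_on {0..1} (\<lambda>x. c * (u x * cis (2 * pi * of_int k * x)))" for c and k :: int
    using linear.prems(1) by (intro continuous_intros) auto
  have "(\<lambda>x. u x * of_real (f (cis (2 * pi * x))) * cis (2 * pi * of_int l * x))
      = (\<lambda>x. A * (u x * cis (2 * pi * of_int (l + 1) * x)) + B * (u x * cis (2 * pi * of_int (l - 1) * x)))"
  proof
    fix x
    have "cis (2 * pi * x) * cis (2 * pi * of_int l * x) = cis (2 * pi * of_int (l + 1) * x)"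
      "cis (- (2 * pi * x)) * cis (2 * pi * of_int l * x) = cis (2 * pi * of_int (l - 1) * x)"
      by (simp_all add: cis_mult algebra_simps)
    then show "u x * of_real (f (cis (2 * pi * x))) * cis (2 * pi * of_int l * x)
      = A * (u x * cis (2 * pi * of_int (l + 1) * x)) + B * (u x * cis (2 * pi * of_int (l - 1) * x))"
      unfolding fAB by (simp add: algebra_simps)
  qed
  then have "integral {0..1} (\<lambda>x. u x * of_real (f (cis (2 * pi * x))) * cis (2 * pi * of_int l * x))
      = integral {0..1} (\<lambda>x. A * (u x * cis (2 * pi * of_int (l + 1) * x)))
      + integral {0..1} (\<lambda>x. B * (u x * cis (2 * pi * of_int (l - 1) * x)))"
    using cont by (simp only:) (intro Henstock_Kurzweil_Integration.integral_add integrable_continuous_real; simp only: cont)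
  also have "\<dots> = 0"
    by (simp only: integral_mult_right linear.prems(2) mult_zero_right add_0)
  finally show ?case .
next
  case (const c)
  have "(\<lambda>x. u x * of_real c * cis (2 * pi * of_int l * x)) = (\<lambda>x. of_real c * (u x * cis (2 * pi * of_int l * x)))"
    by (simp add: mult_ac)
  then show ?case by (simp only: integral_mult_right const.prems(2) mult_zero_right)
next
  case (add f g)
  have cont: "continuous_on {0..1} (\<lambda>x. u x * of_real (f (cis (2 * pi * x))) * cis (2 * pi * of_int l * x))"
    if "real_polynomial_function f" for f
    by (intro continuous_intros add.prems(1) continuous_on_poly_cis that)
  have "(\<lambda>x. u x * of_real (f (cis (2 * pi * x)) + g (cis (2 * pi * x))) * cis (2 * pi * of_int l * x))
    = (\<lambda>x. u x * of_real (f (cis (2 * pi * x))) * cis (2 * pi * of_int l * x)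
        + u x * of_real (g (cis (2 * pi * x))) * cis (2 * pi * of_int l * x))"
    by (simp add: algebra_simps)
  moreover have "integral {0..1} (\<lambda>x. u x * of_real (f (cis (2 * pi * x))) * cis (2 * pi * of_int l * x)
        + u x * of_real (g (cis (2 * pi * x))) * cis (2 * pi * of_int l * x)) =
     integral {0..1} (\<lambda>x. u x * of_real (f (cis (2 * pi * x))) * cis (2 * pi * of_int l * x))
     + integral {0..1} (\<lambda>x. u x * of_real (g (cis (2 * pi * x))) * cis (2 * pi * of_int l * x))"
    by (intro Henstock_Kurzweil_Integration.integral_add integrable_continuous_real cont add.hyps)
  ultimately show ?case using add.IH add.prems by simp
next
  case (mult f g)
  have cf: "continuous_on {0..1} (\<lambda>x. u x * of_real (f (cis (2 * pi * x))))"
    by (intro continuous_intros mult.prems(1) continuous_on_poly_cis mult.hyps)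
  have "integral {0..1} (\<lambda>x. (u x * of_real (f (cis (2 * pi * x)))) * of_real (g (cis (2 * pi * x))) * cis (2 * pi * of_int l * x)) = 0"
    by (rule mult.IH(2)[OF cf]) (rule mult.IH(1)[OF mult.prems])
  then show ?case by (simp add: mult_ac)
qed

text \<open>The interval is compact, so wrapping it around the circle is a closed map and
  \<open>g\<close> descends continuously. On the circle, a compact set in the plane, polynomial
  approximation is available.\<close>

lemma continuous_on_circle:
  fixes g :: "real \<Rightarrow> 'a::topological_space"
  assumes "continuous_on {0..1} g" "g 0 = g 1"
  obtains H where "continuous_on (sphere (0::complex) 1) H" "\<And>x. x \<in> {0..1} \<Longrightarrow> H (cis (2 * pi * x)) = g x"
proof -
  let ?e = "\<lambda>x::real. cis (2 * pi * x)"
  have eq: "g x = g y" if "x \<in> {0..1}" "y \<in> {0..1}" "?e x = ?e y" for x y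
  proof -
    from that(3) have "sin (2 * pi * x) = sin (2 * pi * y) \<and> cos (2 * pi * x) = cos (2 * pi * y)"
      by (simp add: complex_eq_iff)
    then obtain n :: int where "2 * pi * x = 2 * pi * y + 2 * pi * of_int n"
      unfolding sin_cos_eq_iff by auto
    then have "2 * pi * x = 2 * pi * (y + of_int n)" by (simp add: algebra_simps)
    then have n: "x = y + of_int n" by simp
    then have "n \<ge> -1" "n \<le> 1" using that(1,2) by auto
    then consider "n = -1" | "n = 0" | "n = 1" by linarith
    then show ?thesis using n that(1,2) assms(2) by cases auto
  qed
  define H where "H z = g (SOME x. x \<in> {0..1} \<and> ?e x = z)" for z
  have H: "H (?e x) = g x" if "x \<in> {0..1}" for x
  proof -
    have "\<exists>y. y \<in> {0..1} \<and> ?e y = ?e x" using that by blast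
    from someI_ex[OF this] show ?thesis unfolding H_def by (intro eq that) auto
  qed
  have surj: "\<exists>x\<in>{0..1}. z = ?e x" if z: "z \<in> sphere 0 1" for z
  proof -
    have "(Re z)\<^sup>2 + (Im z)\<^sup>2 = 1" using z by (simp add: cmod_def)
    then obtain t where t: "0 \<le> t" "t < 2 * pi" "Re z = cos t" "Im z = sin t"
      by (rule sincos_total_2pi)
    then have "z = ?e (t / (2 * pi))" "t / (2 * pi) \<in> {0..1}" by (auto simp: complex_eq_iff)
    then show ?thesis by blast
  qed
  have "continuous_on (sphere 0 1) H"
    unfolding continuous_on_closed_vimage[OF closed_sphere]
  proof (intro allI impI)
    fix B :: "'a set" assume B: "closed B"
    have "H -` B \<inter> sphere 0 1 = ?e ` (g -` B \<inter> {0..1})"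
    proof (intro subset_antisym subsetI)
      fix z assume z: "z \<in> H -` B \<inter> sphere 0 1"
      then obtain x where "x \<in> {0..1}" "z = ?e x" using surj by blast
      then show "z \<in> ?e ` (g -` B \<inter> {0..1})" using z H by auto
    qed (use H in auto)
    moreover have "closed (g -` B \<inter> {0..1})"
      using assms(1) B continuous_on_closed_vimage[of "{0..1::real}" g] by auto
    then have "compact (g -` B \<inter> {0..1})"
      by (intro compact_Int_closed[of "{0..1}" "g -` B \<inter> {0..1}", simplified Int_absorb1 Int_commute] | simp add: compact_eq_bounded_closed bounded_Int)+
    then have "compact (?e ` (g -` B \<inter> {0..1}))"
      by (intro compact_continuous_image continuous_intros)
    ultimately show "closed (H -` B \<inter> sphere 0 1)" by (simp add: compact_imp_closed)
  qed
  then show ?thesis using H that by blast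
qed

text \<open>\<open>u\<close> is orthogonal to all polynomials on the circle. Approximating the
  conjugate of \<open>u\<close> by them bounds the integral of \<open>(norm (u x))\<^sup>2\<close>
  by an arbitrary positive \<open>e\<close>.\<close>

lemma fourier_unique:
  fixes u :: "real \<Rightarrow> complex"
  assumes u: "continuous_on {0..1} u" "u 0 = u 1"
    and 0: "\<And>l::int. integral {0..1} (\<lambda>x. u x * cis (2 * pi * of_int l * x)) = 0"
    and x: "x \<in> {0..1}"
  shows "u x = 0"
proof -
  obtain H where H: "continuous_on (sphere (0::complex) 1) H" "\<And>x. x \<in> {0..1} \<Longrightarrow> H (cis (2 * pi * x)) = u x"
    by (rule continuous_on_circle[OF u]) blast
  have nu: "continuous_on {0..1} (\<lambda>x. (norm (u x))\<^sup>2)" by (intro continuous_intros u)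
  define I where "I = integral {0..1} (\<lambda>x. (norm (u x))\<^sup>2)"
  have "bounded (u ` {0..1})" by (intro compact_imp_bounded compact_continuous_image u(1)) simp
  then obtain M where "\<forall>y\<in>u ` {0..1}. norm y \<le> M" unfolding bounded_iff by (rule exE)
  then have M: "norm (u x) \<le> M" if "x \<in> {0..1}" for x using that by simp
  have "I \<le> e" if e: "e > 0" for e
  proof -
    \<comment> \<open>\<open>K\<close> is a positive bound for the norm of \<open>u\<close>, and
      \<open>d\<close> is set so that the final error \<open>K * (2 * d)\<close> equals
      \<open>e\<close>; real and imaginary parts contribute \<open>d\<close> each.\<close>
    define K where "K = \<bar>M\<bar> + 1"
    have K: "K > 0" "M \<le> K" by (auto simp: K_def)
    define d where "d = e / (2 * K)"
    have d: "d > 0" using e K by (simp add: d_def)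
    have cR: "continuous_on (sphere 0 1) (\<lambda>z. Re (H z))" "continuous_on (sphere 0 1) (\<lambda>z. Im (H z))"
      by (intro continuous_intros H)+
    obtain p where p: "real_polynomial_function p" "\<And>z. z \<in> sphere 0 1 \<Longrightarrow> \<bar>Re (H z) - p z\<bar> < d"
      by (rule Stone_Weierstrass_real_polynomial_function[OF compact_sphere cR(1) d]) blast
    obtain q where q: "real_polynomial_function q" "\<And>z. z \<in> sphere 0 1 \<Longrightarrow> \<bar>Im (H z) - q z\<bar> < d"
      by (rule Stone_Weierstrass_real_polynomial_function[OF compact_sphere cR(2) d]) blast
    let ?P = "\<lambda>x. of_real (p (cis (2 * pi * x))) :: complex"
    let ?Q = "\<lambda>x. of_real (q (cis (2 * pi * x))) :: complex"
    have cpq: "continuous_on {0..1} ?P" "continuous_on {0..1} ?Q"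
      by (intro continuous_intros continuous_on_poly_cis p q)+
    have iP: "integral {0..1} (\<lambda>x. u x * ?P x) = 0"
      using fourier_coeff_polynomial[OF p(1) u(1) 0, of 0] by simp
    have iQ: "integral {0..1} (\<lambda>x. u x * ?Q x) = 0"
      using fourier_coeff_polynomial[OF q(1) u(1) 0, of 0] by simp
    have hP: "((\<lambda>x. u x * ?P x) has_integral 0) {0..1}"
      using integrable_integral[OF integrable_continuous_real[OF continuous_on_mult[OF u(1) cpq(1)]]]
      unfolding iP .
    have hQ: "((\<lambda>x. u x * ?Q x) has_integral 0) {0..1}"
      using integrable_integral[OF integrable_continuous_real[OF continuous_on_mult[OF u(1) cpq(2)]]]
      unfolding iQ .
    \<comment> \<open>\<open>?P - \<i> * ?Q\<close> is the polynomial approximation to the conjugate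
      of \<open>u\<close>; the sign of the second term comes from the conjugation.\<close>
    have PQ: "((\<lambda>x. u x * ?P x - \<i> * (u x * ?Q x)) has_integral 0) {0..1}"
      using has_integral_diff[OF hP has_integral_mult_right[OF hQ, of \<i>]] by simp
    have "((\<lambda>x. (norm (u x))\<^sup>2) has_integral I) {0..1}"
      unfolding I_def by (intro integrable_integral integrable_continuous_real nu)
    then have "((\<lambda>x. complex_of_real ((norm (u x))\<^sup>2)) has_integral complex_of_real I) {0..1}"
      by (rule has_integral_of_real)
    from has_integral_diff[OF this PQ]
    have hi: "((\<lambda>x. complex_of_real ((norm (u x))\<^sup>2) - (u x * ?P x - \<i> * (u x * ?Q x))) has_integral complex_of_real I) {0..1}"
      by simp
    have "norm (complex_of_real I) \<le> (M * (2 * d)) * measure lborel (cbox 0 (1::real))"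
    proof (rule has_integral_bound[OF _ hi[unfolded cbox_interval[symmetric]]])
      have "norm (u 0) \<le> M" using M[of 0] by simp
      then show "0 \<le> M * (2 * d)" using d norm_ge_zero[of "u 0"] by (intro mult_nonneg_nonneg) linarith+
      fix x :: real assume "x \<in> cbox 0 1"
      then have x: "x \<in> {0..1}" by simp
      have z: "cis (2 * pi * x) \<in> sphere 0 1" by simp
      have "complex_of_real ((norm (u x))\<^sup>2) = u x * cnj (u x)" by (rule complex_norm_square)
      also have "\<dots> - (u x * ?P x - \<i> * (u x * ?Q x)) = u x * (cnj (u x) - (?P x - \<i> * ?Q x))"
        by (simp add: algebra_simps)
      finally have eq: "complex_of_real ((norm (u x))\<^sup>2) - (u x * ?P x - \<i> * (u x * ?Q x)) = u x * (cnj (u x) - (?P x - \<i> * ?Q x))" .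
      have "norm (cnj (u x) - (?P x - \<i> * ?Q x)) \<le> \<bar>Re (cnj (u x) - (?P x - \<i> * ?Q x))\<bar> + \<bar>Im (cnj (u x) - (?P x - \<i> * ?Q x))\<bar>"
        by (rule cmod_le)
      also have "\<dots> \<le> d + d"
        using p(2)[OF z] q(2)[OF z] H(2)[OF x] by (intro add_mono) (simp_all add: abs_minus_commute)
      finally have "norm (cnj (u x) - (?P x - \<i> * ?Q x)) \<le> 2 * d" by simp
      then show "norm (complex_of_real ((norm (u x))\<^sup>2) - (u x * ?P x - \<i> * (u x * ?Q x))) \<le> M * (2 * d)"
        unfolding eq norm_mult using M[OF x] d by (intro mult_mono) (auto intro: order_trans[OF norm_ge_zero])
    qed
    then have "I \<le> M * (2 * d)" by simp
    also have "\<dots> \<le> K * (2 * d)" using d K by (intro mult_right_mono) auto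
    also have "\<dots> = e" using K by (simp add: d_def)
    finally show ?thesis .
  qed
  then have I0: "I \<le> 0" by (rule field_le_epsilon[of I 0, simplified])
  have "((\<lambda>x. (norm (u x))\<^sup>2) has_integral 0) (cbox 0 1)"
  proof -
    have "((\<lambda>x. (norm (u x))\<^sup>2) has_integral I) {0..1}"
      unfolding I_def by (intro integrable_integral integrable_continuous_real nu)
    moreover from this have "I \<ge> 0" by (rule has_integral_nonneg) simp
    ultimately show ?thesis using I0 by simp
  qed
  then have "(norm (u x))\<^sup>2 = 0"
    using nu x by (intro has_integral_0_cbox_imp_0[of 0 1 "\<lambda>x. (norm (u x))\<^sup>2" x]) auto
  then show ?thesis by simp
qed

section \<open>Poisson summation in one variable\<close>

lemma infsum_int_integral:
  fixes f :: "int \<Rightarrow> real \<Rightarrow> complex"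
  assumes c: "\<And>m. continuous_on {0..1} (f m)"
    and M: "\<And>m x. x \<in> {0..1} \<Longrightarrow> norm (f m x) \<le> M m" "M summable_on UNIV"
  shows "continuous_on {0..1} (\<lambda>x. \<Sum>\<^sub>\<infinity>m. f m x)"
    and "((\<lambda>m. integral {0..1} (f m)) has_sum integral {0..1} (\<lambda>x. \<Sum>\<^sub>\<infinity>m. f m x)) UNIV"
proof -
  have ul: "uniform_limit {0..1} (\<lambda>X x. \<Sum>m\<in>X. f m x) (\<lambda>x. \<Sum>\<^sub>\<infinity>m. f m x) (finite_subsets_at_top UNIV)"
    by (rule Weierstrass_m_test_general[OF M])
  have cs: "continuous_on {0..1} (\<lambda>x. \<Sum>m\<in>X. f m x)" for X by (intro continuous_on_sum c)
  show "continuous_on {0..1} (\<lambda>x. \<Sum>\<^sub>\<infinity>m. f m x)"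
    by (rule uniform_limit_theorem[OF _ ul]) (simp_all add: cs)
  obtain I J where IJ: "\<forall>X. ((\<lambda>x. \<Sum>m\<in>X. f m x) has_integral I X) {0..1}"
    "((\<lambda>x. \<Sum>\<^sub>\<infinity>m. f m x) has_integral J) {0..1}" "(I \<longlongrightarrow> J) (finite_subsets_at_top UNIV)"
    by (rule uniform_limit_integral[OF ul cs]) (simp, rule that, simp_all)
  have IX: "I X = (\<Sum>m\<in>X. integral {0..1} (f m))" if "finite X" for X
  proof -
    have "((\<lambda>x. \<Sum>m\<in>X. f m x) has_integral (\<Sum>m\<in>X. integral {0..1} (f m))) {0..1}"
      by (intro has_integral_sum that integrable_integral integrable_continuous_real c)
    then show ?thesis using has_integral_unique[OF IJ(1)[rule_format]] by simp
  qed
  have "((\<lambda>X. \<Sum>m\<in>X. integral {0..1} (f m)) \<longlongrightarrow> J) (finite_subsets_at_top UNIV)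
      \<longleftrightarrow> (I \<longlongrightarrow> J) (finite_subsets_at_top UNIV)"
    by (rule tendsto_cong, rule eventually_finite_subsets_at_top_weakI) (simp add: IX)
  then show "((\<lambda>m. integral {0..1} (f m)) has_sum integral {0..1} (\<lambda>x. \<Sum>\<^sub>\<infinity>m. f m x)) UNIV"
    using IJ(2,3) by (simp add: has_sum_def integral_unique)
qed

lemma integral_cis_int:
  "integral {0..1} (\<lambda>x. cis (2 * pi * of_int l * x)) = (if l = 0 then 1 else 0)"
proof (cases "l = 0")
  case False
  have "((\<lambda>x. cis (2 * pi * of_int l * x)) has_integral
      cis (2 * pi * of_int l * 1) / (\<i> * of_real (2 * pi * of_int l)) - cis (2 * pi * of_int l * 0) / (\<i> * of_real (2 * pi * of_int l))) {0..1}"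
  proof (rule fundamental_theorem_of_calculus)
    fix x :: real
    have "((\<lambda>z. exp (\<i> * of_real (2 * pi * of_int l) * z) / (\<i> * of_real (2 * pi * of_int l)))
      has_field_derivative exp (\<i> * of_real (2 * pi * of_int l) * of_real x)) (at (of_real x))"
      using False by (auto intro!: derivative_eq_intros)
    from has_vector_derivative_real_field[OF this]
    have "((\<lambda>x. exp (\<i> * of_real (2 * pi * of_int l) * of_real x) / (\<i> * of_real (2 * pi * of_int l)))
      has_vector_derivative exp (\<i> * of_real (2 * pi * of_int l) * of_real x)) (at x within {0..1})" by simp
    then show "((\<lambda>x. cis (2 * pi * of_int l * x) / (\<i> * of_real (2 * pi * of_int l)))
      has_vector_derivative cis (2 * pi * of_int l * x)) (at x within {0..1})"
      by (simp add: cis_conv_exp mult_ac)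
  qed simp
  moreover have "cis (2 * pi * of_int l * 1) = 1" by (simp add: complex_eq_iff cos_int_2pin sin_int_2pin)
  ultimately show ?thesis using False by (simp add: integral_unique)
qed simp

text \<open>The characteristic function of the standard normal law, after substituting
  \<open>c * x\<close> for \<open>x\<close> with \<open>c\<^sup>2 = 2 * t\<close>.\<close>

lemma gauss_fourier:
  fixes t w :: real
  assumes t: "t > 0"
  shows "(LINT x|lborel. of_real (exp (- t * x\<^sup>2)) * cis (w * x)) = of_real (sqrt (pi / t) * exp (- w\<^sup>2 / (4 * t)))"
proof -
  define c where "c = sqrt (2 * t)"
  have c: "c > 0" "c\<^sup>2 = 2 * t" using t by (simp_all add: c_def)
  have "of_real (exp (- ((w / c)\<^sup>2) / 2)) = char std_normal_distribution (w / c)"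
    by (simp add: char_std_normal_distribution)
  also have "\<dots> = (LINT x|lborel. std_normal_density x *\<^sub>R iexp (w / c * x))"
    unfolding char_def by (subst integral_density) auto
  also have "\<dots> = \<bar>c\<bar> *\<^sub>R (LINT x|lborel. std_normal_density (0 + c * x) *\<^sub>R iexp (w / c * (0 + c * x)))"
    using c by (intro lborel_integral_real_affine) simp
  also have "(\<lambda>x. std_normal_density (0 + c * x) *\<^sub>R iexp (w / c * (0 + c * x))) =
     (\<lambda>x. of_real (1 / sqrt (2 * pi)) * (of_real (exp (- t * x\<^sup>2)) * cis (w * x)))"
    using c by (auto simp: std_normal_density_def power_mult_distrib cis_conv_exp scaleR_conv_of_real)
  also have "\<bar>c\<bar> *\<^sub>R (LINT x|lborel. of_real (1 / sqrt (2 * pi)) * (of_real (exp (- t * x\<^sup>2)) * cis (w * x)))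
    = of_real (c / sqrt (2 * pi)) * (LINT x|lborel. of_real (exp (- t * x\<^sup>2)) * cis (w * x))"
    using c by (simp add: scaleR_conv_of_real)
  finally have "of_real (exp (- ((w / c)\<^sup>2) / 2)) = of_real (c / sqrt (2 * pi)) * (LINT x|lborel. of_real (exp (- t * x\<^sup>2)) * cis (w * x))" .
  moreover have "c / sqrt (2 * pi) = sqrt (t / pi)" using t by (simp add: c_def flip: real_sqrt_divide)
  moreover have "- ((w / c)\<^sup>2) / 2 = - w\<^sup>2 / (4 * t)" using c by (simp add: power_divide)
  ultimately have "of_real (exp (- w\<^sup>2 / (4 * t))) = of_real (sqrt (t / pi)) * (LINT x|lborel. of_real (exp (- t * x\<^sup>2)) * cis (w * x))"
    by simp
  then have "of_real (sqrt (pi / t) * exp (- w\<^sup>2 / (4 * t))) = of_real (sqrt (pi / t) * sqrt (t / pi)) * (LINT x|lborel. of_real (exp (- t * x\<^sup>2)) * cis (w * x))"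
    by (simp add: mult.assoc)
  moreover have "sqrt (pi / t) * sqrt (t / pi) = 1" using t by (simp flip: real_sqrt_mult)
  ultimately show ?thesis by simp
qed

lemma gauss_cis_integrable:
  fixes t w :: real
  assumes "t > 0"
  shows "integrable lborel (\<lambda>x. of_real (exp (- t * x\<^sup>2)) * cis (w * x))"
proof (rule Bochner_Integration.integrable_bound)
  define c where "c = sqrt (2 * t)"
  have c: "c > 0" "c\<^sup>2 = 2 * t" using assms by (simp_all add: c_def)
  have "integrable lborel std_normal_density" by (rule integrable_normal_density) simp
  then have "integrable lborel (\<lambda>x. std_normal_density (0 + c * x))" using c by (intro lborel_integrable_real_affine) auto
  then have "integrable lborel (\<lambda>x. sqrt (2 * pi) * std_normal_density (0 + c * x))" by simp
  then show "integrable lborel (\<lambda>x. exp (- t * x\<^sup>2))"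
    using c by (simp add: std_normal_density_def power_mult_distrib)
qed (auto simp: norm_mult cis_conv_exp)

text \<open>Unfolding: the Fourier coefficients of a periodized Gaussian are values of its Fourier transform.\<close>

lemma gauss_periodized_coeff:
  fixes t w :: real
  assumes t: "t > 0"
  defines "\<psi> \<equiv> (\<lambda>x. of_real (exp (- t * x\<^sup>2)) * cis (w * x))"
  assumes hs: "((\<lambda>m::int. integral {0..1} (\<lambda>x. \<psi> (of_int m + x))) has_sum S) UNIV"
  shows "S = of_real (sqrt (pi / t) * exp (- w\<^sup>2 / (4 * t)))"
proof -
  have cont: "continuous_on A \<psi>" for A unfolding \<psi>_def by (intro continuous_intros)
  have shift: "integral {0..1} (\<lambda>x. \<psi> (of_int m + x)) = integral {of_int m..of_int m + 1} \<psi>" for m :: int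
  proof -
    have "(\<psi> has_integral integral {of_int m..of_int m + 1} \<psi>) {of_int m..of_int m + 1}"
      by (intro integrable_integral integrable_continuous_real cont)
    then have "(\<psi> has_integral integral {of_int m..of_int m + 1} \<psi>) (cbox (of_int m) (of_int m + 1))" by simp
    from has_integral_affinity[OF this, of 1 "of_int m"]
    have "((\<lambda>x. \<psi> (x + of_int m)) has_integral integral {of_int m..of_int m + 1} \<psi>) ((\<lambda>x. x - of_int m) ` {of_int m..of_int m + 1})"
      by simp
    also have "(\<lambda>x. x - of_int m) ` {of_int m..of_int m + 1} = {0..1::real}"
      using image_diff_atLeastAtMost[of "of_int m :: real"] by (simp add: image_add_atLeastAtMost' diff_conv_add_uminus del: add_uminus_conv_diff)
    finally show ?thesis by (simp add: integral_unique add.commute)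
  qed
  have part: "(\<Sum>m\<in>{- int N..<int N}. integral {of_int m..of_int m + 1} \<psi>) = integral {- real N..real N} \<psi>" for N
  proof (induction N)
    case (Suc N)
    have "{- int (Suc N)..<int (Suc N)} = insert (- int (Suc N)) (insert (int N) {- int N..<int N})" by auto
    then have "(\<Sum>m\<in>{- int (Suc N)..<int (Suc N)}. integral {of_int m..of_int m + 1} \<psi>)
      = integral {- real (Suc N)..- real N} \<psi> + (integral {- real N..real N} \<psi> + integral {real N..real (Suc N)} \<psi>)"
      using Suc.IH by (simp add: algebra_simps)
    also have "integral {- real N..real N} \<psi> + integral {real N..real (Suc N)} \<psi> = integral {- real N..real (Suc N)} \<psi>"
      by (rule Henstock_Kurzweil_Integration.integral_combine) (auto intro: integrable_continuous_real cont)
    also have "integral {- real (Suc N)..- real N} \<psi> + integral {- real N..real (Suc N)} \<psi> = integral {- real (Suc N)..real (Suc N)} \<psi>"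
      by (rule Henstock_Kurzweil_Integration.integral_combine) (auto intro: integrable_continuous_real cont)
    finally show ?case .
  qed simp
  \<comment> \<open>The given sum is unordered. The windows \<open>{- int N..<int N}\<close>
    eventually contain every finite set, so along them the sum becomes the limit of integrals over
    \<open>{- real N..real N}\<close>, to which dominated convergence applies.\<close>
  have "filterlim (\<lambda>N. {- int N..<int N}) (finite_subsets_at_top UNIV) sequentially"
  proof (subst filterlim_finite_subsets_at_top, intro allI impI)
    fix X :: "int set" assume X: "finite X \<and> X \<subseteq> UNIV"
    then obtain K where K: "\<And>x. x \<in> X \<Longrightarrow> \<bar>x\<bar> \<le> K"
      by (metis (no_types, lifting) finite_imageI finite_set_choice bdd_above_finite imageI bdd_above_def)
    show "\<forall>\<^sub>F N in sequentially. finite {- int N..<int N} \<and> X \<subseteq> {- int N..<int N} \<and> {- int N..<int N} \<subseteq> UNIV"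
    proof (rule eventually_sequentiallyI[of "nat (K + 1)"])
      fix N assume "nat (K + 1) \<le> N"
      then have "K + 1 \<le> int N" by linarith
      then show "finite {- int N..<int N} \<and> X \<subseteq> {- int N..<int N} \<and> {- int N..<int N} \<subseteq> UNIV"
        using K by force
    qed
  qed
  from filterlim_compose[OF hs[unfolded has_sum_def] this]
  have lim1: "(\<lambda>N. integral {- real N..real N} \<psi>) \<longlonglongrightarrow> S"
    by (simp add: shift part)
  have "integral {- real N..real N} \<psi> = (LINT x|lborel. indicator {- real N..real N} x *\<^sub>R \<psi> x)" for N
    using set_borel_integral_eq_integral(2)[OF borel_integrable_atLeastAtMost'[OF cont], of "- real N" "real N"]
    by (simp add: set_lebesgue_integral_def)
  moreover have "(\<lambda>N. LINT x|lborel. indicator {- real N..real N} x *\<^sub>R \<psi> x) \<longlonglongrightarrow> (LINT x|lborel. \<psi> x)"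
  proof (rule integral_dominated_convergence[where w="\<lambda>x. norm (\<psi> x)"])
    show meas: "\<psi> \<in> borel_measurable lborel" using gauss_cis_integrable[OF t] unfolding \<psi>_def by (rule borel_measurable_integrable)
    show "(\<lambda>x. indicator {- real N..real N} x *\<^sub>R \<psi> x) \<in> borel_measurable lborel" for N
      using meas by measurable
    show "integrable lborel (\<lambda>x. norm (\<psi> x))" using gauss_cis_integrable[OF t] unfolding \<psi>_def by (rule integrable_norm)
    show "AE x in lborel. (\<lambda>N. indicator {- real N..real N} x *\<^sub>R \<psi> x) \<longlonglongrightarrow> \<psi> x"
    proof (rule AE_I2)
      fix x
      have "\<forall>\<^sub>F N in sequentially. indicator {- real N..real N} x *\<^sub>R \<psi> x = \<psi> x"
      proof (rule eventually_sequentiallyI[of "nat \<lceil>\<bar>x\<bar>\<rceil>"])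
        fix N assume "nat \<lceil>\<bar>x\<bar>\<rceil> \<le> N"
        then have "\<bar>x\<bar> \<le> real N" by linarith
        then show "indicator {- real N..real N} x *\<^sub>R \<psi> x = \<psi> x" by (simp add: indicator_def abs_le_iff)
      qed
      then show "(\<lambda>N. indicator {- real N..real N} x *\<^sub>R \<psi> x) \<longlonglongrightarrow> \<psi> x" by (rule tendsto_eventually)
    qed
  qed (auto simp: indicator_def)
  ultimately have "(\<lambda>N. integral {- real N..real N} \<psi>) \<longlonglongrightarrow> (LINT x|lborel. \<psi> x)" by simp
  then have "S = (LINT x|lborel. \<psi> x)" using lim1 LIMSEQ_unique by blast
  then show ?thesis unfolding \<psi>_def using gauss_fourier[OF t] by simp
qed

text \<open>Multiplied by \<open>cis (2 * pi * a * x)\<close>, both sides are continuous and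
  periodic in \<open>x\<close> with the same Fourier coefficients. The twist by \<open>a\<close>
  serves the higher rank case, where the inner product of a dual vector with the skew part of the
  last basis vector enters as such a character.\<close>

lemma poisson_1d:
  fixes t a x :: real
  assumes t: "t > 0"
  shows "(\<Sum>\<^sub>\<infinity>m::int. of_real (exp (- t * (of_int m + x)\<^sup>2)) * cis (2 * pi * a * of_int m)) =
    of_real (sqrt (pi / t)) * (\<Sum>\<^sub>\<infinity>l::int. of_real (exp (- (pi\<^sup>2 / t) * (of_int l - a)\<^sup>2)) * cis (2 * pi * (of_int l - a) * x))"
proof -
  define \<phi> where "\<phi> y = of_real (exp (- t * y\<^sup>2)) * cis (2 * pi * a * y)" for y
  define g where "g x = (\<Sum>\<^sub>\<infinity>m::int. \<phi> (of_int m + x))" for x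
  define c where "c l = (of_real (sqrt (pi / t) * exp (- (pi\<^sup>2 / t) * (of_int l - a)\<^sup>2)) :: complex)" for l :: int
  define r where "r x = (\<Sum>\<^sub>\<infinity>l::int. c l * cis (2 * pi * of_int l * x))" for x
  have gper: "g (x + of_int n) = g x" for x n
  proof -
    have "bij (\<lambda>m::int. m + n)" by (rule bij_plus_right)
    from infsum_reindex_bij_betw[OF this, of "\<lambda>m. \<phi> (of_int m + x)"]
    show ?thesis by (simp add: g_def add_ac)
  qed
  have rper: "r (x + of_int n) = r x" for x n
  proof -
    have "cis (2 * pi * of_int l * (x + of_int n)) = cis (2 * pi * of_int l * x)" for l
    proof -
      have "cis (2 * pi * of_int l * (x + of_int n)) = cis (2 * pi * of_int l * x) * cis (2 * pi * of_int (l * n))"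
        by (simp add: cis_mult algebra_simps)
      also have "cis (2 * pi * of_int (l * n)) = 1" by (simp only: complex_eq_iff cis.sel cos_int_2pin sin_int_2pin one_complex.sel simp_thms)
      finally show ?thesis by simp
    qed
    then show ?thesis by (simp add: r_def)
  qed
  have gsum: "(\<lambda>m::int. exp t * exp (- (t/2) * (of_int m)\<^sup>2)) summable_on UNIV"
    using t by (intro summable_on_cmult_right gauss_int_summable) simp
  have gbound: "norm (\<phi> (of_int m + x) * cis y) \<le> exp t * exp (- (t/2) * (of_int m)\<^sup>2)" if "x \<in> {0..1}" for m x y
  proof -
    have "x\<^sup>2 \<le> 1" using that by (simp add: power_le_one)
    then have "exp (t * x\<^sup>2) \<le> exp t" using t by simp
    then have "exp (t * x\<^sup>2) * exp (- (t/2) * (of_int m)\<^sup>2) \<le> exp t * exp (- (t/2) * (of_int m)\<^sup>2)"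
      by (rule mult_right_mono) simp
    moreover have "norm (\<phi> (of_int m + x) * cis y) = exp (- t * (of_int m + x)\<^sup>2)"
      by (simp add: \<phi>_def norm_mult)
    ultimately show ?thesis using gauss_shift_bound[OF t, of "of_int m" x] by linarith
  qed
  have csum: "(\<lambda>l. norm (c l)) summable_on UNIV"
  proof -
    have "norm (c l) = sqrt (pi / t) * exp (- (pi\<^sup>2 / t) * (of_int l + - a)\<^sup>2)" for l
      unfolding c_def norm_of_real using t by (simp add: abs_mult)
    moreover have "(\<lambda>l::int. sqrt (pi / t) * exp (- (pi\<^sup>2 / t) * (of_int l + - a)\<^sup>2)) summable_on UNIV"
      using t by (intro summable_on_cmult_right gauss_int_shift_summable) simp
    ultimately show ?thesis by (simp only:)
  qed
  have cphi: "continuous_on {0..1} (\<lambda>x. \<phi> (of_int m + x) * cis (y * x))" for m y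
    unfolding \<phi>_def by (intro continuous_intros)
  have gcont: "continuous_on {0..1} g"
    unfolding g_def using infsum_int_integral(1)[OF cphi[of _ 0] gbound gsum] by simp
  have rcont: "continuous_on {0..1} r"
    unfolding r_def by (rule infsum_int_integral(1)[OF _ _ csum]) (auto intro!: continuous_intros simp: norm_mult)
  \<comment> \<open>Testing against \<open>cis\<close> with frequency \<open>k\<close> extracts the
    coefficient of index \<open>- k\<close>.\<close>
  have gcoef: "integral {0..1} (\<lambda>x. g x * cis (2 * pi * of_int k * x)) = c (- k)" for k :: int
  proof -
    have eq: "\<phi> (of_int m + x) * cis (2 * pi * of_int k * x) =
      of_real (exp (- t * (of_int m + x)\<^sup>2)) * cis (2 * pi * (a + of_int k) * (of_int m + x))" for m x
    proof -
      have "cis (2 * pi * (a + of_int k) * (of_int m + x)) =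
         cis (2 * pi * a * (of_int m + x)) * cis (2 * pi * of_int k * x) * cis (2 * pi * of_int (k * m))"
        by (simp add: cis_mult algebra_simps)
      also have "cis (2 * pi * of_int (k * m)) = 1" by (simp only: complex_eq_iff cis.sel cos_int_2pin sin_int_2pin one_complex.sel simp_thms)
      finally show ?thesis by (simp add: \<phi>_def mult_ac)
    qed
    have gx: "(\<lambda>x. g x * cis (2 * pi * of_int k * x)) = (\<lambda>x. \<Sum>\<^sub>\<infinity>m. \<phi> (of_int m + x) * cis (2 * pi * of_int k * x))"
      by (simp add: g_def infsum_cmult_left')
    have "integral {0..1} (\<lambda>x. g x * cis (2 * pi * of_int k * x))
      = of_real (sqrt (pi / t) * exp (- (2 * pi * (a + of_int k))\<^sup>2 / (4 * t)))"
      using infsum_int_integral(2)[OF cphi[of _ "2 * pi * of_int k"] gbound gsum]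
      unfolding gx by (intro gauss_periodized_coeff[OF t, of "2 * pi * (a + of_int k)"]) (simp only: eq)
    also have "(2 * pi * (a + of_int k))\<^sup>2 = 4 * pi\<^sup>2 * (of_int (- k) - a)\<^sup>2"
      by (simp add: power2_eq_square algebra_simps)
    also have "- (4 * pi\<^sup>2 * (of_int (- k) - a)\<^sup>2) / (4 * t) = - (pi\<^sup>2 / t) * (of_int (- k) - a)\<^sup>2"
      by simp
    finally show ?thesis unfolding c_def by simp
  qed
  have rcoef: "integral {0..1} (\<lambda>x. r x * cis (2 * pi * of_int k * x)) = c (- k)" for k :: int
  proof -
    have rx: "(\<lambda>x. r x * cis (2 * pi * of_int k * x)) = (\<lambda>x. \<Sum>\<^sub>\<infinity>l. c l * cis (2 * pi * of_int (l + k) * x))"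
    proof
      fix x
      have "r x * cis (2 * pi * of_int k * x) = (\<Sum>\<^sub>\<infinity>l. c l * cis (2 * pi * of_int l * x) * cis (2 * pi * of_int k * x))"
        by (simp only: r_def infsum_cmult_left')
      also have "\<dots> = (\<Sum>\<^sub>\<infinity>l. c l * cis (2 * pi * of_int (l + k) * x))"
        by (intro infsum_cong) (simp add: mult.assoc cis_mult, simp add: algebra_simps)
      finally show "r x * cis (2 * pi * of_int k * x) = (\<Sum>\<^sub>\<infinity>l. c l * cis (2 * pi * of_int (l + k) * x))" .
    qed
    have hs: "((\<lambda>l. integral {0..1} (\<lambda>x. c l * cis (2 * pi * of_int (l + k) * x))) has_sum
       integral {0..1} (\<lambda>x. r x * cis (2 * pi * of_int k * x))) UNIV"
      unfolding rx by (rule infsum_int_integral(2)[OF _ _ csum]) (auto intro!: continuous_intros simp: norm_mult)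
    have eq: "(\<lambda>l. integral {0..1} (\<lambda>x. c l * cis (2 * pi * of_int (l + k) * x))) = (\<lambda>l. if l = - k then c (- k) else 0)"
      unfolding integral_mult_right integral_cis_int by auto
    have "((\<lambda>l. if l = - k then c (- k) else 0) has_sum c (- k)) UNIV"
      by (rule has_sum_finite_neutralI[of "{- k}"]) auto
    then show ?thesis by (rule has_sum_unique[OF hs[unfolded eq]])
  qed
  have "g y = r y" if y: "y \<in> {0..1}" for y
  proof -
    have d1: "continuous_on {0..1} (\<lambda>y. g y - r y)" by (rule continuous_on_diff[OF gcont rcont])
    have d2: "g 0 - r 0 = g 1 - r 1" using gper[of 0 1] rper[of 0 1] by simp
    have d3: "integral {0..1} (\<lambda>x. (g x - r x) * cis (2 * pi * of_int l * x)) = 0" for l :: int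
    proof -
      have ccis: "continuous_on {0..1} (\<lambda>x. cis (2 * pi * of_int l * x))" by (intro continuous_intros)
      have "integral {0..1} (\<lambda>x. g x * cis (2 * pi * of_int l * x) - r x * cis (2 * pi * of_int l * x))
        = integral {0..1} (\<lambda>x. g x * cis (2 * pi * of_int l * x)) - integral {0..1} (\<lambda>x. r x * cis (2 * pi * of_int l * x))"
        by (intro Henstock_Kurzweil_Integration.integral_diff integrable_continuous_real continuous_on_mult gcont rcont ccis)
      then show ?thesis by (simp only: gcoef rcoef left_diff_distrib diff_self)
    qed
    have "g y - r y = 0" by (rule fourier_unique[OF d1 d2 d3 y])
    then show ?thesis by simp
  qed
  \<comment> \<open>Equality is known on the unit interval; periodicity carries it to every
    \<open>x\<close>.\<close>
  from this[of "frac x"] have "g (frac x) = r (frac x)" by (simp add: frac_ge_0 less_imp_le[OF frac_lt_1])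
  then have gr: "g x = r x"
    using gper[of "frac x" "\<lfloor>x\<rfloor>"] rper[of "frac x" "\<lfloor>x\<rfloor>"] by (simp add: frac_def)
  have "(\<Sum>\<^sub>\<infinity>m::int. of_real (exp (- t * (of_int m + x)\<^sup>2)) * cis (2 * pi * a * of_int m))
     = (\<Sum>\<^sub>\<infinity>m::int. cis (- (2 * pi * a * x)) * \<phi> (of_int m + x))"
    unfolding \<phi>_def by (intro infsum_cong) (simp add: cis_mult algebra_simps)
  also have "\<dots> = cis (- (2 * pi * a * x)) * r x" using gr by (simp add: infsum_cmult_right' g_def)
  also have "\<dots> = (\<Sum>\<^sub>\<infinity>l::int. of_real (sqrt (pi / t)) * (of_real (exp (- (pi\<^sup>2 / t) * (of_int l - a)\<^sup>2)) * cis (2 * pi * (of_int l - a) * x)))"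
    unfolding r_def infsum_cmult_right'[symmetric] c_def
    by (intro infsum_cong) (simp add: cis_mult algebra_simps)
  finally show ?thesis by (simp add: infsum_cmult_right')
qed

section \<open>Poisson summation in higher rank\<close>

text \<open>Restricting to \<open>span G\<close> keeps the dual of a lattice of lower rank discrete;
  in the whole space it would contain the orthogonal complement.\<close>

definition dualg :: "'a::real_inner set \<Rightarrow> 'a set" where
  "dualg G = {w \<in> span G. \<forall>x\<in>G. w \<bullet> x \<in> \<int>}"

lemma infsum_Times_banach:
  fixes f :: "'a \<Rightarrow> 'b \<Rightarrow> 'c::banach"
  assumes "(\<lambda>(x, y). f x y) summable_on A \<times> B"
  shows "infsum (\<lambda>(x, y). f x y) (A \<times> B) = infsum (\<lambda>x. infsum (f x) B) A"
  using infsum_Sigma'_banach[of f A "\<lambda>_. B"] assms by simp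

lemma summable_times_cis:
  fixes f :: "'a \<Rightarrow> real" and g :: "'a \<Rightarrow> real"
  assumes "f summable_on A" "\<And>x. x \<in> A \<Longrightarrow> f x \<ge> 0"
  shows "(\<lambda>x. of_real (f x) * cis (g x)) summable_on A"
proof (rule abs_summable_summable)
  have "(\<lambda>x. norm (of_real (f x) * cis (g x))) summable_on A \<longleftrightarrow> f summable_on A"
    by (rule summable_on_cong) (simp add: norm_mult assms(2))
  then show "(\<lambda>x. norm (of_real (f x) * cis (g x))) summable_on A" using assms(1) by simp
qed

lemma norm_infsum_cis_le:
  fixes f :: "'a \<Rightarrow> real" and g :: "'a \<Rightarrow> real"
  assumes "f summable_on A" "\<And>x. x \<in> A \<Longrightarrow> f x \<ge> 0"
  shows "norm (\<Sum>\<^sub>\<infinity>x\<in>A. of_real (f x) * cis (g x)) \<le> (\<Sum>\<^sub>\<infinity>x\<in>A. f x)"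
proof -
  have eq: "norm (of_real (f x) * cis (g x)) = f x" if "x \<in> A" for x using assms(2)[OF that] by (simp add: norm_mult)
  have "(\<lambda>x. norm (of_real (f x) * cis (g x))) summable_on A \<longleftrightarrow> f summable_on A"
    by (rule summable_on_cong) (rule eq)
  then have "norm (\<Sum>\<^sub>\<infinity>x\<in>A. of_real (f x) * cis (g x)) \<le> (\<Sum>\<^sub>\<infinity>x\<in>A. norm (of_real (f x) * cis (g x)))"
    using assms(1) by (intro norm_infsum_bound) simp
  also have "\<dots> = (\<Sum>\<^sub>\<infinity>x\<in>A. f x)" by (rule infsum_cong) (rule eq)
  finally show ?thesis .
qed

lemma infsum_complex_of_real:
  fixes f :: "'a \<Rightarrow> real"
  assumes "f summable_on A"
  shows "(\<Sum>\<^sub>\<infinity>x\<in>A. complex_of_real (f x)) = of_real (\<Sum>\<^sub>\<infinity>x\<in>A. f x)"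
  by (rule infsumI, rule has_sum_of_real, rule has_sum_infsum[OF assms])

lemma infsum_real_le_norm:
  fixes f :: "'a \<Rightarrow> real"
  assumes "f summable_on A" "\<And>x. x \<in> A \<Longrightarrow> f x \<ge> 0" "(\<Sum>\<^sub>\<infinity>x\<in>A. complex_of_real (f x)) = z"
  shows "(\<Sum>\<^sub>\<infinity>x\<in>A. f x) = norm z"
proof -
  have "norm z = \<bar>\<Sum>\<^sub>\<infinity>x\<in>A. f x\<bar>"
    unfolding assms(3)[symmetric] infsum_complex_of_real[OF assms(1)] by (rule norm_of_real)
  moreover have "(\<Sum>\<^sub>\<infinity>x\<in>A. f x) \<ge> 0" by (rule infsum_nonneg) (rule assms(2))
  ultimately show ?thesis by linarith
qed

text \<open>On the other side of Poisson summation the shift turns into characters of modulus one.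
  The bound is free of \<open>x\<close>, so it can be used when the shift varies with an outer
  summation index.\<close>

lemma gauss_int_shift_le:
  fixes t x :: real
  assumes t: "t > 0"
  shows "(\<Sum>\<^sub>\<infinity>m::int. exp (- t * (of_int m + x)\<^sup>2)) \<le> sqrt (pi / t) * (\<Sum>\<^sub>\<infinity>l::int. exp (- (pi\<^sup>2 / t) * (of_int l)\<^sup>2))"
proof -
  have s: "(\<lambda>l::int. exp (- (pi\<^sup>2 / t) * (of_int l)\<^sup>2)) summable_on UNIV"
    using t by (intro gauss_int_summable) simp
  have "(\<Sum>\<^sub>\<infinity>m::int. complex_of_real (exp (- t * (of_int m + x)\<^sup>2))) =
    of_real (sqrt (pi / t)) * (\<Sum>\<^sub>\<infinity>l::int. of_real (exp (- (pi\<^sup>2 / t) * (of_int l)\<^sup>2)) * cis (2 * pi * of_int l * x))"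
    using poisson_1d[OF t, of x 0] by simp
  from infsum_real_le_norm[OF gauss_int_shift_summable[OF t] _ this]
  have "(\<Sum>\<^sub>\<infinity>m::int. exp (- t * (of_int m + x)\<^sup>2)) = sqrt (pi / t) * norm (\<Sum>\<^sub>\<infinity>l::int. complex_of_real (exp (- (pi\<^sup>2 / t) * (of_int l)\<^sup>2)) * cis (2 * pi * of_int l * x))"
    using t by (simp add: norm_mult)
  also have "\<dots> \<le> sqrt (pi / t) * (\<Sum>\<^sub>\<infinity>l::int. exp (- (pi\<^sup>2 / t) * (of_int l)\<^sup>2))"
    using t by (intro mult_left_mono norm_infsum_cis_le s) auto
  finally show ?thesis .
qed

text \<open>Splitting off the last basis vector: \<open>b k = h + \<beta>\<close> with \<open>h\<close> in the span of the previous
  vectors and \<open>\<beta>\<close> orthogonal to it.\<close>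

locale last_vector =
  fixes b :: "nat \<Rightarrow> 'a::euclidean_space" and k :: nat
  assumes nz: "gdet (Suc k) b \<noteq> 0"
begin

abbreviation "V \<equiv> span (b ` {..<k})"

definition \<beta> where "\<beta> = perp (b ` {..<k}) (b k)"
definition h where "h = b k - \<beta>"
text \<open>The dual of \<open>zspan j b\<close>, with integrality tested on the generators only;
  \<open>dualg_zspan\<close> identifies the two.\<close>

definition D where "D j = {w \<in> span (b ` {..<j}). \<forall>i<j. w \<bullet> b i \<in> \<int>}"

lemma h_V: "h \<in> V" unfolding h_def \<beta>_def by (rule perp)

lemma orth: "y \<in> V \<Longrightarrow> \<beta> \<bullet> y = 0" "y \<in> V \<Longrightarrow> y \<bullet> \<beta> = 0"
  unfolding \<beta>_def by (simp_all add: perp inner_commute[of y])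

lemma bk: "b k = h + \<beta>" by (simp add: h_def)

lemma gdet_eq: "gdet (Suc k) b = gdet k b * (norm \<beta>)\<^sup>2"
  by (rule gdet_Suc) (use h_V in \<open>auto simp: h_def intro: orth span_base\<close>)

lemma nz': "gdet k b \<noteq> 0" "\<beta> \<noteq> 0"
  using nz unfolding gdet_eq by auto

lemma span_Suc: "span (b ` {..<Suc k}) = {y + r *\<^sub>R \<beta> | y r. y \<in> V}"
proof (intro subset_antisym subsetI)
  fix z assume "z \<in> span (b ` {..<Suc k})"
  then have "z \<in> span (insert (b k) (b ` {..<k}))" by (simp add: lessThan_Suc)
  then obtain r where r: "z - r *\<^sub>R b k \<in> V" by (auto simp: span_breakdown_eq)
  have "z = (z - r *\<^sub>R b k + r *\<^sub>R h) + r *\<^sub>R \<beta>" by (simp add: bk scaleR_add_right)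
  moreover have "z - r *\<^sub>R b k + r *\<^sub>R h \<in> V" by (intro span_add r span_scale h_V)
  ultimately show "z \<in> {y + r *\<^sub>R \<beta> | y r. y \<in> V}" by blast
next
  fix z assume "z \<in> {y + r *\<^sub>R \<beta> | y r. y \<in> V}"
  then obtain y r where z: "z = y + r *\<^sub>R \<beta>" "y \<in> V" by auto
  have sub: "V \<subseteq> span (b ` {..<Suc k})" by (intro span_mono) auto
  have "\<beta> = b k - h" by (simp add: bk)
  moreover have "b k \<in> span (b ` {..<Suc k})" by (intro span_base) auto
  ultimately have "\<beta> \<in> span (b ` {..<Suc k})" using h_V sub by (auto intro: span_diff)
  then show "z \<in> span (b ` {..<Suc k})" using z sub by (auto intro: span_add span_scale)
qed

lemma decomp_unique:
  assumes "x \<in> V" "y \<in> V" "x + r *\<^sub>R \<beta> = y + s *\<^sub>R \<beta>"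
  shows "x = y" "r = s"
proof -
  have "r * (\<beta> \<bullet> \<beta>) = (x + r *\<^sub>R \<beta>) \<bullet> \<beta>" using assms(1) by (simp add: inner_add_left orth)
  also have "\<dots> = (y + s *\<^sub>R \<beta>) \<bullet> \<beta>" by (simp only: assms(3))
  also have "\<dots> = s * (\<beta> \<bullet> \<beta>)" using assms(2) by (simp add: inner_add_left orth)
  finally show "r = s" using nz'(2) by simp
  then show "x = y" using assms(3) by simp
qed

lemma bij_zspan: "bij_betw (\<lambda>(m, x). x + of_int m *\<^sub>R b k) (UNIV \<times> zspan k b) (zspan (Suc k) b)"
proof (rule bij_betw_imageI)
  show "inj_on (\<lambda>(m, x). x + of_int m *\<^sub>R b k) (UNIV \<times> zspan k b)"
  proof (rule inj_onI, clarify)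
    fix m m' :: int and x x' assume x: "x \<in> zspan k b" "x' \<in> zspan k b" "x + of_int m *\<^sub>R b k = x' + of_int m' *\<^sub>R b k"
    have xV: "x \<in> V" "x' \<in> V" using x zspan_subset_span[of k b] by auto
    have "(x + of_int m *\<^sub>R h) + of_int m *\<^sub>R \<beta> = (x' + of_int m' *\<^sub>R h) + of_int m' *\<^sub>R \<beta>"
      using x(3) by (simp add: bk scaleR_add_right add.assoc)
    from decomp_unique(2)[OF span_add[OF xV(1) span_scale[OF h_V]] span_add[OF xV(2) span_scale[OF h_V]] this]
    have "m = m'" by simp
    then show "m = m' \<and> x = x'" using x(3) by simp
  qed
  show "(\<lambda>(m, x). x + of_int m *\<^sub>R b k) ` (UNIV \<times> zspan k b) = zspan (Suc k) b"
    unfolding zspan_Suc by (auto simp: image_iff)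
qed

text \<open>Write a dual vector as \<open>w + r *\<^sub>R \<beta>\<close>. Pairing with the earlier
  \<open>b i\<close> sees only \<open>w\<close>, so \<open>w\<close> is dual to them; pairing with
  \<open>b k = h + \<beta>\<close> must be an integer \<open>l\<close>, which determines
  \<open>r\<close>.\<close>

lemma bij_D: "bij_betw (\<lambda>(w, l). w + ((of_int l - w \<bullet> h) / (\<beta> \<bullet> \<beta>)) *\<^sub>R \<beta>) (D k \<times> (UNIV::int set)) (D (Suc k))"
proof (rule bij_betw_imageI)
  let ?f = "\<lambda>(w, l::int). w + ((of_int l - w \<bullet> h) / (\<beta> \<bullet> \<beta>)) *\<^sub>R \<beta>"
  have bb: "\<beta> \<bullet> \<beta> \<noteq> 0" using nz'(2) by simp
  show "inj_on ?f (D k \<times> (UNIV::int set))"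
  proof (rule inj_onI, clarify)
    fix w w' and l l' :: int
    assume w: "w \<in> D k" "w' \<in> D k"
      "w + ((of_int l - w \<bullet> h) / (\<beta> \<bullet> \<beta>)) *\<^sub>R \<beta> = w' + ((of_int l' - w' \<bullet> h) / (\<beta> \<bullet> \<beta>)) *\<^sub>R \<beta>"
    have wV: "w \<in> V" "w' \<in> V" using w by (auto simp: D_def)
    have ww: "w = w'" by (rule decomp_unique(1)[OF wV w(3)])
    have "(of_int l - w \<bullet> h) / (\<beta> \<bullet> \<beta>) = (of_int l' - w' \<bullet> h) / (\<beta> \<bullet> \<beta>)" by (rule decomp_unique(2)[OF wV w(3)])
    then show "w = w' \<and> l = l'" using bb ww by simp
  qed
  show "?f ` (D k \<times> (UNIV::int set)) = D (Suc k)"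
  proof (intro subset_antisym subsetI)
    fix W assume "W \<in> ?f ` (D k \<times> (UNIV::int set))"
    then obtain w and l :: int where w: "w \<in> D k" "W = w + ((of_int l - w \<bullet> h) / (\<beta> \<bullet> \<beta>)) *\<^sub>R \<beta>" by auto
    have wV: "w \<in> V" using w by (simp add: D_def)
    have "W \<in> span (b ` {..<Suc k})" unfolding span_Suc using w wV by blast
    moreover have "W \<bullet> b i \<in> \<int>" if "i < Suc k" for i
    proof (cases "i = k")
      case True
      have "W \<bullet> b k = of_int l" unfolding w(2) bk using bb by (simp add: inner_add_left inner_add_right orth wV h_V)
      then show ?thesis using True by simp
    next
      case False
      then have "i < k" using that by simp
      then have "W \<bullet> b i = w \<bullet> b i" unfolding w(2) by (simp add: inner_add_left orth span_base)
      then show ?thesis using w(1) \<open>i < k\<close> by (simp add: D_def)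
    qed
    ultimately show "W \<in> D (Suc k)" by (simp add: D_def)
  next
    fix W assume W: "W \<in> D (Suc k)"
    then have "W \<in> span (b ` {..<Suc k})" by (simp add: D_def)
    then obtain w r where w: "W = w + r *\<^sub>R \<beta>" "w \<in> V" unfolding span_Suc by auto
    have "W \<bullet> b k \<in> \<int>" using W by (simp add: D_def)
    then obtain l :: int where "W \<bullet> b k = of_int l" by (auto elim: Ints_cases)
    then have "w \<bullet> h + r * (\<beta> \<bullet> \<beta>) = of_int l"
      unfolding w(1) bk by (simp add: inner_add_left inner_add_right orth w(2) h_V)
    then have r: "r = (of_int l - w \<bullet> h) / (\<beta> \<bullet> \<beta>)" using bb by (simp add: field_simps)
    have "w \<bullet> b i \<in> \<int>" if "i < k" for i
    proof -
      have "w \<bullet> b i = W \<bullet> b i" unfolding w(1) using that by (simp add: inner_add_left orth span_base)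
      then show ?thesis using W that by (simp add: D_def)
    qed
    then have "w \<in> D k" using w by (simp add: D_def)
    then have wl: "(w, l) \<in> D k \<times> (UNIV::int set)" by simp
    have "W = ?f (w, l)" using w r by simp
    then show "W \<in> ?f ` (D k \<times> (UNIV::int set))" by (rule image_eqI[OF _ wl])
  qed
qed

lemma norm_zspan_shift:
  assumes "x \<in> V" "z \<in> V"
  shows "(norm (x + of_int m *\<^sub>R b k + (z + r *\<^sub>R \<beta>)))\<^sup>2 = (norm (x + (of_int m *\<^sub>R h + z)))\<^sup>2 + (norm \<beta>)\<^sup>2 * (of_int m + r)\<^sup>2"
proof -
  have V: "x + (of_int m *\<^sub>R h + z) \<in> V" using assms h_V by (intro span_add span_scale)
  have "x + of_int m *\<^sub>R b k + (z + r *\<^sub>R \<beta>) = (x + (of_int m *\<^sub>R h + z)) + (of_int m + r) *\<^sub>R \<beta>"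
    by (simp add: bk scaleR_add_right scaleR_add_left)
  also have "(norm \<dots>)\<^sup>2 = (norm (x + (of_int m *\<^sub>R h + z)))\<^sup>2 + (norm ((of_int m + r) *\<^sub>R \<beta>))\<^sup>2"
    by (rule norm_add_orth) (simp add: orth V)
  finally show ?thesis by (simp add: power_mult_distrib mult.commute)
qed

lemma norm_D:
  assumes "w \<in> V"
  shows "(norm (w + ((of_int l - w \<bullet> h) / (\<beta> \<bullet> \<beta>)) *\<^sub>R \<beta>))\<^sup>2 = (norm w)\<^sup>2 + (of_int l - w \<bullet> h)\<^sup>2 / (norm \<beta>)\<^sup>2"
proof -
  have bb: "\<beta> \<bullet> \<beta> = (norm \<beta>)\<^sup>2" by (simp add: power2_norm_eq_inner)
  have n0: "norm \<beta> \<noteq> 0" using nz'(2) by simp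
  have "(norm (w + ((of_int l - w \<bullet> h) / (\<beta> \<bullet> \<beta>)) *\<^sub>R \<beta>))\<^sup>2 = (norm w)\<^sup>2 + (norm (((of_int l - w \<bullet> h) / (\<beta> \<bullet> \<beta>)) *\<^sub>R \<beta>))\<^sup>2"
    by (rule norm_add_orth) (simp add: orth assms)
  also have "(norm (((of_int l - w \<bullet> h) / (\<beta> \<bullet> \<beta>)) *\<^sub>R \<beta>))\<^sup>2 = (of_int l - w \<bullet> h)\<^sup>2 / (norm \<beta>)\<^sup>2"
    using n0 unfolding bb by (simp add: power_mult_distrib power_divide power2_eq_square)
  finally show ?thesis .
qed

lemma inner_D:
  assumes "w \<in> V" "z \<in> V"
  shows "(w + ((of_int l - w \<bullet> h) / (\<beta> \<bullet> \<beta>)) *\<^sub>R \<beta>) \<bullet> (z + r *\<^sub>R \<beta>) = w \<bullet> z + (of_int l - w \<bullet> h) * r"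
  using nz'(2) assms by (simp add: inner_add_left inner_add_right orth)

end

text \<open>Slice the lattice by the multiple \<open>m\<close> of \<open>b k\<close>. Each slice is
  the lower lattice shifted by \<open>m\<close> times \<open>h\<close> plus a fixed vector, and the
  induction hypothesis turns it into a sum over \<open>D k\<close>. After exchanging the sums, the
  one over \<open>m\<close> is a one-dimensional Gaussian sum of parameter \<open>t * n\<close>
  twisted by \<open>w \<bullet> h\<close>, and \<open>poisson_1d\<close> produces the new dual
  coordinate \<open>l\<close>.\<close>

lemma (in last_vector) poisson_step:
  assumes t: "t > 0"
    and IH1: "\<And>t z. t > 0 \<Longrightarrow> z \<in> V \<Longrightarrow> (\<lambda>x. exp (- t * (norm (x + z))\<^sup>2)) summable_on zspan k b"
    and IH2: "\<And>t. t > 0 \<Longrightarrow> (\<lambda>w. exp (- t * (norm w)\<^sup>2)) summable_on D k"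
    and IH3: "\<And>t z. t > 0 \<Longrightarrow> z \<in> V \<Longrightarrow> (\<Sum>\<^sub>\<infinity>x\<in>zspan k b. complex_of_real (exp (- t * (norm (x + z))\<^sup>2))) =
      of_real (sqrt (pi / t) ^ k / sqrt (gdet k b)) * (\<Sum>\<^sub>\<infinity>w\<in>D k. of_real (exp (- (pi\<^sup>2 / t) * (norm w)\<^sup>2)) * cis (2 * pi * (w \<bullet> z)))"
  shows "z \<in> span (b ` {..<Suc k}) \<Longrightarrow> (\<lambda>x. exp (- t * (norm (x + z))\<^sup>2)) summable_on zspan (Suc k) b"
    and "(\<lambda>w. exp (- t * (norm w)\<^sup>2)) summable_on D (Suc k)"
    and "z \<in> span (b ` {..<Suc k}) \<Longrightarrow> (\<Sum>\<^sub>\<infinity>x\<in>zspan (Suc k) b. complex_of_real (exp (- t * (norm (x + z))\<^sup>2))) =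
      of_real (sqrt (pi / t) ^ Suc k / sqrt (gdet (Suc k) b)) * (\<Sum>\<^sub>\<infinity>w\<in>D (Suc k). of_real (exp (- (pi\<^sup>2 / t) * (norm w)\<^sup>2)) * cis (2 * pi * (w \<bullet> z)))"
proof -
  define n where "n = (norm \<beta>)\<^sup>2"
  let ?Q = "\<lambda>s w (l::int). exp (- s * ((norm w)\<^sup>2 + (of_int l - w \<bullet> h)\<^sup>2 / n))"
  let ?\<phi> = "\<lambda>(w, l::int). w + ((of_int l - w \<bullet> h) / (\<beta> \<bullet> \<beta>)) *\<^sub>R \<beta>"
  let ?\<psi> = "\<lambda>(m, x). x + of_int m *\<^sub>R b k"
  have n: "n > 0" using nz'(2) by (simp add: n_def)
  define K where "K t = sqrt (pi / t) ^ k / sqrt (gdet k b)" for t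
  have gpos: "gdet k b > 0" using nz'(1) gdet_nonneg[of k b] by linarith
  have Kpos: "K t \<ge> 0" if "t > 0" for t using that gpos by (simp add: K_def)
  have VD: "w \<in> V" if "w \<in> D k" for w using that by (simp add: D_def)
  \<comment> \<open>For fixed \<open>w\<close> the sum over \<open>l\<close> is a shifted Gaussian
    sum, at most \<open>B\<close> whatever the shift \<open>w \<bullet> h\<close>; so the double
    series is dominated by the series over \<open>D k\<close>.\<close>
  have dual_sum: "(\<lambda>(w, l::int). ?Q t w l) summable_on D k \<times> UNIV" if t: "t > 0" for t
  proof (rule summable_on_SigmaI)
    have tn: "t / n > 0" using t n by simp
    define B where "B = sqrt (pi / (t / n)) * (\<Sum>\<^sub>\<infinity>l::int. exp (- (pi\<^sup>2 / (t / n)) * (of_int l)\<^sup>2))"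
    define g where "g w = exp (- t * (norm w)\<^sup>2) * (\<Sum>\<^sub>\<infinity>l::int. exp (- (t / n) * (of_int l + - (w \<bullet> h))\<^sup>2))" for w
    show "((\<lambda>l. case (w, l) of (w, l) \<Rightarrow> ?Q t w l) has_sum g w) UNIV" for w
    proof -
      have "((\<lambda>l::int. exp (- t * (norm w)\<^sup>2) * exp (- (t / n) * (of_int l + - (w \<bullet> h))\<^sup>2)) has_sum g w) UNIV"
        unfolding g_def by (intro has_sum_cmult_right has_sum_infsum gauss_int_shift_summable[OF tn])
      moreover have "exp (- t * (norm w)\<^sup>2) * exp (- (t / n) * (of_int l + - (w \<bullet> h))\<^sup>2) = ?Q t w l" for l :: int
        unfolding exp_add[symmetric] by (simp add: algebra_simps)
      ultimately show ?thesis by simp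
    qed
    show "g summable_on D k"
    proof (rule summable_on_comparison_test)
      show "(\<lambda>w. B * exp (- t * (norm w)\<^sup>2)) summable_on D k" by (intro summable_on_cmult_right IH2 t)
      show "g w \<le> B * exp (- t * (norm w)\<^sup>2)" for w
        unfolding g_def B_def mult.commute[of "exp (- t * (norm w)\<^sup>2)"]
        by (intro mult_right_mono gauss_int_shift_le tn) simp
      show "0 \<le> g w" for w unfolding g_def by (intro mult_nonneg_nonneg infsum_nonneg) simp_all
    qed
  qed auto
  have normD: "exp (- t * (norm w)\<^sup>2 - t * ((of_int l - w \<bullet> h)\<^sup>2 / n)) = ?Q t w l" for t w and l :: int
    by (simp add: algebra_simps)
  show "(\<lambda>w. exp (- t * (norm w)\<^sup>2)) summable_on D (Suc k)"
  proof -
    have "(\<lambda>w. exp (- t * (norm w)\<^sup>2)) summable_on D (Suc k) \<longleftrightarrow>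
      (\<lambda>p. exp (- t * (norm (?\<phi> p))\<^sup>2)) summable_on D k \<times> (UNIV::int set)"
      by (rule summable_on_reindex_bij_betw[OF bij_D, symmetric])
    also have "\<dots> \<longleftrightarrow> (\<lambda>(w, l::int). ?Q t w l) summable_on D k \<times> UNIV"
      by (rule summable_on_cong) (auto simp: norm_D VD n_def)
    finally show ?thesis using dual_sum[OF t] by simp
  qed
  assume "z \<in> span (b ` {..<Suc k})"
  then obtain y r where z: "z = y + r *\<^sub>R \<beta>" and y: "y \<in> V" unfolding span_Suc by auto
  let ?c = "\<lambda>w (l::int). 2 * pi * (w \<bullet> y + (of_int l - w \<bullet> h) * r)"
  let ?v = "\<lambda>m::int. of_int m *\<^sub>R h + y"
  have mhy: "?v m \<in> V" for m by (intro span_add span_scale h_V y)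
  have tn: "t * n > 0" using t n by simp
  define e where "e m = exp (- (t * n) * (of_int m + r)\<^sup>2)" for m :: int
  have esum: "e summable_on UNIV" unfolding e_def by (rule gauss_int_shift_summable[OF tn])
  define S where "S v = (\<Sum>\<^sub>\<infinity>x\<in>zspan k b. exp (- t * (norm (x + v))\<^sup>2))" for v
  define E where "E w = exp (- (pi\<^sup>2 / t) * (norm w)\<^sup>2)" for w :: 'a
  have pt: "pi\<^sup>2 / t > 0" using t by simp
  have Esum: "E summable_on D k" unfolding E_def by (rule IH2[OF pt])
  have SC: "complex_of_real (S v) = of_real (K t) * (\<Sum>\<^sub>\<infinity>w\<in>D k. of_real (E w) * cis (2 * pi * (w \<bullet> v)))" if "v \<in> V" for v
    unfolding S_def K_def E_def infsum_complex_of_real[OF IH1[OF t that], symmetric] by (rule IH3[OF t that])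
  \<comment> \<open>A bound on the mass of the slices that is uniform in the shift; with it the sum
    over \<open>m\<close> converges because \<open>e\<close> does.\<close>
  have Sle: "S v \<le> K t * (\<Sum>\<^sub>\<infinity>w\<in>D k. E w)" if v: "v \<in> V" for v
  proof -
    have "S v = norm (of_real (K t) * (\<Sum>\<^sub>\<infinity>w\<in>D k. of_real (E w) * cis (2 * pi * (w \<bullet> v))))"
      unfolding S_def K_def E_def by (rule infsum_real_le_norm[OF IH1[OF t v] _ IH3[OF t v]]) simp
    also have "\<dots> = K t * norm (\<Sum>\<^sub>\<infinity>w\<in>D k. of_real (E w) * cis (2 * pi * (w \<bullet> v)))"
      using Kpos[OF t] by (simp add: norm_mult)
    also have "\<dots> \<le> K t * (\<Sum>\<^sub>\<infinity>w\<in>D k. E w)"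
      by (intro mult_left_mono norm_infsum_cis_le Esum Kpos t) (simp add: E_def)
    finally show ?thesis .
  qed
  have Snonneg: "S v \<ge> 0" for v unfolding S_def by (rule infsum_nonneg) simp
  have Ssum: "(\<lambda>m. S (?v m) * e m) summable_on UNIV"
  proof (rule summable_on_comparison_test)
    show "(\<lambda>m. (K t * (\<Sum>\<^sub>\<infinity>w\<in>D k. E w)) * e m) summable_on UNIV" by (intro summable_on_cmult_right esum)
    show "S (?v m) * e m \<le> (K t * (\<Sum>\<^sub>\<infinity>w\<in>D k. E w)) * e m" for m
      by (intro mult_right_mono Sle mhy) (simp add: e_def)
    show "0 \<le> S (?v m) * e m" for m by (intro mult_nonneg_nonneg Snonneg) (simp add: e_def)
  qed
  have prim: "(\<lambda>(m, x). exp (- t * (norm (x + ?v m))\<^sup>2) * e m) summable_on UNIV \<times> zspan k b"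
  proof (rule summable_on_SigmaI)
    show "((\<lambda>x. case (m, x) of (m, x) \<Rightarrow> exp (- t * (norm (x + ?v m))\<^sup>2) * e m) has_sum S (?v m) * e m) (zspan k b)" for m
      unfolding S_def prod.case by (intro has_sum_cmult_left has_sum_infsum IH1 t mhy)
    show "(\<lambda>m. S (?v m) * e m) summable_on UNIV" by (rule Ssum)
  qed (auto simp: e_def)
  have zV: "x \<in> V" if "x \<in> zspan k b" for x using that zspan_subset_span[of k b] by auto
  have shift: "exp (- t * (norm (?\<psi> p + z))\<^sup>2) = (\<lambda>(m, x). exp (- t * (norm (x + ?v m))\<^sup>2) * e m) p"
    if p: "p \<in> UNIV \<times> zspan k b" for p :: "int \<times> 'a"
  proof -
    obtain m x where mx: "p = (m, x)" "x \<in> V" using p zV by auto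
    have "exp (- t * (norm (x + of_int m *\<^sub>R b k + z))\<^sup>2) = exp (- t * (norm (x + (?v m)))\<^sup>2 + - (t * n) * (of_int m + r)\<^sup>2)"
      unfolding z norm_zspan_shift[OF mx(2) y] n_def by (simp add: algebra_simps)
    then show ?thesis unfolding e_def mx(1) prod.case exp_add .
  qed
  show S1: "(\<lambda>x. exp (- t * (norm (x + z))\<^sup>2)) summable_on zspan (Suc k) b"
  proof -
    have "(\<lambda>x. exp (- t * (norm (x + z))\<^sup>2)) summable_on zspan (Suc k) b \<longleftrightarrow>
      (\<lambda>p. exp (- t * (norm (?\<psi> p + z))\<^sup>2)) summable_on UNIV \<times> zspan k b"
      by (rule summable_on_reindex_bij_betw[OF bij_zspan, symmetric])
    also have "\<dots> \<longleftrightarrow> (\<lambda>(m, x). exp (- t * (norm (x + ?v m))\<^sup>2) * e m) summable_on UNIV \<times> zspan k b"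
      by (rule summable_on_cong) (rule shift)
    finally show ?thesis using prim by simp
  qed
  define F where "F w m = complex_of_real (E w) * cis (2 * pi * (w \<bullet> (?v m))) * of_real (e m)" for w :: 'a and m :: int
  \<comment> \<open>Absolute convergence over all pairs licenses the exchange of the sums over
    \<open>m\<close> and \<open>w\<close>.\<close>
  have prodsum: "(\<lambda>(m, w). F w m) summable_on UNIV \<times> D k"
  proof -
    have "(\<lambda>(m, w). e m * E w) summable_on UNIV \<times> D k"
    proof (rule summable_on_SigmaI)
      show "((\<lambda>w. case (m, w) of (m, w) \<Rightarrow> e m * E w) has_sum e m * (\<Sum>\<^sub>\<infinity>w\<in>D k. E w)) (D k)" for m
        unfolding prod.case by (intro has_sum_cmult_right has_sum_infsum Esum)
      show "(\<lambda>m. e m * (\<Sum>\<^sub>\<infinity>w\<in>D k. E w)) summable_on UNIV" by (intro summable_on_cmult_left esum)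
    qed (auto simp: e_def E_def)
    then have "(\<lambda>p. of_real ((\<lambda>(m, w). e m * E w) p) * cis ((\<lambda>(m, w). 2 * pi * (w \<bullet> (?v m))) p)) summable_on UNIV \<times> D k"
      by (rule summable_times_cis) (auto simp: e_def E_def)
    also have "(\<lambda>p. of_real ((\<lambda>(m, w). e m * E w) p) * cis ((\<lambda>(m, w). 2 * pi * (w \<bullet> (?v m))) p)) = (\<lambda>(m, w). F w m)"
      by (rule ext) (auto simp: F_def mult_ac)
    finally show ?thesis .
  qed
  define c where "c = sqrt (pi / (t * n))"
  have inner_sum: "(\<Sum>\<^sub>\<infinity>m. F w m) = of_real c * (\<Sum>\<^sub>\<infinity>l::int. of_real (?Q (pi\<^sup>2 / t) w l) * cis (?c w l))" for w
  proof -
    have "(\<Sum>\<^sub>\<infinity>m. F w m) = (\<Sum>\<^sub>\<infinity>m. (of_real (E w) * cis (2 * pi * (w \<bullet> y))) * (of_real (exp (- (t * n) * (of_int m + r)\<^sup>2)) * cis (2 * pi * (w \<bullet> h) * of_int m)))"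
    proof (rule infsum_cong)
      fix m :: int
      have "cis (2 * pi * (w \<bullet> (?v m))) = cis (2 * pi * (w \<bullet> y)) * cis (2 * pi * (w \<bullet> h) * of_int m)"
        by (simp add: cis_mult inner_add_right algebra_simps)
      then show "F w m = (of_real (E w) * cis (2 * pi * (w \<bullet> y))) * (of_real (exp (- (t * n) * (of_int m + r)\<^sup>2)) * cis (2 * pi * (w \<bullet> h) * of_int m))"
        by (simp add: F_def e_def mult_ac)
    qed
    also have "\<dots> = (of_real (E w) * cis (2 * pi * (w \<bullet> y))) * (of_real c * (\<Sum>\<^sub>\<infinity>l::int. of_real (exp (- (pi\<^sup>2 / (t * n)) * (of_int l - w \<bullet> h)\<^sup>2)) * cis (2 * pi * (of_int l - w \<bullet> h) * r)))"
      unfolding infsum_cmult_right' poisson_1d[OF tn] c_def ..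
    also have "\<dots> = of_real c * (\<Sum>\<^sub>\<infinity>l::int. (of_real (E w) * cis (2 * pi * (w \<bullet> y))) * (of_real (exp (- (pi\<^sup>2 / (t * n)) * (of_int l - w \<bullet> h)\<^sup>2)) * cis (2 * pi * (of_int l - w \<bullet> h) * r)))"
      unfolding infsum_cmult_right' by (simp only: mult_ac)
    also have "(\<Sum>\<^sub>\<infinity>l::int. (of_real (E w) * cis (2 * pi * (w \<bullet> y))) * (of_real (exp (- (pi\<^sup>2 / (t * n)) * (of_int l - w \<bullet> h)\<^sup>2)) * cis (2 * pi * (of_int l - w \<bullet> h) * r)))
      = (\<Sum>\<^sub>\<infinity>l::int. of_real (?Q (pi\<^sup>2 / t) w l) * cis (?c w l))"
    proof (rule infsum_cong)
      fix l :: int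
      have "?Q (pi\<^sup>2 / t) w l = E w * exp (- (pi\<^sup>2 / (t * n)) * (of_int l - w \<bullet> h)\<^sup>2)"
        unfolding E_def exp_add[symmetric] by (simp add: algebra_simps)
      moreover have "cis (?c w l) = cis (2 * pi * (w \<bullet> y)) * cis (2 * pi * (of_int l - w \<bullet> h) * r)"
        by (simp add: cis_mult algebra_simps)
      ultimately show "(of_real (E w) * cis (2 * pi * (w \<bullet> y))) * (of_real (exp (- (pi\<^sup>2 / (t * n)) * (of_int l - w \<bullet> h)\<^sup>2)) * cis (2 * pi * (of_int l - w \<bullet> h) * r))
        = of_real (?Q (pi\<^sup>2 / t) w l) * cis (?c w l)"
        by (simp only: of_real_mult mult_ac)
    qed
    finally show ?thesis .
  qed
  have Dsum: "(\<lambda>(w, l::int). of_real (?Q (pi\<^sup>2 / t) w l) * cis (?c w l)) summable_on D k \<times> UNIV"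
  proof -
    have "(\<lambda>p. of_real ((\<lambda>(w, l::int). ?Q (pi\<^sup>2 / t) w l) p) * cis ((\<lambda>(w, l::int). ?c w l) p)) summable_on D k \<times> UNIV"
      by (rule summable_times_cis[OF dual_sum[OF pt]]) auto
    also have "(\<lambda>p. of_real ((\<lambda>(w, l::int). ?Q (pi\<^sup>2 / t) w l) p) * cis ((\<lambda>(w, l::int). ?c w l) p))
       = (\<lambda>(w, l::int). of_real (?Q (pi\<^sup>2 / t) w l) * cis (?c w l))"
      by (rule ext) auto
    finally show ?thesis .
  qed
  have "(\<Sum>\<^sub>\<infinity>x\<in>zspan (Suc k) b. complex_of_real (exp (- t * (norm (x + z))\<^sup>2)))
    = of_real (\<Sum>\<^sub>\<infinity>x\<in>zspan (Suc k) b. exp (- t * (norm (x + z))\<^sup>2))" by (rule infsum_complex_of_real[OF S1])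
  also have "(\<Sum>\<^sub>\<infinity>x\<in>zspan (Suc k) b. exp (- t * (norm (x + z))\<^sup>2)) =
    (\<Sum>\<^sub>\<infinity>p\<in>UNIV \<times> zspan k b. exp (- t * (norm (?\<psi> p + z))\<^sup>2))"
    by (rule infsum_reindex_bij_betw[OF bij_zspan, symmetric])
  also have "\<dots> = (\<Sum>\<^sub>\<infinity>(m, x)\<in>UNIV \<times> zspan k b. exp (- t * (norm (x + ?v m))\<^sup>2) * e m)"
    by (rule infsum_cong) (rule shift)
  also have "\<dots> = (\<Sum>\<^sub>\<infinity>m. \<Sum>\<^sub>\<infinity>x\<in>zspan k b. exp (- t * (norm (x + ?v m))\<^sup>2) * e m)"
    by (rule infsum_Times_banach[OF prim])
  also have "\<dots> = (\<Sum>\<^sub>\<infinity>m. S (?v m) * e m)"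
    unfolding S_def infsum_cmult_left' ..
  also have "complex_of_real \<dots> = (\<Sum>\<^sub>\<infinity>m. complex_of_real (S (?v m) * e m))"
  by (rule infsum_complex_of_real[OF Ssum, symmetric])
  also have "\<dots> = (\<Sum>\<^sub>\<infinity>m. of_real (K t) * (\<Sum>\<^sub>\<infinity>w\<in>D k. F w m))"
  proof (rule infsum_cong)
    fix m :: int
    have eq: "(\<Sum>\<^sub>\<infinity>w\<in>D k. F w m) = (\<Sum>\<^sub>\<infinity>w\<in>D k. of_real (E w) * cis (2 * pi * (w \<bullet> (?v m)))) * of_real (e m)"
      unfolding F_def infsum_cmult_left' ..
    show "complex_of_real (S (?v m) * e m) = of_real (K t) * (\<Sum>\<^sub>\<infinity>w\<in>D k. F w m)"
      unfolding of_real_mult SC[OF mhy] eq by (simp only: mult_ac)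
  qed
  also have "\<dots> = of_real (K t) * (\<Sum>\<^sub>\<infinity>m. \<Sum>\<^sub>\<infinity>w\<in>D k. F w m)" by (rule infsum_cmult_right')
  also have "(\<Sum>\<^sub>\<infinity>m. \<Sum>\<^sub>\<infinity>w\<in>D k. F w m) = (\<Sum>\<^sub>\<infinity>w\<in>D k. \<Sum>\<^sub>\<infinity>m. F w m)"
    by (rule infsum_swap_banach[OF prodsum])
  also have "\<dots> = of_real c * (\<Sum>\<^sub>\<infinity>w\<in>D k. \<Sum>\<^sub>\<infinity>l::int. of_real (?Q (pi\<^sup>2 / t) w l) * cis (?c w l))"
    unfolding inner_sum infsum_cmult_right' ..
  also have "(\<Sum>\<^sub>\<infinity>w\<in>D k. \<Sum>\<^sub>\<infinity>l::int. of_real (?Q (pi\<^sup>2 / t) w l) * cis (?c w l))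
    = (\<Sum>\<^sub>\<infinity>(w, l::int)\<in>D k \<times> UNIV. of_real (?Q (pi\<^sup>2 / t) w l) * cis (?c w l))"
    by (rule infsum_Times_banach[OF Dsum, symmetric])
  also have "\<dots> = (\<Sum>\<^sub>\<infinity>p\<in>D k \<times> (UNIV::int set). (\<lambda>w. of_real (exp (- (pi\<^sup>2 / t) * (norm w)\<^sup>2)) * cis (2 * pi * (w \<bullet> z))) (?\<phi> p))"
    by (rule infsum_cong) (auto simp: norm_D inner_D VD y z n_def)
  also have "\<dots> = (\<Sum>\<^sub>\<infinity>w\<in>D (Suc k). of_real (exp (- (pi\<^sup>2 / t) * (norm w)\<^sup>2)) * cis (2 * pi * (w \<bullet> z)))"
    by (rule infsum_reindex_bij_betw[OF bij_D])
  also have "of_real (K t) * (of_real c * (\<Sum>\<^sub>\<infinity>w\<in>D (Suc k). of_real (exp (- (pi\<^sup>2 / t) * (norm w)\<^sup>2)) * cis (2 * pi * (w \<bullet> z)))) =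
    of_real (K t * c) * (\<Sum>\<^sub>\<infinity>w\<in>D (Suc k). of_real (exp (- (pi\<^sup>2 / t) * (norm w)\<^sup>2)) * cis (2 * pi * (w \<bullet> z)))"
    by (simp only: of_real_mult mult.assoc)
  also have "K t * c = sqrt (pi / t) ^ Suc k / sqrt (gdet (Suc k) b)"
    unfolding K_def c_def gdet_eq n_def[symmetric] by (simp add: real_sqrt_mult real_sqrt_divide mult_ac)
  finally show "(\<Sum>\<^sub>\<infinity>x\<in>zspan (Suc k) b. complex_of_real (exp (- t * (norm (x + z))\<^sup>2))) =
      of_real (sqrt (pi / t) ^ Suc k / sqrt (gdet (Suc k) b)) * (\<Sum>\<^sub>\<infinity>w\<in>D (Suc k). of_real (exp (- (pi\<^sup>2 / t) * (norm w)\<^sup>2)) * cis (2 * pi * (w \<bullet> z)))" .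
qed

lemma dualg_zspan: "dualg (zspan k b) = {w \<in> span (b ` {..<k}). \<forall>i<k. w \<bullet> b i \<in> \<int>}" for b :: "nat \<Rightarrow> 'a::euclidean_space"
proof -
  have sp: "span (zspan k b) = span (b ` {..<k})"
  proof
    show "span (zspan k b) \<subseteq> span (b ` {..<k})"
      using span_mono[OF zspan_subset_span, of k b] by (simp add: span_span)
    show "span (b ` {..<k}) \<subseteq> span (zspan k b)" by (intro span_mono) (auto intro: zspan_base)
  qed
  have "w \<bullet> x \<in> \<int>" if w: "\<forall>i<k. w \<bullet> b i \<in> \<int>" and x: "x \<in> zspan k b" for w x
  proof -
    obtain c where c: "x = (\<Sum>i<k. of_int (c i) *\<^sub>R b i)" using x by (rule zspanE)
    show ?thesis unfolding c inner_sum_right using w by (intro Ints_sum) (auto intro!: Ints_mult)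
  qed
  then show ?thesis unfolding dualg_def sp by (auto intro: zspan_base)
qed

text \<open>Summability on both sides is proved together with the identity, because the exchange of
  sums at the next rank relies on it. \<open>t\<close> and \<open>z\<close> are general in the
  induction: the hypothesis is used at \<open>pi\<^sup>2 / t\<close> as well as \<open>t\<close>,
  and at all shifts \<open>of_int m *\<^sub>R h + y\<close>.\<close>

lemma poisson_zspan:
  fixes b :: "nat \<Rightarrow> 'a::euclidean_space"
  assumes "gdet k b \<noteq> 0" "t > 0"
  shows "z \<in> span (b ` {..<k}) \<Longrightarrow> (\<lambda>x. exp (- t * (norm (x + z))\<^sup>2)) summable_on zspan k b"
    and "(\<lambda>w. exp (- t * (norm w)\<^sup>2)) summable_on dualg (zspan k b)"
    and "z \<in> span (b ` {..<k}) \<Longrightarrow> (\<Sum>\<^sub>\<infinity>x\<in>zspan k b. complex_of_real (exp (- t * (norm (x + z))\<^sup>2))) =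
      of_real (sqrt (pi / t) ^ k / sqrt (gdet k b)) * (\<Sum>\<^sub>\<infinity>w\<in>dualg (zspan k b). of_real (exp (- (pi\<^sup>2 / t) * (norm w)\<^sup>2)) * cis (2 * pi * (w \<bullet> z)))"
  using assms unfolding dualg_zspan
proof (induction k arbitrary: t z)
  case 0
  {
    case 1 then show ?case by (simp add: zspan_def)
  next
    case 2 then show ?case by simp
  next
    case 3
    have "zspan 0 b = {0}" by (auto simp: zspan_def)
    then show ?case using 3 by simp
  }
next
  case (Suc k)
  {
    case 1
    interpret last_vector b k by unfold_locales (use 1 in simp)
    show ?case by (rule poisson_step(1)) (use 1 nz' Suc.IH in \<open>simp_all add: D_def\<close>)
  next
    case 2
    interpret last_vector b k by unfold_locales (use 2 in simp)
    show ?case unfolding D_def[symmetric] by (rule poisson_step(2)) (use 2 nz' Suc.IH in \<open>simp_all add: D_def\<close>)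
  next
    case 3
    interpret last_vector b k by unfold_locales (use 3 in simp)
    show ?case unfolding D_def[symmetric] by (rule poisson_step(3)) (use 3 nz' Suc.IH in \<open>simp_all add: D_def\<close>)
  }
qed

section \<open>Gaussian mass of lattices\<close>

text \<open>A Jacobi theta constant: the mass of the integers, whose powers are the bounds to be
  proved in each rank.\<close>

definition theta :: "real \<Rightarrow> real" where
  "theta t = (\<Sum>\<^sub>\<infinity>m::int. exp (- t * (of_int m)\<^sup>2))"

definition rho :: "real \<Rightarrow> 'a::real_normed_vector set \<Rightarrow> real" where
  "rho t G = (\<Sum>\<^sub>\<infinity>x\<in>G. exp (- t * (norm x)\<^sup>2))"

lemma span_zbasis: "zbasis k b G \<Longrightarrow> span G = span (b ` {..<k})" for b :: "nat \<Rightarrow> 'a::euclidean_space"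
proof -
  assume "zbasis k b G"
  then have G: "G = zspan k b" by (simp add: zbasis_def)
  show ?thesis
  proof
    show "span G \<subseteq> span (b ` {..<k})" unfolding G
      using span_mono[OF zspan_subset_span, of k b] by (simp add: span_span)
    show "span (b ` {..<k}) \<subseteq> span G" unfolding G by (intro span_mono) (auto intro: zspan_base)
  qed
qed

lemma dim_zbasis: "zbasis k b G \<Longrightarrow> dim G = k" for b :: "nat \<Rightarrow> 'a::euclidean_space"
  using span_zbasis[of k b G] dim_span[of G] dim_span_tuple[of k b] by (simp add: zbasis_def)

lemma lattice_shift_summable:
  fixes b :: "nat \<Rightarrow> 'a::euclidean_space"
  assumes "zbasis k b G" "t > 0" "z \<in> span G"
  shows "(\<lambda>x. exp (- t * (norm (x + z))\<^sup>2)) summable_on G"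
  using poisson_zspan(1)[of k b t z] assms span_zbasis[OF assms(1)] by (simp add: zbasis_def)

lemma lattice_summable:
  fixes b :: "nat \<Rightarrow> 'a::euclidean_space"
  assumes "zbasis k b G" "t > 0"
  shows "(\<lambda>x. exp (- t * (norm x)\<^sup>2)) summable_on G"
  using lattice_shift_summable[OF assms span_zero] by simp

lemma rho_shift_poisson:
  fixes b :: "nat \<Rightarrow> 'a::euclidean_space"
  assumes "zbasis k b G" "t > 0" "z \<in> span G"
  shows "(\<Sum>\<^sub>\<infinity>x\<in>G. exp (- t * (norm (x + z))\<^sup>2)) = sqrt (pi / t) ^ k / sqrt (gdet k b) *
    norm (\<Sum>\<^sub>\<infinity>w\<in>dualg G. complex_of_real (exp (- (pi\<^sup>2 / t) * (norm w)\<^sup>2)) * cis (2 * pi * (w \<bullet> z)))"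
proof -
  have b: "gdet k b \<noteq> 0" "G = zspan k b" "z \<in> span (b ` {..<k})" using assms span_zbasis[OF assms(1)] by (auto simp: zbasis_def)
  have "sqrt (pi / t) ^ k / sqrt (gdet k b) \<ge> 0" using assms(2) gdet_nonneg[of k b] by simp
  then have "norm (complex_of_real (sqrt (pi / t) ^ k / sqrt (gdet k b))) = sqrt (pi / t) ^ k / sqrt (gdet k b)"
    unfolding norm_of_real by (rule abs_of_nonneg)
  then show ?thesis unfolding b(2)
    by (subst infsum_real_le_norm[OF poisson_zspan(1)[OF b(1) assms(2) b(3)] _ poisson_zspan(3)[OF b(1) assms(2) b(3)]])
       (simp_all only: norm_mult exp_ge_zero)
qed

lemma rho_poisson:
  fixes b :: "nat \<Rightarrow> 'a::euclidean_space"
  assumes "zbasis k b G" "t > 0"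
  shows "rho t G = sqrt (pi / t) ^ k / sqrt (gdet k b) * rho (pi\<^sup>2 / t) (dualg G)"
proof -
  have s: "(\<lambda>w. exp (- (pi\<^sup>2 / t) * (norm w)\<^sup>2)) summable_on dualg G"
    using poisson_zspan(2)[of k b "pi\<^sup>2 / t"] assms by (simp add: zbasis_def)
  have "(\<Sum>\<^sub>\<infinity>w\<in>dualg G. exp (- (pi\<^sup>2 / t) * (norm w)\<^sup>2)) = norm (\<Sum>\<^sub>\<infinity>w\<in>dualg G. complex_of_real (exp (- (pi\<^sup>2 / t) * (norm w)\<^sup>2)))"
    by (rule infsum_real_le_norm[OF s]) simp_all
  then show ?thesis using rho_shift_poisson[OF assms span_zero] by (simp add: rho_def)
qed

text \<open>After Poisson summation the shifted sum differs from the unshifted one only by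
  characters of modulus one against positive weights.\<close>

lemma rho_shift_le:
  fixes b :: "nat \<Rightarrow> 'a::euclidean_space"
  assumes "zbasis k b G" "t > 0" "z \<in> span G"
  shows "(\<Sum>\<^sub>\<infinity>x\<in>G. exp (- t * (norm (x + z))\<^sup>2)) \<le> rho t G"
proof -
  have s: "(\<lambda>w. exp (- (pi\<^sup>2 / t) * (norm w)\<^sup>2)) summable_on dualg G"
    using poisson_zspan(2)[of k b "pi\<^sup>2 / t"] assms by (simp add: zbasis_def)
  show ?thesis unfolding rho_shift_poisson[OF assms] rho_poisson[OF assms(1,2)] unfolding rho_def
    using assms(2) gdet_nonneg[of k b] by (intro mult_left_mono norm_infsum_cis_le s) auto
qed

lemma theta_poisson: "t > 0 \<Longrightarrow> theta t = sqrt (pi / t) * theta (pi\<^sup>2 / t)"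
proof -
  assume t: "t > 0"
  then have pt: "pi\<^sup>2 / t > 0" by simp
  have "(\<Sum>\<^sub>\<infinity>m::int. complex_of_real (exp (- t * (of_int m)\<^sup>2))) = of_real (sqrt (pi / t)) * (\<Sum>\<^sub>\<infinity>l::int. of_real (exp (- (pi\<^sup>2 / t) * (of_int l)\<^sup>2)))"
    using poisson_1d[OF t, of 0 0] by simp
  then have "complex_of_real (theta t) = of_real (sqrt (pi / t) * theta (pi\<^sup>2 / t))"
    unfolding theta_def infsum_complex_of_real[OF gauss_int_summable[OF t]] infsum_complex_of_real[OF gauss_int_summable[OF pt]] by simp
  then show ?thesis by (simp only: of_real_eq_iff)
qed

lemma theta_ge_1: "t > 0 \<Longrightarrow> theta t \<ge> 1"
proof -
  assume t: "t > 0"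
  have "(\<Sum>\<^sub>\<infinity>m\<in>{0::int}. exp (- t * (of_int m)\<^sup>2)) \<le> (\<Sum>\<^sub>\<infinity>m. exp (- t * (of_int m)\<^sup>2))"
    by (rule infsum_mono2) (use gauss_int_summable[OF t] in auto)
  then show ?thesis by (simp add: theta_def)
qed

lemma rho_zero: "rho t {0 :: 'a::real_normed_vector} = 1"
  by (simp add: rho_def)

lemma gdet_orthonormal:
  assumes "\<And>i j. i < k \<Longrightarrow> j < k \<Longrightarrow> e i \<bullet> e j = (if i = j then 1 else 0)"
  shows "gdet k e = 1"
proof -
  have "Matrix.mat k k (\<lambda>(i,j). e i \<bullet> e j) = 1\<^sub>m k" by (rule eq_matI) (auto simp: assms)
  then show ?thesis by (simp add: gdet_def)
qed

lemma rho_orthonormal: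
  fixes e :: "nat \<Rightarrow> 'a::euclidean_space"
  assumes t: "t > 0" and "\<And>i j. i < k \<Longrightarrow> j < k \<Longrightarrow> e i \<bullet> e j = (if i = j then 1 else 0)"
  shows "rho t (zspan k e) = theta t ^ k"
  using assms(2)
proof (induction k)
  case 0
  have "zspan 0 e = {0}" by (auto simp: zspan_def)
  then show ?case by (simp add: rho_zero)
next
  case (Suc k)
  have gd: "gdet (Suc k) e = 1" "gdet k e = 1" by (rule gdet_orthonormal; simp add: Suc.prems)+
  interpret last_vector e k by unfold_locales (simp add: gd)
  have ek: "x \<bullet> e k = 0" if x: "x \<in> zspan k e" for x
  proof -
    obtain c where "x = (\<Sum>i<k. of_int (c i) *\<^sub>R e i)" using x by (rule zspanE)
    then show ?thesis by (simp add: inner_sum_left Suc.prems)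
  qed
  have nk: "norm (e k) = 1" using Suc.prems[of k k] by (simp add: norm_eq_1)
  have eq: "exp (- t * (norm ((\<lambda>(m, x). x + of_int m *\<^sub>R e k) p))\<^sup>2) = (\<lambda>(m, x). exp (- t * (of_int m)\<^sup>2) * exp (- t * (norm x)\<^sup>2)) p"
    if p: "p \<in> UNIV \<times> zspan k e" for p :: "int \<times> 'a"
  proof -
    obtain m x where mx: "p = (m, x)" "x \<in> zspan k e" using p by auto
    have "(norm (x + of_int m *\<^sub>R e k))\<^sup>2 = (norm x)\<^sup>2 + (norm (of_int m *\<^sub>R e k))\<^sup>2"
      by (rule norm_add_orth) (simp add: ek[OF mx(2)])
    then show ?thesis by (simp add: mx(1) nk algebra_simps flip: exp_add)
  qed
  have zb: "zbasis (Suc k) e (zspan (Suc k) e)" using gd by (simp add: zbasis_def)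
  have "(\<lambda>p. exp (- t * (norm ((\<lambda>(m, x). x + of_int m *\<^sub>R e k) p))\<^sup>2)) summable_on UNIV \<times> zspan k e"
    unfolding summable_on_reindex_bij_betw[OF bij_zspan, of "\<lambda>y. exp (- t * (norm y)\<^sup>2)"] by (rule lattice_summable[OF zb t])
  then have s: "(\<lambda>(m, x). exp (- t * (of_int m)\<^sup>2) * exp (- t * (norm x)\<^sup>2)) summable_on UNIV \<times> zspan k e"
    by (rule iffD1[OF summable_on_cong, rotated]) (rule eq)
  have "rho t (zspan (Suc k) e) = (\<Sum>\<^sub>\<infinity>p\<in>UNIV \<times> zspan k e. exp (- t * (norm ((\<lambda>(m, x). x + of_int m *\<^sub>R e k) p))\<^sup>2))"
    unfolding rho_def by (rule infsum_reindex_bij_betw[OF bij_zspan, symmetric])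
  also have "\<dots> = (\<Sum>\<^sub>\<infinity>(m, x)\<in>UNIV \<times> zspan k e. exp (- t * (of_int m)\<^sup>2) * exp (- t * (norm x)\<^sup>2))"
    by (rule infsum_cong) (rule eq)
  also have "\<dots> = (\<Sum>\<^sub>\<infinity>m. \<Sum>\<^sub>\<infinity>x\<in>zspan k e. exp (- t * (of_int m)\<^sup>2) * exp (- t * (norm x)\<^sup>2))"
    by (rule infsum_Times_banach[OF s])
  also have "\<dots> = theta t * rho t (zspan k e)"
    unfolding infsum_cmult_right' infsum_cmult_left' theta_def rho_def ..
  finally show ?case using Suc by simp
qed

lemma zbasis_extend:
  fixes b d :: "nat \<Rightarrow> 'a::euclidean_space"
  assumes G: "agroup G" and b: "zbasis m b (G \<inter> span (b ` {..<m}))"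
    and d: "zbasis q d (perp (b ` {..<m}) ` G)"
  shows "\<exists>e. zbasis (m + q) e G"
proof -
  let ?p = "perp (b ` {..<m})"
  have "\<forall>i. \<exists>x. i < q \<longrightarrow> x \<in> G \<and> d i = ?p x"
  proof
    fix i show "\<exists>x. i < q \<longrightarrow> x \<in> G \<and> d i = ?p x"
    proof (cases "i < q")
      case True
      then have "d i \<in> ?p ` G" using d zspan_base[of i q d] by (simp add: zbasis_def)
      then show ?thesis by auto
    qed simp
  qed
  from choice[OF this] obtain c where c: "\<forall>i. i < q \<longrightarrow> c i \<in> G \<and> d i = ?p (c i)" by (rule exE)
  have "gdet q (\<lambda>i. ?p (c i)) = gdet q d" by (rule gdet_cong) (simp add: c)
  moreover have "zspan q (\<lambda>i. ?p (c i)) = zspan q d" by (rule zspan_cong) (simp add: c)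
  ultimately have "zbasis q (\<lambda>i. ?p (c i)) (?p ` G)" using d by (simp add: zbasis_def)
  from zbasis_glue(1)[OF G b this] c show ?thesis by auto
qed

text \<open>The fibres of the orthogonal projection along \<open>span G1\<close> are shifts of \<open>G1\<close>, and shifting a
  lattice inside its span does not increase its Gaussian mass.\<close>

lemma rho_split:
  fixes b d :: "nat \<Rightarrow> 'a::euclidean_space"
  assumes t: "t > 0" and G: "agroup G" and b: "zbasis m b (G \<inter> span (b ` {..<m}))"
    and d: "zbasis q d (perp (b ` {..<m}) ` G)"
  shows "rho t G \<le> rho t (G \<inter> span (b ` {..<m})) * rho t (perp (b ` {..<m}) ` G)"
proof -
  define p where "p = perp (b ` {..<m})"
  define V where "V = span (b ` {..<m})"
  define l where "l y = (SOME x. x \<in> G \<and> p x = y)" for y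
  have lp: "linear p" unfolding p_def by (rule linear_perp)
  have l: "l y \<in> G" "p (l y) = y" if "y \<in> p ` G" for y
  proof -
    have "\<exists>x. x \<in> G \<and> p x = y" using that by auto
    from someI_ex[OF this] show "l y \<in> G" "p (l y) = y" by (auto simp: l_def)
  qed
  have p0: "p x = 0 \<longleftrightarrow> x \<in> V" for x unfolding p_def V_def by (rule perp_eq_0_iff)
  obtain e where zG: "zbasis (m + q) e G" using zbasis_extend[OF G b d] by (rule exE)
  have spV: "span (G \<inter> V) = V" using span_zbasis[OF b] by (simp add: V_def)
  have bij: "bij_betw (\<lambda>(y, x). l y + x) (p ` G \<times> (G \<inter> V)) G"
  proof (rule bij_betw_imageI)
    show "inj_on (\<lambda>(y, x). l y + x) (p ` G \<times> (G \<inter> V))"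
    proof (rule inj_onI, clarsimp)
      fix y1 x1 y2 x2 assume *: "l (p y1) + x1 = l (p y2) + x2" "y1 \<in> G" "y2 \<in> G" "x1 \<in> G" "x1 \<in> V" "x2 \<in> G" "x2 \<in> V"
      have pl: "p (l (p y) + x) = p y" if "y \<in> G" "x \<in> V" for x y
        using l(2)[OF imageI[OF that(1)]] p0[THEN iffD2, OF that(2)] by (simp add: linear_add[OF lp])
      have "p y1 = p (l (p y1) + x1)" using *(2,5) by (rule pl[symmetric])
      also have "\<dots> = p (l (p y2) + x2)" by (simp only: *(1))
      also have "\<dots> = p y2" using *(3,7) by (rule pl)
      finally have "p y1 = p y2" .
      then show "p y1 = p y2 \<and> x1 = x2" using * by simp
    qed
    show "(\<lambda>(y, x). l y + x) ` (p ` G \<times> (G \<inter> V)) = G"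
    proof (intro subset_antisym subsetI)
      fix x assume x: "x \<in> G"
      have "p (x - l (p x)) = 0" using l(2)[of "p x"] x by (simp add: linear_diff[OF lp])
      then have "x - l (p x) \<in> G \<inter> V" using p0 agroupD(4)[OF G x] l(1)[of "p x"] x by simp
      then show "x \<in> (\<lambda>(y, x). l y + x) ` (p ` G \<times> (G \<inter> V))"
        using x by (intro image_eqI[of _ _ "(p x, x - l (p x))"]) auto
    qed (auto intro!: agroupD(2)[OF G] l(1))
  qed
  have lV: "l y - y \<in> V" if "y \<in> p ` G" for y
    using perp(1)[of "l y" "b ` {..<m}"] l(2)[OF that] by (simp add: p_def V_def)
  \<comment> \<open>The lift \<open>l y\<close> differs from \<open>y\<close> by a vector of
    \<open>V\<close>, and this difference is the shift of the fibre over \<open>y\<close>. Since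
    \<open>y\<close> is orthogonal to \<open>V\<close>, Pythagoras separates the two Gaussian
    factors.\<close>
  have eq: "exp (- t * (norm ((\<lambda>(y, x). l y + x) u))\<^sup>2) = (\<lambda>(y, x). exp (- t * (norm y)\<^sup>2) * exp (- t * (norm (x + (l y - y)))\<^sup>2)) u"
    if u: "u \<in> p ` G \<times> (G \<inter> V)" for u
  proof -
    obtain y x where yx: "u = (y, x)" "y \<in> p ` G" "x \<in> V" using u by auto
    have xV: "x + (l y - y) \<in> V" using yx lV unfolding V_def by (intro span_add) auto
    obtain y' where "y = p y'" using yx by auto
    then have "y \<bullet> (x + (l y - y)) = 0" using xV unfolding V_def p_def by (simp add: perp(2))
    then have "(norm (y + (x + (l y - y))))\<^sup>2 = (norm y)\<^sup>2 + (norm (x + (l y - y)))\<^sup>2" by (rule norm_add_orth)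
    moreover have "y + (x + (l y - y)) = l y + x" by simp
    ultimately show ?thesis by (simp add: yx(1) algebra_simps flip: exp_add)
  qed
  have "(\<lambda>u. exp (- t * (norm ((\<lambda>(y, x). l y + x) u))\<^sup>2)) summable_on p ` G \<times> (G \<inter> V)"
    unfolding summable_on_reindex_bij_betw[OF bij, of "\<lambda>y. exp (- t * (norm y)\<^sup>2)"] by (rule lattice_summable[OF zG t])
  then have s: "(\<lambda>(y, x). exp (- t * (norm y)\<^sup>2) * exp (- t * (norm (x + (l y - y)))\<^sup>2)) summable_on p ` G \<times> (G \<inter> V)"
    by (rule iffD1[OF summable_on_cong, rotated]) (rule eq)
  have le: "(\<Sum>\<^sub>\<infinity>x\<in>G \<inter> V. exp (- t * (norm (x + (l y - y)))\<^sup>2)) \<le> rho t (G \<inter> V)" if "y \<in> p ` G" for y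
    using rho_shift_le[OF b t] lV[OF that] spV unfolding V_def by simp
  have sd: "(\<lambda>y. exp (- t * (norm y)\<^sup>2) * rho t (G \<inter> V)) summable_on p ` G"
    using lattice_summable[OF d t] unfolding p_def by (rule summable_on_cmult_left)
  have "rho t G = (\<Sum>\<^sub>\<infinity>u\<in>p ` G \<times> (G \<inter> V). exp (- t * (norm ((\<lambda>(y, x). l y + x) u))\<^sup>2))"
    unfolding rho_def by (rule infsum_reindex_bij_betw[OF bij, symmetric])
  also have "\<dots> = (\<Sum>\<^sub>\<infinity>(y, x)\<in>p ` G \<times> (G \<inter> V). exp (- t * (norm y)\<^sup>2) * exp (- t * (norm (x + (l y - y)))\<^sup>2))"
    by (rule infsum_cong) (rule eq)
  also have "\<dots> = (\<Sum>\<^sub>\<infinity>y\<in>p ` G. \<Sum>\<^sub>\<infinity>x\<in>G \<inter> V. exp (- t * (norm y)\<^sup>2) * exp (- t * (norm (x + (l y - y)))\<^sup>2))"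
    by (rule infsum_Times_banach[OF s])
  also have "\<dots> = (\<Sum>\<^sub>\<infinity>y\<in>p ` G. exp (- t * (norm y)\<^sup>2) * (\<Sum>\<^sub>\<infinity>x\<in>G \<inter> V. exp (- t * (norm (x + (l y - y)))\<^sup>2)))"
    unfolding infsum_cmult_right' ..
  also have "\<dots> \<le> (\<Sum>\<^sub>\<infinity>y\<in>p ` G. exp (- t * (norm y)\<^sup>2) * rho t (G \<inter> V))"
  proof (rule infsum_mono[OF _ sd])
    show "(\<lambda>y. exp (- t * (norm y)\<^sup>2) * (\<Sum>\<^sub>\<infinity>x\<in>G \<inter> V. exp (- t * (norm (x + (l y - y)))\<^sup>2))) summable_on p ` G"
    proof (rule summable_on_comparison_test[OF sd])
      show "exp (- t * (norm y)\<^sup>2) * (\<Sum>\<^sub>\<infinity>x\<in>G \<inter> V. exp (- t * (norm (x + (l y - y)))\<^sup>2)) \<le> exp (- t * (norm y)\<^sup>2) * rho t (G \<inter> V)"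
        if "y \<in> p ` G" for y by (intro mult_left_mono le that) simp
      show "0 \<le> exp (- t * (norm y)\<^sup>2) * (\<Sum>\<^sub>\<infinity>x\<in>G \<inter> V. exp (- t * (norm (x + (l y - y)))\<^sup>2))" for y
        by (intro mult_nonneg_nonneg infsum_nonneg) simp_all
    qed
    show "exp (- t * (norm y)\<^sup>2) * (\<Sum>\<^sub>\<infinity>x\<in>G \<inter> V. exp (- t * (norm (x + (l y - y)))\<^sup>2)) \<le> exp (- t * (norm y)\<^sup>2) * rho t (G \<inter> V)"
      if "y \<in> p ` G" for y by (intro mult_left_mono le that) simp
  qed
  also have "\<dots> = rho t (p ` G) * rho t (G \<inter> V)" unfolding infsum_cmult_left' rho_def ..
  finally show ?thesis unfolding p_def V_def by (simp add: mult.commute)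
qed

lemma rho_scale_mono:
  fixes b :: "nat \<Rightarrow> 'a::euclidean_space"
  assumes t: "t > 0" and G: "zbasis k b G" and c: "c \<ge> 1"
  shows "rho t G \<le> rho t ((\<lambda>x. x /\<^sub>R c) ` G)"
proof -
  have c0: "c > 0" using c by simp
  have inj: "inj_on (\<lambda>x. x /\<^sub>R c) G" using c0 by (intro inj_onI) simp
  have eq: "t * (norm (x /\<^sub>R c))\<^sup>2 = (t / c\<^sup>2) * (norm x)\<^sup>2" for x :: 'a
    using c0 by (simp add: power_divide divide_inverse power_mult_distrib power_inverse)
  have "rho t ((\<lambda>x. x /\<^sub>R c) ` G) = (\<Sum>\<^sub>\<infinity>x\<in>G. exp (- (t / c\<^sup>2) * (norm x)\<^sup>2))"
    unfolding rho_def infsum_reindex[OF inj] using eq by (simp add: o_def)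
  moreover have "rho t G \<le> (\<Sum>\<^sub>\<infinity>x\<in>G. exp (- (t / c\<^sup>2) * (norm x)\<^sup>2))"
    unfolding rho_def
  proof (rule infsum_mono)
    show "(\<lambda>x. exp (- t * (norm x)\<^sup>2)) summable_on G" by (rule lattice_summable[OF G t])
    show "(\<lambda>x. exp (- (t / c\<^sup>2) * (norm x)\<^sup>2)) summable_on G" using t c0 by (intro lattice_summable[OF G]) simp
    fix x
    have "t / c\<^sup>2 \<le> t / 1" using t c by (intro divide_left_mono) (auto simp: one_le_power)
    then have "t / c\<^sup>2 * (norm x)\<^sup>2 \<le> t * (norm x)\<^sup>2" by (intro mult_right_mono) auto
    then show "exp (- t * (norm x)\<^sup>2) \<le> exp (- (t / c\<^sup>2) * (norm x)\<^sup>2)" by simp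
  qed
  ultimately show ?thesis by simp
qed

section \<open>Contraction and duality\<close>

lemma good_norm: "good G \<Longrightarrow> \<forall>x\<in>G. x \<noteq> 0 \<longrightarrow> norm x \<ge> 1"
  using good_norm_ge by blast

lemma good_agroup: "good G \<Longrightarrow> agroup G"
  by (simp add: good_def)

lemma good_has_basis:
  fixes G :: "'a::euclidean_space set"
  assumes "good G"
  obtains k b where "zbasis k b G"
proof -
  \<comment> \<open>With determinant bound \<open>0\<close> the norm bound is vacuous, since the
    determinant of a basis is positive; what remains is the existence of a basis.\<close>
  obtain R where R: "\<forall>G :: 'a set. agroup G \<and> (\<forall>x\<in>G. x \<noteq> 0 \<longrightarrow> norm x \<ge> 1) \<and> dim G \<le> DIM('a) \<longrightarrow>
    (\<exists>k b. zbasis k b G \<and> (gdet k b \<le> 0 \<longrightarrow> (\<forall>i<k. norm (b i) \<le> R)))"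
    using reduced_basis[of 1 "DIM('a)" 0] by auto
  have "\<exists>k b. zbasis k b G" using R[rule_format, of G] good_agroup[OF assms] good_norm[OF assms] dim_subset_UNIV[of G] by auto
  then show ?thesis using that by auto
qed

text \<open>Appending lifts of \<open>d\<close> to \<open>b\<close> gives a tuple of
  \<open>G\<close> whose Gram determinant is \<open>gdet m b * gdet q d\<close>. The first factor
  being exactly one, the bound passes to \<open>d\<close> unchanged.\<close>

lemma good_quotient:
  fixes b :: "nat \<Rightarrow> 'a::euclidean_space"
  assumes G: "good G" and b: "\<And>i. i < m \<Longrightarrow> b i \<in> G" "gdet m b = 1"
  shows "good (perp (b ` {..<m}) ` G)"
  unfolding good_def
proof (intro conjI allI impI)
  let ?p = "perp (b ` {..<m})"
  show "agroup (?p ` G)" by (rule agroup_linear_image[OF linear_perp good_agroup[OF G]])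
  fix q and d :: "nat \<Rightarrow> 'a" assume d: "\<forall>i<q. d i \<in> ?p ` G"
  have "\<forall>i. \<exists>x. i < q \<longrightarrow> x \<in> G \<and> d i = ?p x" using d by auto
  from choice[OF this] obtain c where c: "\<forall>i. i < q \<longrightarrow> c i \<in> G \<and> d i = ?p (c i)" by (rule exE)
  define e where "e i = (if i < m then b i else c (i - m))" for i
  have eb: "e ` {..<m} = b ` {..<m}" by (auto simp: e_def)
  have "gdet (m + q) e = gdet m e * gdet q d"
  proof (rule gdet_split)
    show "e (m + i) - d i \<in> span (e ` {..<m})" if "i < q" for i
      unfolding eb using c that by (simp add: e_def perp)
    show "d i \<bullet> e j = 0" if "i < q" "j < m" for i j
      using c that by (simp add: e_def perp span_base)
  qed
  moreover have "gdet m e = gdet m b" by (rule gdet_cong) (simp add: e_def)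
  ultimately have eq: "gdet q d = gdet (m + q) e" using b(2) by simp
  have "e i \<in> G" if "i < m + q" for i using b c that by (auto simp: e_def)
  then show "gdet q d = 0 \<or> gdet q d \<ge> 1" using goodD[OF G, of "m + q" e] eq by auto
qed

lemma gdet_scale: "gdet k (\<lambda>i. r *\<^sub>R b i) = (r\<^sup>2) ^ k * gdet k b" for b :: "nat \<Rightarrow> 'a::real_inner"
proof -
  define A where "A = Matrix.mat k k (\<lambda>(i,j). if i = j then r else 0)"
  have A: "A \<in> carrier_mat k k" by (simp add: A_def)
  have "gdet k (\<lambda>i. r *\<^sub>R b i) = (Determinant.det A)\<^sup>2 * gdet k b"
  proof (rule gdet_base_change[OF A])
    fix i assume "i < k"
    have "(\<Sum>j<k. A $$ (i, j) *\<^sub>R b j) = (\<Sum>j<k. if j = i then r *\<^sub>R b i else 0)"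
      using \<open>i < k\<close> by (intro sum.cong) (auto simp: A_def)
    then show "r *\<^sub>R b i = (\<Sum>j<k. A $$ (i, j) *\<^sub>R b j)" using \<open>i < k\<close> by simp
  qed
  also have "Determinant.det A = r ^ k"
    by (subst det_lower_triangular[OF _ A]) (auto simp: A_def prod_list_diag_prod)
  finally show ?thesis by (simp add: power_mult[symmetric] mult.commute)
qed

text \<open>The sublattice generated by a tuple inherits the minimal norm \<open>m\<close>, so it
  has a basis inside a ball whose radius does not depend on the tuple, and that ball contains
  finitely many elements of \<open>G\<close>.\<close>

lemma finite_gdet_values:
  fixes G :: "'a::euclidean_space set"
  assumes G: "agroup G" and m: "m > 0" "\<forall>x\<in>G. x \<noteq> 0 \<longrightarrow> norm x \<ge> m"
  shows "finite {gdet r xs | xs. (\<forall>i<r. xs i \<in> G) \<and> gdet r xs \<noteq> 0 \<and> gdet r xs \<le> D}" (is "finite ?S")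
proof -
  obtain R where R: "\<forall>G :: 'a set. agroup G \<and> (\<forall>x\<in>G. x \<noteq> 0 \<longrightarrow> norm x \<ge> m) \<and> dim G \<le> DIM('a) \<longrightarrow>
      (\<exists>k b. zbasis k b G \<and> (gdet k b \<le> D \<longrightarrow> (\<forall>i<k. norm (b i) \<le> R)))"
    using reduced_basis[OF m(1), of "DIM('a)" D] by auto
  let ?F = "{x \<in> G. norm x \<le> R}"
  have fin: "finite ?F" using m by (intro discrete_finite_ball[OF G m(1)]) auto
  have "?S \<subseteq> gdet r ` (PiE {..<r} (\<lambda>_. ?F))"
  proof
    fix v assume "v \<in> ?S"
    then obtain xs where xs: "v = gdet r xs" "\<forall>i<r. xs i \<in> G" "gdet r xs \<noteq> 0" "gdet r xs \<le> D" by auto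
    have sub: "zspan r xs \<subseteq> G" using xs(2) by (intro zspan_subset G) auto
    have "\<forall>x\<in>zspan r xs. x \<noteq> 0 \<longrightarrow> norm x \<ge> m" using sub m(2) by auto
    then have "\<exists>k b. zbasis k b (zspan r xs) \<and> (gdet k b \<le> D \<longrightarrow> (\<forall>i<k. norm (b i) \<le> R))"
      using R[rule_format, of "zspan r xs"] agroup_zspan[of r xs] dim_subset_UNIV[of "zspan r xs"] by simp
    then obtain k b where kb: "zbasis k b (zspan r xs)" "gdet k b \<le> D \<longrightarrow> (\<forall>i<k. norm (b i) \<le> R)" by auto
    have "zbasis r xs (zspan r xs)" using xs(3) by (simp add: zbasis_def)
    then have kr: "k = r" using kb(1) zbasis_rank_unique by metis
    have zz: "zspan r b = zspan r xs" using kb(1) kr by (simp add: zbasis_def)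
    have gg: "gdet r b = gdet r xs" by (rule gdet_basis_unique[OF zz])
    have bF: "b i \<in> ?F" if "i < r" for i
      using kb(2) gg xs(4) kr that zspan_base[OF that, of b] sub zz by auto
    let ?b = "restrict b {..<r}"
    have "gdet r ?b = v" unfolding xs(1) gg[symmetric] by (rule gdet_cong) simp
    moreover have "?b \<in> PiE {..<r} (\<lambda>_. ?F)" using bF by auto
    ultimately show "v \<in> gdet r ` (PiE {..<r} (\<lambda>_. ?F))" by blast
  qed
  then show ?thesis by (rule finite_subset) (intro finite_imageI finite_PiE finite_lessThan fin)
qed

lemma min_gdet:
  fixes G :: "'a::euclidean_space set"
  assumes G: "agroup G" and m: "m > 0" "\<forall>x\<in>G. x \<noteq> 0 \<longrightarrow> norm x \<ge> m"
    and b: "\<And>i. i < r \<Longrightarrow> b i \<in> G" "gdet r b \<noteq> 0"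
  obtains c where "\<forall>i<r. c i \<in> G" "gdet r c \<noteq> 0" "\<forall>d. (\<forall>i<r. d i \<in> G) \<and> gdet r d \<noteq> 0 \<longrightarrow> gdet r c \<le> gdet r d"
proof -
  let ?S = "{gdet r xs | xs. (\<forall>i<r. xs i \<in> G) \<and> gdet r xs \<noteq> 0 \<and> gdet r xs \<le> gdet r b}"
  have fin: "finite ?S" by (rule finite_gdet_values[OF G m])
  have ne: "gdet r b \<in> ?S" using b by auto
  have "Min ?S \<in> ?S" using fin ne by (intro Min_in) auto
  then obtain c where c: "Min ?S = gdet r c" "\<forall>i<r. c i \<in> G" "gdet r c \<noteq> 0" by auto
  have "gdet r c \<le> gdet r d" if d: "\<forall>i<r. d i \<in> G" "gdet r d \<noteq> 0" for d
  proof (cases "gdet r d \<le> gdet r b")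
    case True
    then have "gdet r d \<in> ?S" using d by auto
    then show ?thesis unfolding c(1)[symmetric] using fin by (intro Min_le)
  next
    case False
    then show ?thesis using Min_le[OF fin ne] c(1) by simp
  qed
  then show ?thesis using that[of c] c by simp
qed

text \<open>The contraction factor is the least \<open>m\<close>-th root of a covolume of \<open>m\<close> independent elements of \<open>G\<close>.\<close>

lemma good_contraction:
  fixes G :: "'a::euclidean_space set"
  assumes G: "good G" and b: "zbasis k b G" and k: "k \<ge> 1"
  obtains c m xs where "c \<ge> 1" "good ((\<lambda>x. x /\<^sub>R c) ` G)" "1 \<le> m" "m \<le> k"
    "\<forall>i<m. xs i \<in> (\<lambda>x. x /\<^sub>R c) ` G" "gdet m xs = 1"
proof -
  have ag: "agroup G" by (rule good_agroup[OF G])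
  have bG: "b i \<in> G" if "i < k" for i using b zspan_base[OF that, of b] by (simp add: zbasis_def)
  have bnz: "gdet m b \<noteq> 0" if "m \<le> k" for m
  proof (rule independent_imp_gdet_nz)
    have nzb: "gdet k b \<noteq> 0" using b by (simp add: zbasis_def)
    have sub: "{..<m} \<subseteq> {..<k}" using that by simp
    show "inj_on b {..<m}" by (rule inj_on_subset[OF gdet_nz_imp_independent(1)[OF nzb] sub])
    show "independent (b ` {..<m})" by (rule independent_mono[OF gdet_nz_imp_independent(2)[OF nzb] image_mono[OF sub]])
  qed
  have "\<exists>c. \<forall>m\<in>{1..k}. (\<forall>i<m. c m i \<in> G) \<and> gdet m (c m) \<noteq> 0 \<and> (\<forall>d. (\<forall>i<m. d i \<in> G) \<and> gdet m d \<noteq> 0 \<longrightarrow> gdet m (c m) \<le> gdet m d)"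
  proof (rule bchoice, rule ballI)
    fix m assume m: "m \<in> {1..k}"
    obtain c where "\<forall>i<m. c i \<in> G" "gdet m c \<noteq> 0" "\<forall>d. (\<forall>i<m. d i \<in> G) \<and> gdet m d \<noteq> 0 \<longrightarrow> gdet m c \<le> gdet m d"
      by (rule min_gdet[OF ag _ good_norm[OF G], of m b]) (use bG bnz m in auto)
    then show "\<exists>c. (\<forall>i<m. c i \<in> G) \<and> gdet m c \<noteq> 0 \<and> (\<forall>d. (\<forall>i<m. d i \<in> G) \<and> gdet m d \<noteq> 0 \<longrightarrow> gdet m c \<le> gdet m d)"
      by auto
  qed
  then obtain c where c0: "\<forall>m\<in>{1..k}. (\<forall>i<m. c m i \<in> G) \<and> gdet m (c m) \<noteq> 0 \<and>
      (\<forall>d. (\<forall>i<m. d i \<in> G) \<and> gdet m d \<noteq> 0 \<longrightarrow> gdet m (c m) \<le> gdet m d)" by (rule exE)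
  have c: "c j i \<in> G" if "j \<in> {1..k}" "i < j" for i j
    using bspec[OF c0 that(1)] that(2) by simp
  have c': "gdet j (c j) \<noteq> 0" "(\<forall>i<j. d i \<in> G) \<Longrightarrow> gdet j d \<noteq> 0 \<Longrightarrow> gdet j (c j) \<le> gdet j d"
    if "j \<in> {1..k}" for j d
    using bspec[OF c0 that] by simp_all
  define \<mu> where "\<mu> m = root m (sqrt (gdet m (c m)))" for m
  \<comment> \<open>Dividing all vectors by \<open>C\<close> divides the squared covolume of a
    \<open>j\<close>-tuple by \<open>(C\<^sup>2) ^ j\<close>. The minimum over the ranks is thus the
    largest contraction that stays admissible, and some rank \<open>m\<close> attains it with
    equality.\<close>
  define C where "C = Min (\<mu> ` {1..k})"
  have ne: "{1..k} \<noteq> {}" using k by simp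
  have "C \<in> \<mu> ` {1..k}" unfolding C_def using ne by (intro Min_in) auto
  then obtain m where m: "m \<in> {1..k}" "C = \<mu> m" by auto
  have Cle: "C \<le> \<mu> j" if "j \<in> {1..k}" for j unfolding C_def using that by (intro Min_le) auto
  have mu: "((\<mu> j)\<^sup>2) ^ j = gdet j (c j)" if "j \<in> {1..k}" for j
  proof -
    have "((\<mu> j)\<^sup>2) ^ j = (\<mu> j ^ j)\<^sup>2" by (simp add: power_mult[symmetric] mult.commute)
    also have "\<mu> j ^ j = sqrt (gdet j (c j))" unfolding \<mu>_def using that by (intro real_root_pow_pos2) (auto simp: gdet_nonneg)
    also have "(sqrt (gdet j (c j)))\<^sup>2 = gdet j (c j)" by (simp add: gdet_nonneg)
    finally show ?thesis .
  qed
  have C1: "C \<ge> 1"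
  proof -
    have "gdet m (c m) \<ge> 1" using goodD[OF G, of m "c m"] c[OF m(1)] c'(1)[OF m(1)] by auto
    then have "sqrt (gdet m (c m)) \<ge> 1" by simp
    then show ?thesis unfolding m(2) \<mu>_def using m(1) by simp
  qed
  let ?f = "\<lambda>x :: 'a. x /\<^sub>R C"
  have lf: "linear ?f" by (rule linear_compose_scale_right[OF linear_id, unfolded id_def])
  have gs: "gdet j (\<lambda>i. ?f (d i)) = gdet j d / (C\<^sup>2) ^ j" for j d
    using gdet_scale[of j "inverse C" d] by (simp add: power_inverse divide_inverse)
  have lift: "\<exists>d. (\<forall>i<j. d i \<in> G) \<and> gdet j ys = gdet j d / (C\<^sup>2) ^ j" if ys: "\<forall>i<j. ys i \<in> ?f ` G" for j ys
  proof -
    have "\<forall>i. \<exists>x. i < j \<longrightarrow> x \<in> G \<and> ys i = ?f x" using ys by auto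
    from choice[OF this] obtain d where d: "\<forall>i. i < j \<longrightarrow> d i \<in> G \<and> ys i = ?f (d i)" by (rule exE)
    have "gdet j ys = gdet j (\<lambda>i. ?f (d i))" by (rule gdet_cong) (use d in auto)
    then show ?thesis using gs[of j d] d by auto
  qed
  have "good (?f ` G)"
    unfolding good_def
  proof (intro conjI allI impI)
    show "agroup (?f ` G)" by (rule agroup_linear_image[OF lf ag])
    fix j and ys :: "nat \<Rightarrow> 'a" assume "\<forall>i<j. ys i \<in> ?f ` G"
    from lift[OF this] obtain d where d: "\<forall>i<j. d i \<in> G" "gdet j ys = gdet j d / (C\<^sup>2) ^ j" by auto
    show "gdet j ys = 0 \<or> gdet j ys \<ge> 1"
    proof (cases "gdet j d = 0 \<or> j = 0")
      case True
      then show ?thesis using d by auto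
    next
      case False
      have "j \<le> dim G" by (rule gdet_nz_le_dim[of j d]) (use False d in \<open>auto intro: span_base\<close>)
      then have j: "j \<in> {1..k}" using dim_zbasis[OF b] False by auto
      have "(C\<^sup>2) ^ j \<le> ((\<mu> j)\<^sup>2) ^ j" using Cle[OF j] C1 by (intro power_mono) auto
      also have "\<dots> \<le> gdet j d" unfolding mu[OF j] using c'(2)[OF j d(1)] False by simp
      finally have "gdet j ys \<ge> 1" unfolding d(2) using C1 by simp
      then show ?thesis by simp
    qed
  qed
  moreover have "(C\<^sup>2) ^ m = gdet m (c m)" unfolding m(2) by (rule mu[OF m(1)])
  then have "gdet m (\<lambda>i. ?f (c m i)) = 1"
    unfolding gs using c'(1)[OF m(1)] by simp
  ultimately show ?thesis using that[of C m "\<lambda>i. ?f (c m i)"] C1 m(1) c[OF m(1)] by auto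
qed

text \<open>The new height vector \<open>f\<close> is also the orthogonal component of
  \<open>T d\<close>, so each height is at most \<open>norm (T d)\<close> and hence at most
  \<open>norm d\<close>.\<close>

lemma gdet_linear_upper:
  fixes b :: "nat \<Rightarrow> 'a::euclidean_space"
  assumes T: "linear (T :: 'a \<Rightarrow> 'a)" and c: "\<And>x. norm (T x) \<le> norm x"
  shows "gdet k (\<lambda>i. T (b i)) \<le> gdet k b"
proof (induction k)
  case (Suc k)
  obtain d where d: "b k - d \<in> span (b ` {..<k})" "\<And>y. y \<in> span (b ` {..<k}) \<Longrightarrow> d \<bullet> y = 0"
    "gdet (Suc k) b = gdet k b * (norm d)\<^sup>2" by (rule gdet_SucE[of b k]) blast
  define e where "e i = T (b i)" for i
  obtain f where f: "e k - f \<in> span (e ` {..<k})" "\<And>y. y \<in> span (e ` {..<k}) \<Longrightarrow> f \<bullet> y = 0"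
    "gdet (Suc k) e = gdet k e * (norm f)\<^sup>2" by (rule gdet_SucE[of e k]) blast
  have "e ` {..<k} = T ` (b ` {..<k})" by (auto simp: e_def)
  then have sp: "span (e ` {..<k}) = T ` span (b ` {..<k})"
    by (simp only: linear_span_image[OF T])
  have "T (b k - d) \<in> span (e ` {..<k})" unfolding sp using d(1) by (rule imageI)
  then have "(e k - f) - T (b k - d) \<in> span (e ` {..<k})" by (rule span_diff[OF f(1)])
  moreover have "(e k - f) - T (b k - d) = T d - f" by (simp add: e_def linear_diff[OF T])
  ultimately have "T d - f \<in> span (e ` {..<k})" by (simp only:)
  then have "f \<bullet> (T d - f) = 0" by (rule f(2))
  then have "norm f \<le> norm (f + (T d - f))" by (rule norm_le_add_orth)
  also have "\<dots> \<le> norm d" using c[of d] by simp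
  finally have "(norm f)\<^sup>2 \<le> (norm d)\<^sup>2" by (intro power_mono) auto
  then have "gdet k e * (norm f)\<^sup>2 \<le> gdet k b * (norm d)\<^sup>2"
    using Suc.IH unfolding e_def[abs_def] by (intro mult_mono gdet_nonneg) auto
  then show ?case using d(3) f(3) by (simp add: e_def[abs_def])
qed simp

lemma agroup_dualg: "agroup (dualg G)"
  unfolding agroup_def dualg_def
  by (auto intro: span_zero span_add span_neg Ints_add Ints_minus simp: inner_add_left)

text \<open>Gluing of generators along an arbitrary linear map, with no claim of independence:
  \<open>good_dual\<close> applies it to the projection onto a span and settles independence
  afterwards through determinants.\<close>

lemma zspan_glue:
  fixes b c :: "nat \<Rightarrow> 'a::real_vector" and f :: "'a \<Rightarrow> 'a"
  assumes f: "linear f" and G: "agroup G" and b: "zspan m b = {x \<in> G. f x = 0}"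
    and d: "zspan q (\<lambda>i. f (c i)) = f ` G" and c: "\<And>i. i < q \<Longrightarrow> c i \<in> G"
  shows "zspan (m + q) (\<lambda>i. if i < m then b i else c (i - m)) = G"
proof
  let ?e = "\<lambda>i. if i < m then b i else c (i - m)"
  have bG: "b i \<in> G" if "i < m" for i using b zspan_base[OF that, of b] by auto
  show "zspan (m + q) ?e \<subseteq> G" using bG c by (intro zspan_subset G) simp
  have app: "zspan (m + q) ?e = {x + y | x y. x \<in> zspan m ?e \<and> y \<in> zspan q c}"
    by (rule zspan_append) simp
  have zm: "zspan m ?e = {x \<in> G. f x = 0}" unfolding b[symmetric] by (rule zspan_cong) simp
  show "G \<subseteq> zspan (m + q) ?e"
  proof
    fix x assume x: "x \<in> G"
    have "f x \<in> zspan q (\<lambda>i. f (c i))" unfolding d using x by (rule imageI)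
    then have "f x \<in> f ` zspan q c" unfolding zspan_image[OF f] .
    then obtain y where y: "f x = f y" "y \<in> zspan q c" by (rule imageE)
    have "y \<in> G" using zspan_subset[OF G, of q c] y(2) c by auto
    then have "x - y \<in> zspan m ?e" unfolding zm using x y(1) agroupD(4)[OF G] linear_diff[OF f, of x y] by simp
    then have "(x - y) + y \<in> zspan (m + q) ?e" unfolding app using y(2) by blast
    then show "x \<in> zspan (m + q) ?e" by simp
  qed
qed

text \<open>A tuple \<open>ys\<close> of the dual pairs integrally with the projection of \<open>G\<close> to the span of \<open>ys\<close>,
  and the covolume of that projection is at most the covolume of \<open>G\<close>.\<close>

lemma good_dual:
  fixes G :: "'a::euclidean_space set"
  assumes G: "good G" and b: "zbasis k b G" and det1: "gdet k b = 1"
  shows "good (dualg G)"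
  unfolding good_def
proof (intro conjI allI impI agroup_dualg)
  fix r and ys :: "nat \<Rightarrow> 'a"
  assume ys: "\<forall>i<r. ys i \<in> dualg G"
  show "gdet r ys = 0 \<or> gdet r ys \<ge> 1"
  proof (cases "gdet r ys = 0")
    case False
    define V where "V = span (ys ` {..<r})"
    \<comment> \<open>The orthogonal projection onto \<open>V\<close>, written as the complement of
      \<open>perp\<close>. Pairing with a vector of \<open>V\<close> does not distinguish
      \<open>x\<close> from \<open>f x\<close>.\<close>
    define f where "f x = x - perp (ys ` {..<r}) x" for x
    have lf: "linear f" unfolding f_def by (intro linear_compose_sub linear_perp linear_ident)
    have fV: "f x \<in> V" for x unfolding f_def V_def by (rule perp)
    have of: "w \<bullet> f x = w \<bullet> x" if "w \<in> V" for w x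
      using perp(2)[of w "ys ` {..<r}" x] that unfolding f_def V_def
      by (simp add: inner_diff_right inner_commute[of w "perp _ _"])
    have ag: "agroup G" by (rule good_agroup[OF G])
    have ysG: "ys i \<in> span G" "\<forall>x\<in>G. ys i \<bullet> x \<in> \<int>" if "i < r" for i using ys that by (auto simp: dualg_def)
    have ysV: "ys i \<in> V" if "i < r" for i using that by (auto simp: V_def intro: span_base)
    have VG: "V \<subseteq> span G" unfolding V_def using ysG by (intro span_minimal) auto
    have int: "ys i \<bullet> f x \<in> \<int>" if "i < r" "x \<in> G" for i x using of[OF ysV[OF that(1)]] ysG(2)[OF that(1)] that(2) by simp
    have nc: "norm (f x) \<le> norm x" for x
    proof -
      have "f x \<bullet> perp (ys ` {..<r}) x = 0"
        using perp(2)[of "f x" "ys ` {..<r}" x] fV[of x] unfolding V_def by (simp add: inner_commute)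
      then have "norm (f x) \<le> norm (f x + perp (ys ` {..<r}) x)" by (rule norm_le_add_orth)
      then show ?thesis by (simp add: f_def)
    qed
    \<comment> \<open>A nonzero element of the projected lattice has a nonzero integer pairing with
      some \<open>ys i\<close>, so its norm is at least \<open>1 / M\<close>. The summand
      \<open>1\<close> makes \<open>M\<close> positive even for an empty tuple.\<close>
    define M where "M = 1 + (\<Sum>i<r. norm (ys i))"
    have M: "M > 0" "\<And>i. i < r \<Longrightarrow> norm (ys i) \<le> M"
    proof -
      have "(\<Sum>i<r. norm (ys i)) \<ge> 0" by (intro sum_nonneg) auto
      then show "M > 0" by (simp add: M_def)
      show "norm (ys i) \<le> M" if "i < r" for i
        using member_le_sum[of i "{..<r}" "\<lambda>i. norm (ys i)"] that by (simp add: M_def)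
    qed
    have disc: "\<forall>y\<in>f ` G. y \<noteq> 0 \<longrightarrow> norm y \<ge> 1 / M"
    proof (intro ballI impI)
      fix y assume y: "y \<in> f ` G" "y \<noteq> 0"
      then obtain x where x: "x \<in> G" "y = f x" by auto
      have "\<exists>i<r. ys i \<bullet> y \<noteq> 0"
      proof (rule ccontr)
        assume "\<not> (\<exists>i<r. ys i \<bullet> y \<noteq> 0)"
        then have n: "\<forall>i<r. ys i \<bullet> y = 0" by simp
        obtain u where "y = (\<Sum>i<r. u i *\<^sub>R ys i)" using fV[of x] unfolding x(2)[symmetric] V_def span_range_tuple by auto
        then have "y \<bullet> y = (\<Sum>i<r. u i * (ys i \<bullet> y))" by (metis (no_types, lifting) inner_scaleR_left inner_sum_left sum.cong)
        then show False using n y(2) by simp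
      qed
      then obtain i where i: "i < r" "ys i \<bullet> y \<noteq> 0" by auto
      have "ys i \<bullet> y \<in> \<int>" unfolding x(2) by (rule int[OF i(1) x(1)])
      then have "1 \<le> \<bar>ys i \<bullet> y\<bar>" using i(2) by (rule Ints_nonzero_abs_ge1)
      also have "\<dots> \<le> norm (ys i) * norm y" by (rule Cauchy_Schwarz_ineq2)
      also have "\<dots> \<le> M * norm y" using M(2)[OF i(1)] by (intro mult_right_mono) auto
      finally show "norm y \<ge> 1 / M" using M(1) by (simp add: field_simps)
    qed
    have agf: "agroup (f ` G)" by (rule agroup_linear_image[OF lf ag])
    obtain R where R: "\<forall>G :: 'a set. agroup G \<and> (\<forall>x\<in>G. x \<noteq> 0 \<longrightarrow> norm x \<ge> 1 / M) \<and> dim G \<le> DIM('a) \<longrightarrow>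
      (\<exists>k b. zbasis k b G \<and> (gdet k b \<le> 0 \<longrightarrow> (\<forall>i<k. norm (b i) \<le> R)))"
      using reduced_basis[of "1 / M" "DIM('a)" 0] M(1) by auto
    have "\<exists>j d. zbasis j d (f ` G)" using R[rule_format, of "f ` G"] agf disc dim_subset_UNIV[of "f ` G"] by auto
    then obtain j d where d: "zbasis j d (f ` G)" by auto
    have "\<forall>i. \<exists>x. i < j \<longrightarrow> x \<in> G \<and> d i = f x"
    proof
      fix i show "\<exists>x. i < j \<longrightarrow> x \<in> G \<and> d i = f x"
      proof (cases "i < j")
        case True
        then have "d i \<in> f ` G" using d zspan_base[of i j d] by (simp add: zbasis_def)
        then show ?thesis by auto
      qed simp
    qed
    from choice[OF this] obtain c where c0: "\<forall>i. i < j \<longrightarrow> c i \<in> G \<and> d i = f (c i)" by (rule exE)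
    have c: "c i \<in> G" "d i = f (c i)" if "i < j" for i using c0 that by auto
    have "good {x \<in> G. f x = 0}"
    proof (rule good_subset[OF G])
      show "agroup {x \<in> G. f x = 0}"
        using ag unfolding agroup_def by (simp add: linear_0[OF lf] linear_add[OF lf] linear_neg[OF lf])
    qed auto
    then obtain m bs where bs: "zbasis m bs {x \<in> G. f x = 0}" by (rule good_has_basis)
    define e where "e = (\<lambda>i. if i < m then bs i else c (i - m))"
    have "zspan j (\<lambda>i. f (c i)) = zspan j d" by (rule zspan_cong) (simp add: c(2))
    then have zde: "zspan j (\<lambda>i. f (c i)) = f ` G" using d by (simp add: zbasis_def)
    have eG: "zspan (m + j) e = G"
      unfolding e_def by (rule zspan_glue[OF lf ag _ zde c(1)]) (use bs in \<open>simp add: zbasis_def\<close>)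
    have bsG: "bs i \<in> G" "f (bs i) = 0" if "i < m" for i
      using bs zspan_base[OF that, of bs] by (auto simp: zbasis_def)
    \<comment> \<open>The covolume of \<open>G\<close> factors as
      \<open>gdet m bs * gdet j c' = 1\<close> with the first factor at least one. As
      \<open>f\<close> kills the span of \<open>bs\<close> and lengthens nothing, it follows that
      \<open>gdet j d \<le> gdet j c' \<le> 1\<close>.\<close>
    define c' where "c' i = perp (bs ` {..<m}) (c i)" for i
    have ebs: "e ` {..<m} = bs ` {..<m}" by (auto simp: e_def)
    have ge: "gdet (m + j) e = gdet m e * gdet j c'"
    proof (rule gdet_split)
      show "e (m + i) - c' i \<in> span (e ` {..<m})" for i unfolding ebs by (simp add: e_def c'_def perp)
      show "c' i \<bullet> e l = 0" if "l < m" for i l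
        unfolding c'_def by (rule perp) (use that in \<open>auto simp: e_def intro: span_base\<close>)
    qed
    have "gdet m e = gdet m bs" by (rule gdet_cong) (simp add: e_def)
    then have gm: "gdet m e \<ge> 1" using goodD[OF G, of m bs] bsG bs by (simp add: zbasis_def)
    have fspan: "f x = 0" if "x \<in> span (bs ` {..<m})" for x
    proof -
      have "f x \<in> span (f ` (bs ` {..<m}))" using that linear_span_image[OF lf, of "bs ` {..<m}"] by auto
      also have "span (f ` (bs ` {..<m})) \<subseteq> span {0}" using bsG(2) by (intro span_mono) auto
      finally show ?thesis by simp
    qed
    have "gdet j d = gdet j (\<lambda>i. f (c' i))"
    proof (rule gdet_cong)
      fix i assume i: "i < j"
      have "f (c i - c' i) = 0" unfolding c'_def by (rule fspan) (rule perp)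
      then show "d i = f (c' i)" using c(2)[OF i] by (simp add: linear_diff[OF lf])
    qed
    also have "\<dots> \<le> gdet j c'" by (rule gdet_linear_upper[OF lf nc])
    finally have dc: "gdet j d \<le> gdet j c'" .
    have dpos: "gdet j d > 0" using d gdet_nonneg[of j d] by (simp add: zbasis_def)
    have "gdet (m + j) e \<noteq> 0" using ge gm dc dpos by simp
    then have ze: "zbasis (m + j) e G" using eG by (simp add: zbasis_def)
    have mk: "m + j = k" by (rule zbasis_rank_unique[OF ze b])
    have zz: "zspan k e = zspan k b" using eG b unfolding mk zbasis_def by simp
    have "gdet (m + j) e = gdet k b" unfolding mk by (rule gdet_basis_unique[OF zz])
    then have "gdet m e * gdet j c' = 1" using ge det1 by simp
    moreover have "1 * gdet j c' \<le> gdet m e * gdet j c'" using gm by (intro mult_right_mono gdet_nonneg)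
    ultimately have d1: "gdet j d \<le> 1" using dc by simp
    \<comment> \<open>A vector of \<open>V\<close> orthogonal to every \<open>f x\<close> is
      orthogonal to \<open>G\<close>, hence to \<open>span G\<close>, which contains
      \<open>V\<close>; so it vanishes.\<close>
    have spf: "span (f ` G) = V"
    proof
      show "span (f ` G) \<subseteq> V" using fV unfolding V_def by (intro span_minimal) auto
      show "V \<subseteq> span (f ` G)"
      proof
        fix v assume v: "v \<in> V"
        define w where "w = perp (f ` G) v"
        have "v - w \<in> V" using perp(1)[of v "f ` G"] \<open>span (f ` G) \<subseteq> V\<close> by (auto simp: w_def)
        then have "v - (v - w) \<in> V" using span_diff[of v "ys ` {..<r}" "v - w"] v unfolding V_def by simp
        then have wV: "w \<in> V" by simp
        have "w \<bullet> x = 0" if "x \<in> G" for x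
        proof -
          have "w \<bullet> f x = 0" unfolding w_def by (rule perp(2)[OF span_base[OF imageI[OF that]]])
          then show ?thesis using of[OF wV] by simp
        qed
        then have "G \<subseteq> {x. w \<bullet> x = 0}" by auto
        moreover have "subspace {x. w \<bullet> x = 0}" by (rule subspace_hyperplane)
        ultimately have "span G \<subseteq> {x. w \<bullet> x = 0}" by (rule span_minimal)
        then have "w \<bullet> w = 0" using wV VG by auto
        then have "perp (f ` G) v = 0" by (simp add: w_def)
        then show "v \<in> span (f ` G)" by (simp add: perp_eq_0_iff)
      qed
    qed
    have "dim V = r" unfolding V_def by (rule dim_span_tuple[OF False])
    then have jr: "j = r" using dim_zbasis[OF d] dim_span[of "f ` G"] spf by simp
    have spd: "V = span (d ` {..<r})" using span_zbasis[OF d] spf jr by simp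
    have "\<forall>i. \<exists>u. i < r \<longrightarrow> ys i = (\<Sum>l<r. u l *\<^sub>R d l)"
      using ysV unfolding spd span_range_tuple by (auto simp: image_iff)
    from choice[OF this] obtain u where u: "\<forall>i. i < r \<longrightarrow> ys i = (\<Sum>l<r. u i l *\<^sub>R d l)" by (rule exE)
    define A where "A = Matrix.mat r r (\<lambda>(i,l). u i l)"
    \<comment> \<open>The matrix of pairings has integer entries. Its squared determinant is
      \<open>gdet r ys * gdet r d\<close>, a positive integer, while
      \<open>gdet r d \<le> 1\<close>.\<close>
    define P where "P = Matrix.mat r r (\<lambda>(i,l). ys i \<bullet> d l)"
    define D where "D = Matrix.mat r r (\<lambda>(i,l). d i \<bullet> d l)"
    have A: "A \<in> carrier_mat r r" "D \<in> carrier_mat r r" by (simp_all add: A_def D_def)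
    have gy: "gdet r ys = (Determinant.det A)\<^sup>2 * gdet r d"
      by (rule gdet_base_change[OF A(1)]) (use u in \<open>simp add: A_def\<close>)
    have "P = A * D"
      by (rule eq_matI) (auto simp: P_def A_def D_def scalar_prod_def atLeast0LessThan u inner_sum_left)
    then have detP: "Determinant.det P = Determinant.det A * gdet r d"
      using det_mult[OF A] by (simp add: gdet_def D_def)
    have "\<exists>z. \<forall>i<r. \<forall>l<r. ys i \<bullet> d l = of_int (z i l)"
    proof (intro exI allI impI)
      fix i l assume "i < r" "l < r"
      then have "ys i \<bullet> d l \<in> \<int>" using int[of i "c l"] c[of l] jr by simp
      then show "ys i \<bullet> d l = of_int \<lfloor>ys i \<bullet> d l\<rfloor>" by simp
    qed
    then obtain z where z: "\<forall>i<r. \<forall>l<r. ys i \<bullet> d l = of_int (z i l)" by (rule exE)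
    have "P = map_mat of_int (Matrix.mat r r (\<lambda>(i,l). z i l))" by (rule eq_matI) (use z in \<open>auto simp: P_def\<close>)
    then have "Determinant.det P = of_int (Determinant.det (Matrix.mat r r (\<lambda>(i,l). z i l)))" by (simp add: of_int_hom.hom_det)
    then have Pint: "Determinant.det P \<in> \<int>" by simp
    have "(Determinant.det P)\<^sup>2 = gdet r ys * gdet r d" unfolding detP gy by (simp add: power2_eq_square)
    moreover have "gdet r d > 0" using dpos jr by simp
    ultimately have "Determinant.det P \<noteq> 0" using False by auto
    then have "1 \<le> \<bar>Determinant.det P\<bar>" by (rule Ints_nonzero_abs_ge1[OF Pint])
    then have "1 \<le> (Determinant.det P)\<^sup>2" by (simp add: abs_le_square_iff[of 1, simplified])
    also have "\<dots> = gdet r ys * gdet r d" by fact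
    also have "\<dots> \<le> gdet r ys * 1" using d1 jr by (intro mult_left_mono gdet_nonneg) simp
    finally show ?thesis by simp
  qed simp
qed

section \<open>Compactness of the set of reduced bases\<close>

lemma continuous_on_coord: "continuous_on S (\<lambda>b. b i)" for S :: "(nat \<Rightarrow> 'a::topological_space) set"
  by (rule continuous_on_subset[OF continuous_on_product_coordinates]) simp

lemma continuous_on_gdet:
  fixes f :: "'b::topological_space \<Rightarrow> nat \<Rightarrow> 'a::real_inner"
  assumes "\<And>i. i < k \<Longrightarrow> continuous_on S (\<lambda>x. f x i)"
  shows "continuous_on S (\<lambda>x. gdet k (f x))"
proof -
  have "gdet k (f x) = (\<Sum>p | p permutes {0..<k}. signof p * (\<Prod>i = 0..<k. f x i \<bullet> f x (p i)))" for x
  proof -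
    have "gdet k (f x) = (\<Sum>p | p permutes {0..<k}. signof p * (\<Prod>i = 0..<k. Matrix.mat k k (\<lambda>(i,j). f x i \<bullet> f x j) $$ (i, p i)))"
      unfolding gdet_def by (subst det_def') auto
    also have "\<dots> = (\<Sum>p | p permutes {0..<k}. signof p * (\<Prod>i = 0..<k. f x i \<bullet> f x (p i)))"
    proof (intro sum.cong refl arg_cong2[where f="(*)"] prod.cong)
      fix p i assume "p \<in> {p. p permutes {0..<k}}" "i \<in> {0..<k}"
      then have "i < k" "p i < k" using permutes_in_image[of p "{0..<k}" i] by auto
      then show "Matrix.mat k k (\<lambda>(i,j). f x i \<bullet> f x j) $$ (i, p i) = f x i \<bullet> f x (p i)" by simp
    qed
    finally show ?thesis .
  qed
  moreover have "continuous_on S (\<lambda>x. \<Sum>p | p permutes {0..<k}. signof p * (\<Prod>i = 0..<k. f x i \<bullet> f x (p i)))"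
  proof (intro continuous_on_sum continuous_on_mult continuous_on_const continuous_on_prod continuous_on_inner)
    fix p i assume "p \<in> {p. p permutes {0..<k}}" "i \<in> {0..<k}"
    then have "i < k" "p i < k" using permutes_in_image[of p "{0..<k}" i] by auto
    then show "continuous_on S (\<lambda>x. f x i)" "continuous_on S (\<lambda>x. f x (p i))" by (auto intro: assms)
  qed
  ultimately show ?thesis by (simp only:)
qed

lemma compact_box:
  fixes A :: "nat \<Rightarrow> 'a::topological_space set"
  assumes "\<And>i. compact (A i)"
  shows "compact {b. \<forall>i. b i \<in> A i}"
proof -
  have "compactin (product_topology (\<lambda>_. euclidean) UNIV) (PiE UNIV A)"
    unfolding compactin_PiE using assms by simp
  then have "compact (PiE UNIV A)" by (simp add: euclidean_product_topology)
  moreover have "PiE UNIV A = {b. \<forall>i. b i \<in> A i}" by auto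
  ultimately show ?thesis by simp
qed

text \<open>Entries from \<open>k\<close> on are pinned to zero, since free entries would destroy
  compactness in the product topology on functions.\<close>

definition reduced_tuples :: "nat \<Rightarrow> real \<Rightarrow> (nat \<Rightarrow> 'a::euclidean_space) set" where
  "reduced_tuples k R = {b. \<forall>i. b i \<in> (if i < k then cball 0 R else {0})} \<inter>
     ({b. gdet k b = 1} \<inter> {b. good (zspan k b)})"

text \<open>The quantifier over elements of \<open>zspan k b\<close> becomes one over integer arrays
  \<open>C\<close> that do not depend on \<open>b\<close>. Each condition is then the preimage of
  the closed set \<open>{0} \<union> {1..}\<close> under a continuous function of \<open>b\<close>,
  so goodness is a closed condition.\<close>

lemma good_zspan_iff:
  fixes b :: "nat \<Rightarrow> 'a::real_inner"
  shows "good (zspan k b) \<longleftrightarrow> (\<forall>m C. gdet m (\<lambda>i. \<Sum>j<k. of_int (C i j) *\<^sub>R b j) \<in> {0} \<union> {1..})"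
proof
  assume g: "good (zspan k b)"
  show "\<forall>m C. gdet m (\<lambda>i. \<Sum>j<k. of_int (C i j) *\<^sub>R b j) \<in> {0} \<union> {1..}"
  proof (intro allI)
    fix m and C :: "nat \<Rightarrow> nat \<Rightarrow> int"
    have "(\<Sum>j<k. of_int (C i j) *\<^sub>R b j) \<in> zspan k b" for i by (rule zspanI) (rule refl)
    then show "gdet m (\<lambda>i. \<Sum>j<k. of_int (C i j) *\<^sub>R b j) \<in> {0} \<union> {1..}"
      using goodD[OF g, of m "\<lambda>i. \<Sum>j<k. of_int (C i j) *\<^sub>R b j"] by auto
  qed
next
  assume a: "\<forall>m C. gdet m (\<lambda>i. \<Sum>j<k. of_int (C i j) *\<^sub>R b j) \<in> {0} \<union> {1..}"
  show "good (zspan k b)" unfolding good_def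
  proof (intro conjI allI impI agroup_zspan)
    fix m and d :: "nat \<Rightarrow> 'a" assume d: "\<forall>i<m. d i \<in> zspan k b"
    have "\<forall>i. \<exists>c. i < m \<longrightarrow> d i = (\<Sum>j<k. of_int (c j :: int) *\<^sub>R b j)" using d unfolding zspan_def by auto
    from choice[OF this] obtain C where C: "\<forall>i. i < m \<longrightarrow> d i = (\<Sum>j<k. of_int (C i j :: int) *\<^sub>R b j)" by (rule exE)
    have "gdet m d = gdet m (\<lambda>i. \<Sum>j<k. of_int (C i j) *\<^sub>R b j)" by (rule gdet_cong) (use C in auto)
    then show "gdet m d = 0 \<or> gdet m d \<ge> 1" using a[rule_format, of m C] by auto
  qed
qed

lemma compact_reduced_tuples: "compact (reduced_tuples k R :: (nat \<Rightarrow> 'a::euclidean_space) set)"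
  unfolding reduced_tuples_def
proof (rule compact_Int_closed)
  show "compact {b :: nat \<Rightarrow> 'a. \<forall>i. b i \<in> (if i < k then cball 0 R else {0})}"
    by (rule compact_box) simp
  have c: "continuous_on UNIV (\<lambda>b :: nat \<Rightarrow> 'a. gdet m (\<lambda>i. \<Sum>j<k. of_int (C i j) *\<^sub>R b j))" for m and C :: "nat \<Rightarrow> nat \<Rightarrow> int"
    by (intro continuous_on_gdet continuous_on_sum continuous_on_scaleR continuous_on_const continuous_on_coord)
  have "closed {b :: nat \<Rightarrow> 'a. gdet k b = 1}"
  proof -
    have "continuous_on UNIV (\<lambda>b :: nat \<Rightarrow> 'a. gdet k b)" by (intro continuous_on_gdet continuous_on_coord)
    from closed_vimage[OF closed_singleton[of 1] this] have "closed ((\<lambda>b :: nat \<Rightarrow> 'a. gdet k b) -` {1})" .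
    then show ?thesis by (simp add: vimage_def)
  qed
  moreover have "closed {b :: nat \<Rightarrow> 'a. good (zspan k b)}"
  proof -
    have "{b :: nat \<Rightarrow> 'a. good (zspan k b)} = (\<Inter>m. \<Inter>C. (\<lambda>b. gdet m (\<lambda>i. \<Sum>j<k. of_int (C i j) *\<^sub>R b j)) -` ({0} \<union> {1..}))"
      unfolding good_zspan_iff by auto
    moreover have "closed ((\<lambda>b :: nat \<Rightarrow> 'a. gdet m (\<lambda>i. \<Sum>j<k. of_int (C i j) *\<^sub>R b j)) -` ({0} \<union> {1..}))" for m and C :: "nat \<Rightarrow> nat \<Rightarrow> int"
    proof -
      have cl: "closed ({0} \<union> {1..} :: real set)" by (intro closed_Un) auto
      show ?thesis by (rule closed_vimage[OF cl c])
    qed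
    ultimately show ?thesis by (simp only:) (intro closed_INT ballI)
  qed
  ultimately show "closed ({b :: nat \<Rightarrow> 'a. gdet k b = 1} \<inter> {b. good (zspan k b)})" by (rule closed_Int)
qed

text \<open>On the compact product of \<open>K\<close> with the unit sphere of coefficients the norm
  of the combination has a positive minimum, by independence; homogeneity extends the bound.
  Comparing with a fixed tuple \<open>b0\<close> makes the majorant in
  \<open>rho_attains_max\<close> a Gaussian sum over one lattice, already known to converge.\<close>

lemma reduced_tuples_lower_bound:
  fixes K :: "(nat \<Rightarrow> 'a::euclidean_space) set"
  assumes "compact K" "\<And>b. b \<in> K \<Longrightarrow> gdet k b \<noteq> 0" "b0 \<in> K"
  obtains c where "c > 0" "\<And>b u. b \<in> K \<Longrightarrow> (norm (\<Sum>i<k. u i *\<^sub>R b i))\<^sup>2 \<ge> c * (norm (\<Sum>i<k. u i *\<^sub>R b0 i))\<^sup>2"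
proof -
  \<comment> \<open>The unit sphere in the first \<open>k\<close> coefficients. The box is there
    only to exhibit it as a closed part of a compact product.\<close>
  define S where "S = {u :: nat \<Rightarrow> real. \<forall>i. u i \<in> (if i < k then {-1..1} else {0})} \<inter> {u. (\<Sum>i<k. (u i)\<^sup>2) = 1}"
  have "compact S" unfolding S_def
  proof (rule compact_Int_closed)
    show "compact {u :: nat \<Rightarrow> real. \<forall>i. u i \<in> (if i < k then {-1..1} else {0})}" by (rule compact_box) simp
    have "continuous_on UNIV (\<lambda>u :: nat \<Rightarrow> real. \<Sum>i<k. (u i)\<^sup>2)"
      by (intro continuous_on_sum continuous_on_power continuous_on_coord)
    from closed_vimage[OF closed_singleton[of 1] this] have "closed ((\<lambda>u :: nat \<Rightarrow> real. \<Sum>i<k. (u i)\<^sup>2) -` {1})" .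
    then show "closed {u :: nat \<Rightarrow> real. (\<Sum>i<k. (u i)\<^sup>2) = 1}" by (simp add: vimage_def)
  qed
  define B where "B = (\<Sum>i<k. (norm (b0 i))\<^sup>2)"
  have B: "B \<ge> 0" by (simp add: B_def sum_nonneg)
  have up: "(norm (\<Sum>i<k. u i *\<^sub>R b0 i))\<^sup>2 \<le> (\<Sum>i<k. (u i)\<^sup>2) * B" for u
  proof -
    have "norm (\<Sum>i<k. u i *\<^sub>R b0 i) \<le> (\<Sum>i<k. \<bar>u i\<bar> * norm (b0 i))"
      by (rule order_trans[OF norm_sum]) simp
    then have "(norm (\<Sum>i<k. u i *\<^sub>R b0 i))\<^sup>2 \<le> (\<Sum>i<k. \<bar>u i\<bar> * norm (b0 i))\<^sup>2" by (intro power_mono) auto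
    also have "\<dots> \<le> (\<Sum>i<k. \<bar>u i\<bar>\<^sup>2) * (\<Sum>i<k. (norm (b0 i))\<^sup>2)" by (rule Cauchy_Schwarz_ineq_sum)
    finally show ?thesis by (simp add: B_def)
  qed
  show ?thesis
  proof (cases "k = 0")
    case True
    then show ?thesis using that[of 1] by simp
  next
    case False
    let ?f = "\<lambda>(b, u). (norm (\<Sum>i<k. u i *\<^sub>R b i :: 'a))\<^sup>2"
    have cf: "continuous_on (K \<times> S) ?f"
      unfolding case_prod_beta
      by (intro continuous_on_power continuous_on_norm continuous_on_sum continuous_on_scaleR
        continuous_on_compose2[OF continuous_on_coord continuous_on_fst] continuous_on_compose2[OF continuous_on_coord continuous_on_snd] continuous_on_id) auto
    define u0 where "u0 = (\<lambda>i::nat. if i = 0 then 1 else 0 :: real)"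
    have "(\<Sum>i<k. (u0 i)\<^sup>2) = (\<Sum>i<k. if i = 0 then 1 else 0)" by (intro sum.cong) (auto simp: u0_def)
    then have "u0 \<in> S" using False by (auto simp: S_def u0_def)
    then have "K \<times> S \<noteq> {}" using assms(3) by auto
    from continuous_attains_inf[OF compact_Times[OF assms(1) \<open>compact S\<close>] this cf]
    obtain p where p: "p \<in> K \<times> S" "\<forall>q\<in>K \<times> S. ?f p \<le> ?f q" by (rule bexE)
    define \<mu> where "\<mu> = ?f p"
    have mupos: "\<mu> > 0"
    proof -
      obtain b u where bu: "p = (b, u)" "b \<in> K" "u \<in> S" using p(1) by auto
      have "\<mu> \<noteq> 0"
      proof
        assume "\<mu> = 0"
        then have "(\<Sum>i<k. u i *\<^sub>R b i) = 0" by (simp add: \<mu>_def bu(1))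
        then have "u i = 0" if "i < k" for i using that by (rule gdet_nz_coeff[OF assms(2)[OF bu(2)]])
        then have "(\<Sum>i<k. (u i)\<^sup>2) = 0" by simp
        then show False using bu(3) by (simp add: S_def)
      qed
      moreover have "\<mu> \<ge> 0" by (simp add: \<mu>_def case_prod_beta)
      ultimately show ?thesis by simp
    qed
    have low: "(norm (\<Sum>i<k. u i *\<^sub>R b i))\<^sup>2 \<ge> \<mu> * (\<Sum>i<k. (u i)\<^sup>2)" if b: "b \<in> K" for b u
    proof (cases "(\<Sum>i<k. (u i)\<^sup>2) = 0")
      case False
      define N where "N = sqrt (\<Sum>i<k. (u i)\<^sup>2)"
      have N2: "N\<^sup>2 = (\<Sum>i<k. (u i)\<^sup>2)" by (simp add: N_def sum_nonneg)
      then have N: "N > 0" using False by (auto simp: N_def sum_nonneg order_less_le)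
      define v where "v = (\<lambda>i. if i < k then u i / N else 0)"
      have "(\<Sum>i<k. (v i)\<^sup>2) = (\<Sum>i<k. (u i)\<^sup>2 / N\<^sup>2)" by (intro sum.cong) (auto simp: v_def power_divide)
      also have "\<dots> = 1" unfolding sum_divide_distrib[symmetric] N2[symmetric] using N by simp
      finally have v1: "(\<Sum>i<k. (v i)\<^sup>2) = 1" .
      have "v i \<in> (if i < k then {-1..1} else {0})" for i
      proof (cases "i < k")
        case True
        then have "(v i)\<^sup>2 \<le> (\<Sum>i<k. (v i)\<^sup>2)" by (intro member_le_sum) auto
        then have "\<bar>v i\<bar> \<le> 1" unfolding v1 by (simp add: abs_square_le_1)
        then have "- 1 \<le> v i" "v i \<le> 1" by linarith+
        then show ?thesis using True by simp
      qed (simp add: v_def)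
      then have "v \<in> S" using v1 unfolding S_def by blast
      then have bv: "(b, v) \<in> K \<times> S" using b by simp
      have "\<mu> \<le> ?f (b, v)" unfolding \<mu>_def by (rule bspec[OF p(2) bv])
      then have "\<mu> \<le> (norm (\<Sum>i<k. v i *\<^sub>R b i))\<^sup>2" by simp
      also have "(\<Sum>i<k. v i *\<^sub>R b i) = (1 / N) *\<^sub>R (\<Sum>i<k. u i *\<^sub>R b i)"
        unfolding scaleR_sum_right by (intro sum.cong) (auto simp: v_def)
      also have "(norm \<dots>)\<^sup>2 = (norm (\<Sum>i<k. u i *\<^sub>R b i))\<^sup>2 / N\<^sup>2" using N by (simp add: power_divide)
      finally show ?thesis unfolding N2[symmetric] using N by (simp add: field_simps)
    qed simp
    show ?thesis
    proof (rule that[of "\<mu> / (B + 1)"])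
      show "\<mu> / (B + 1) > 0" using mupos B by simp
      fix b u assume b: "b \<in> K"
      have "(norm (\<Sum>i<k. u i *\<^sub>R b0 i))\<^sup>2 \<le> (\<Sum>i<k. (u i)\<^sup>2) * (B + 1)"
        by (rule order_trans[OF up]) (intro mult_left_mono, auto simp: sum_nonneg)
      then have "\<mu> / (B + 1) * (norm (\<Sum>i<k. u i *\<^sub>R b0 i))\<^sup>2 \<le> \<mu> / (B + 1) * ((\<Sum>i<k. (u i)\<^sup>2) * (B + 1))"
        using mupos B by (intro mult_left_mono) auto
      also have "\<dots> = \<mu> * (\<Sum>i<k. (u i)\<^sup>2)" using B by simp
      also have "\<dots> \<le> (norm (\<Sum>i<k. u i *\<^sub>R b i))\<^sup>2" by (rule low[OF b])
      finally show "\<mu> / (B + 1) * (norm (\<Sum>i<k. u i *\<^sub>R b0 i))\<^sup>2 \<le> (norm (\<Sum>i<k. u i *\<^sub>R b i))\<^sup>2" .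
    qed
  qed
qed

lemma zspan_bij:
  fixes b :: "nat \<Rightarrow> 'a::euclidean_space"
  assumes "gdet k b \<noteq> 0"
  shows "bij_betw (\<lambda>c. \<Sum>i<k. of_int (c i) *\<^sub>R b i) (PiE {..<k} (\<lambda>_. UNIV :: int set)) (zspan k b)"
proof (rule bij_betw_imageI)
  show "inj_on (\<lambda>c. \<Sum>i<k. of_int (c i) *\<^sub>R b i) (PiE {..<k} (\<lambda>_. UNIV :: int set))"
  proof (rule inj_onI)
    fix c d assume cd: "c \<in> PiE {..<k} (\<lambda>_. UNIV :: int set)" "d \<in> PiE {..<k} (\<lambda>_. UNIV :: int set)"
      "(\<Sum>i<k. of_int (c i) *\<^sub>R b i) = (\<Sum>i<k. of_int (d i) *\<^sub>R b i)"
    have "c i = d i" if "i < k" for i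
      using gdet_nz_coeff_unique[OF assms cd(3) that] by simp
    then show "c = d" by (intro PiE_ext[OF cd(1,2)]) auto
  qed
  show "(\<lambda>c. \<Sum>i<k. of_int (c i) *\<^sub>R b i) ` (PiE {..<k} (\<lambda>_. UNIV :: int set)) = zspan k b"
  proof (intro subset_antisym subsetI)
    fix x assume "x \<in> zspan k b"
    then obtain c where c: "x = (\<Sum>i<k. of_int (c i) *\<^sub>R b i)" by (rule zspanE)
    have "restrict c {..<k} \<in> PiE {..<k} (\<lambda>_. UNIV :: int set)" by auto
    moreover have "x = (\<Sum>i<k. of_int (restrict c {..<k} i) *\<^sub>R b i)" unfolding c by (intro sum.cong) auto
    ultimately show "x \<in> (\<lambda>c. \<Sum>i<k. of_int (c i) *\<^sub>R b i) ` (PiE {..<k} (\<lambda>_. UNIV :: int set))"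
      by (intro image_eqI[of _ _ "restrict c {..<k}"])
  qed (auto intro: zspanI)
qed

text \<open>Integer coefficient vectors form an index set independent of \<open>b\<close>. Over it
  the series is dominated by the Gaussian sum of \<open>b0\<close> at parameter
  \<open>t * c\<close>, and uniform convergence makes the mass continuous on
  \<open>K\<close>.\<close>

lemma rho_attains_max:
  fixes K :: "(nat \<Rightarrow> 'a::euclidean_space) set"
  assumes "compact K" "\<And>b. b \<in> K \<Longrightarrow> gdet k b \<noteq> 0" "K \<noteq> {}" "t > 0"
  obtains b where "b \<in> K" "\<And>d. d \<in> K \<Longrightarrow> rho t (zspan k d) \<le> rho t (zspan k b)"
proof -
  obtain b0 where b0: "b0 \<in> K" using assms(3) by auto
  obtain c where c: "c > 0" "\<And>b u. b \<in> K \<Longrightarrow> (norm (\<Sum>i<k. u i *\<^sub>R b i))\<^sup>2 \<ge> c * (norm (\<Sum>i<k. u i *\<^sub>R b0 i))\<^sup>2"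
    by (rule reduced_tuples_lower_bound[OF assms(1,2) b0]) auto
  let ?Z = "PiE {..<k} (\<lambda>_. UNIV :: int set)"
  have rho: "rho t (zspan k b) = (\<Sum>\<^sub>\<infinity>z\<in>?Z. exp (- t * (norm (\<Sum>i<k. of_int (z i) *\<^sub>R b i))\<^sup>2))" if "b \<in> K" for b
    unfolding rho_def by (rule infsum_reindex_bij_betw[OF zspan_bij[OF assms(2)[OF that]], symmetric])
  have "zbasis k b0 (zspan k b0)" using assms(2)[OF b0] by (simp add: zbasis_def)
  then have "(\<lambda>x. exp (- (t * c) * (norm x)\<^sup>2)) summable_on zspan k b0"
    using assms(4) c(1) by (intro lattice_summable) auto
  then have s: "(\<lambda>z. exp (- (t * c) * (norm (\<Sum>i<k. of_int (z i) *\<^sub>R b0 i))\<^sup>2)) summable_on ?Z"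
    unfolding summable_on_reindex_bij_betw[OF zspan_bij[OF assms(2)[OF b0]], symmetric, of "\<lambda>x. exp (- (t * c) * (norm x)\<^sup>2)"] .
  have ul: "uniform_limit K (\<lambda>X b. \<Sum>z\<in>X. exp (- t * (norm (\<Sum>i<k. of_int (z i) *\<^sub>R b i))\<^sup>2))
     (\<lambda>b. \<Sum>\<^sub>\<infinity>z\<in>?Z. exp (- t * (norm (\<Sum>i<k. of_int (z i) *\<^sub>R b i))\<^sup>2)) (finite_subsets_at_top ?Z)"
  proof (rule Weierstrass_m_test_general[OF _ s])
    fix z b assume "z \<in> ?Z" "b \<in> K"
    then have "t * (c * (norm (\<Sum>i<k. of_int (z i) *\<^sub>R b0 i))\<^sup>2) \<le> t * (norm (\<Sum>i<k. of_int (z i) *\<^sub>R b i))\<^sup>2"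
      using assms(4) c(2)[of b "\<lambda>i. of_int (z i)"] by (intro mult_left_mono) auto
    then show "norm (exp (- t * (norm (\<Sum>i<k. of_int (z i) *\<^sub>R b i))\<^sup>2)) \<le> exp (- (t * c) * (norm (\<Sum>i<k. of_int (z i) *\<^sub>R b0 i))\<^sup>2)"
      by simp
  qed
  have cs: "continuous_on K (\<lambda>b. \<Sum>z\<in>X. exp (- t * (norm (\<Sum>i<k. of_int (z i) *\<^sub>R b i))\<^sup>2))" for X :: "(nat \<Rightarrow> int) set"
    by (intro continuous_on_sum continuous_on_exp continuous_on_mult continuous_on_const continuous_on_power continuous_on_norm continuous_on_scaleR continuous_on_coord)
  have "continuous_on K (\<lambda>b. \<Sum>\<^sub>\<infinity>z\<in>?Z. exp (- t * (norm (\<Sum>i<k. of_int (z i) *\<^sub>R b i))\<^sup>2))"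
    by (rule uniform_limit_theorem[OF _ ul]) (simp_all only: cs eventually_True finite_subsets_at_top_neq_bot not_False_eq_True)
  then have "continuous_on K (\<lambda>b. rho t (zspan k b))"
    by (rule continuous_on_eq) (simp add: rho)
  from continuous_attains_sup[OF assms(1,3) this] show ?thesis using that by auto
qed

section \<open>Second variation of the Gaussian mass\<close>

text \<open>The Lagrange remainder of degree four is nonnegative for either sign of
  \<open>x\<close>.\<close>

lemma exp_ge_cubic: "exp x \<ge> 1 + x + x\<^sup>2 / 2 + x ^ 3 / 6" for x :: real
proof -
  obtain s where s: "exp x = (\<Sum>m<4. (x ^ m) / fact m) + (exp s / fact 4) * x ^ 4"
    using Maclaurin_exp_le[of x 4] by auto
  have "(\<Sum>m<4. (x ^ m) / fact m) = 1 + x + x\<^sup>2 / 2 + x ^ 3 / 6"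
    by (simp add: eval_nat_numeral fact_numeral)
  moreover have "(exp s / fact 4) * x ^ 4 \<ge> 0" by simp
  ultimately show ?thesis using s by linarith
qed

text \<open>Designed for \<open>p = \<alpha>\<^sup>2 - 1\<close> and
  \<open>q = 1 / \<alpha>\<^sup>2 - 1\<close>, which satisfy the two relations with
  \<open>\<sigma> = (\<alpha> - 1 / \<alpha>)\<^sup>2\<close>; \<open>a\<close> and \<open>b\<close>
  are squared coordinates along two orthonormal vectors. After symmetrizing, the linear and
  quadratic Taylor terms are both of order \<open>\<sigma>\<close> and make up the main term, while
  the cubic ones cost only order \<open>\<sigma>\<^sup>2\<close>.\<close>

lemma exp_second_difference:
  fixes t a b p q \<sigma> r :: real
  assumes t: "t > 0" and ab: "a \<ge> 0" "b \<ge> 0" "a + b \<le> r"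
    and pq: "p + q = \<sigma>" "p * q = - \<sigma>" and s: "0 \<le> \<sigma>" "\<sigma> \<le> 1"
  shows "exp (- t * (p * a + q * b)) + exp (- t * (q * a + p * b)) - 2
    \<ge> \<sigma> * (t\<^sup>2 * (a - b)\<^sup>2 - t * (a + b) - \<sigma> * t ^ 3 * r ^ 3)"
proof -
  define u where "u = p * a + q * b"
  define v where "v = q * a + p * b"
  have uv: "u + v = \<sigma> * (a + b)" unfolding u_def v_def pq(1)[symmetric] by (simp add: algebra_simps)
  have ppqq: "p\<^sup>2 + q\<^sup>2 = \<sigma>\<^sup>2 + 2 * \<sigma>"
  proof -
    have "p\<^sup>2 + q\<^sup>2 = (p + q)\<^sup>2 - 2 * (p * q)" by (simp add: power2_eq_square algebra_simps)
    then show ?thesis unfolding pq by simp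
  qed
  have uuvv: "u\<^sup>2 + v\<^sup>2 = (\<sigma>\<^sup>2 + 2 * \<sigma>) * (a\<^sup>2 + b\<^sup>2) - 4 * \<sigma> * (a * b)"
  proof -
    have "u\<^sup>2 + v\<^sup>2 = (p\<^sup>2 + q\<^sup>2) * (a\<^sup>2 + b\<^sup>2) + 4 * (p * q) * (a * b)"
      unfolding u_def v_def by (simp add: power2_eq_square algebra_simps)
    then show ?thesis unfolding ppqq pq by simp
  qed
  have uvp: "u * v = - \<sigma> * (a\<^sup>2 + b\<^sup>2) + (\<sigma>\<^sup>2 + 2 * \<sigma>) * (a * b)"
  proof -
    have "u * v = (p * q) * (a\<^sup>2 + b\<^sup>2) + (p\<^sup>2 + q\<^sup>2) * (a * b)"
      unfolding u_def v_def by (simp add: power2_eq_square algebra_simps)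
    then show ?thesis unfolding ppqq pq by simp
  qed
  have sq: "u\<^sup>2 + v\<^sup>2 \<ge> 2 * \<sigma> * (a - b)\<^sup>2"
  proof -
    have "u\<^sup>2 + v\<^sup>2 = 2 * \<sigma> * (a - b)\<^sup>2 + \<sigma>\<^sup>2 * (a\<^sup>2 + b\<^sup>2)"
      unfolding uuvv by (simp add: power2_eq_square algebra_simps)
    then show ?thesis by simp
  qed
  \<comment> \<open>Factor the sum of cubes through \<open>u + v\<close>: that factor is of order
    \<open>\<sigma>\<close>, and the quadratic cofactor is bounded above to the same order.\<close>
  have cube: "u ^ 3 + v ^ 3 \<le> 4 * \<sigma>\<^sup>2 * (a + b) ^ 3"
  proof -
    have "u\<^sup>2 + v\<^sup>2 - u * v = (\<sigma>\<^sup>2 + 3 * \<sigma>) * (a + b)\<^sup>2 - (3 * \<sigma>\<^sup>2 + 12 * \<sigma>) * (a * b)"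
      unfolding uuvv uvp by (simp add: power2_eq_square algebra_simps)
    also have "\<dots> \<le> (\<sigma>\<^sup>2 + 3 * \<sigma>) * (a + b)\<^sup>2" using ab s by simp
    also have "\<dots> \<le> (4 * \<sigma>) * (a + b)\<^sup>2"
    proof (rule mult_right_mono)
      have "\<sigma>\<^sup>2 \<le> \<sigma>" using s by (simp add: power2_eq_square mult_left_le)
      then show "\<sigma>\<^sup>2 + 3 * \<sigma> \<le> 4 * \<sigma>" by simp
    qed simp
    finally have "(u + v) * (u\<^sup>2 + v\<^sup>2 - u * v) \<le> (\<sigma> * (a + b)) * ((4 * \<sigma>) * (a + b)\<^sup>2)"
      unfolding uv using ab s by (intro mult_left_mono) auto
    then show ?thesis by (simp add: power2_eq_square power3_eq_cube algebra_simps)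
  qed
  have r3: "(a + b) ^ 3 \<le> r ^ 3" using ab by (intro power_mono) auto
  have "exp (- t * u) \<ge> 1 + (- t * u) + (- t * u)\<^sup>2 / 2 + (- t * u) ^ 3 / 6"
    "exp (- t * v) \<ge> 1 + (- t * v) + (- t * v)\<^sup>2 / 2 + (- t * v) ^ 3 / 6" by (rule exp_ge_cubic)+
  then have "exp (- t * u) + exp (- t * v) - 2 \<ge> - t * (u + v) + t\<^sup>2 / 2 * (u\<^sup>2 + v\<^sup>2) - t ^ 3 / 6 * (u ^ 3 + v ^ 3)"
    by (simp add: power_mult_distrib algebra_simps add_divide_distrib)
  moreover have "t\<^sup>2 / 2 * (u\<^sup>2 + v\<^sup>2) \<ge> t\<^sup>2 / 2 * (2 * \<sigma> * (a - b)\<^sup>2)" by (intro mult_left_mono sq) simp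
  moreover have "t ^ 3 / 6 * (u ^ 3 + v ^ 3) \<le> t ^ 3 / 6 * (4 * \<sigma>\<^sup>2 * (a + b) ^ 3)" using t by (intro mult_left_mono cube) simp
  moreover have "t ^ 3 / 6 * (4 * \<sigma>\<^sup>2 * (a + b) ^ 3) \<le> t ^ 3 * \<sigma>\<^sup>2 * r ^ 3"
  proof -
    have "t ^ 3 / 6 * (4 * \<sigma>\<^sup>2 * (a + b) ^ 3) = 4 / 6 * (t ^ 3 * \<sigma>\<^sup>2 * (a + b) ^ 3)" by simp
    also have "\<dots> \<le> 1 * (t ^ 3 * \<sigma>\<^sup>2 * (a + b) ^ 3)"
      using t ab by (intro mult_right_mono) auto
    also have "\<dots> \<le> t ^ 3 * \<sigma>\<^sup>2 * r ^ 3" using t r3 by (simp add: mult_left_mono)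
    finally show ?thesis .
  qed
  ultimately have "exp (- t * u) + exp (- t * v) - 2 \<ge> - t * (\<sigma> * (a + b)) + t\<^sup>2 / 2 * (2 * \<sigma> * (a - b)\<^sup>2) - t ^ 3 * \<sigma>\<^sup>2 * r ^ 3"
    unfolding uv by linarith
  also have "- t * (\<sigma> * (a + b)) + t\<^sup>2 / 2 * (2 * \<sigma> * (a - b)\<^sup>2) - t ^ 3 * \<sigma>\<^sup>2 * r ^ 3 = \<sigma> * (t\<^sup>2 * (a - b)\<^sup>2 - t * (a + b) - \<sigma> * t ^ 3 * r ^ 3)"
    by (simp add: algebra_simps power2_eq_square)
  finally show ?thesis unfolding u_def v_def .
qed

lemma lattice_cubic_summable:
  fixes b :: "nat \<Rightarrow> 'a::euclidean_space"
  assumes b: "zbasis k b G" and t: "t > 0"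
  shows "(\<lambda>y. (1 + ((norm y)\<^sup>2) ^ 3) * exp (- t * (norm y)\<^sup>2)) summable_on G"
proof (rule summable_on_comparison_test)
  have t2: "t / 2 > 0" using t by simp
  \<comment> \<open>The \<open>6\<close> comes from writing \<open>exp (t * r / 2)\<close> as a cube
    of \<open>exp (t * r / 6)\<close>, which absorbs \<open>r ^ 3\<close>; the other half of the
    exponent is kept for convergence.\<close>
  define C where "C = 1 + (6 / t) ^ 3"
  show "(\<lambda>y. C * exp (- (t / 2) * (norm y)\<^sup>2)) summable_on G"
    by (intro summable_on_cmult_right lattice_summable[OF b t2])
  fix y
  define r where "r = (norm y)\<^sup>2"
  have r: "r \<ge> 0" by (simp add: r_def)
  have "t * r / 6 \<le> exp (t * r / 6)" using exp_ge_add_one_self[of "t * r / 6"] by linarith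
  then have "(t * r / 6) ^ 3 \<le> (exp (t * r / 6)) ^ 3" using t r by (intro power_mono) auto
  also have "\<dots> = exp ((t / 2) * r)" by (simp flip: exp_of_nat_mult)
  finally have "(6 / t) ^ 3 * (t * r / 6) ^ 3 \<le> (6 / t) ^ 3 * exp ((t / 2) * r)" using t by (intro mult_left_mono) auto
  moreover have "(6 / t) ^ 3 * (t * r / 6) ^ 3 = r ^ 3" using t by (simp flip: power_mult_distrib)
  moreover have "1 \<le> exp ((t / 2) * r)" using t r by simp
  ultimately have "1 + r ^ 3 \<le> exp ((t / 2) * r) + (6 / t) ^ 3 * exp ((t / 2) * r)" by linarith
  then have "1 + r ^ 3 \<le> C * exp ((t / 2) * r)" by (simp only: C_def distrib_right mult_1)
  then have "(1 + r ^ 3) * exp (- t * r) \<le> (C * exp ((t / 2) * r)) * exp (- t * r)" by (rule mult_right_mono) simp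
  also have "\<dots> = C * exp (- (t / 2) * r)" by (simp add: mult.assoc flip: exp_add)
  finally show "(1 + ((norm y)\<^sup>2) ^ 3) * exp (- t * (norm y)\<^sup>2) \<le> C * exp (- (t / 2) * (norm y)\<^sup>2)" unfolding r_def .
qed simp

text \<open>For orthonormal \<open>u\<close> and \<open>v\<close> this scales the direction of
  \<open>u\<close> by \<open>\<alpha>\<close> and that of \<open>v\<close> by
  \<open>1 / \<alpha>\<close>, and fixes their orthogonal complement. It preserves volume, and
  \<open>1 / \<alpha>\<close> in place of \<open>\<alpha>\<close> inverts it.\<close>

definition squeeze :: "'a::euclidean_space \<Rightarrow> 'a \<Rightarrow> real \<Rightarrow> 'a \<Rightarrow> 'a" where
  "squeeze u v \<alpha> y = y + ((\<alpha> - 1) * (y \<bullet> u)) *\<^sub>R u + ((1 / \<alpha> - 1) * (y \<bullet> v)) *\<^sub>R v"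

lemma linear_squeeze: "linear (squeeze u v \<alpha>)"
  by (rule linearI) (simp_all add: squeeze_def inner_add_left algebra_simps scaleR_add_left scaleR_add_right)

context
  fixes u v :: "'a::euclidean_space" and \<alpha> :: real
  assumes uv: "u \<bullet> u = 1" "v \<bullet> v = 1" "u \<bullet> v = 0" and al: "\<alpha> > 0"
begin

lemma squeeze_inner: "squeeze u v \<alpha> y \<bullet> u = \<alpha> * (y \<bullet> u)" "squeeze u v \<alpha> y \<bullet> v = (1 / \<alpha>) * (y \<bullet> v)"
  using uv by (simp_all add: squeeze_def inner_add_left inner_commute[of v u] algebra_simps)

lemma norm_squeeze: "(norm (squeeze u v \<alpha> y))\<^sup>2 = (norm y)\<^sup>2 + ((\<alpha>\<^sup>2 - 1) * (y \<bullet> u)\<^sup>2 + (1 / \<alpha>\<^sup>2 - 1) * (y \<bullet> v)\<^sup>2)"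
proof -
  let ?T = "squeeze u v \<alpha> y"
  have "?T \<bullet> ?T = ?T \<bullet> y + (\<alpha> - 1) * (y \<bullet> u) * (?T \<bullet> u) + (1 / \<alpha> - 1) * (y \<bullet> v) * (?T \<bullet> v)"
    by (subst (2) squeeze_def) (simp add: inner_add_right)
  also have "?T \<bullet> y = y \<bullet> y + (\<alpha> - 1) * (y \<bullet> u)\<^sup>2 + (1 / \<alpha> - 1) * (y \<bullet> v)\<^sup>2"
    by (simp add: squeeze_def inner_add_left inner_commute[of u y] inner_commute[of v y] power2_eq_square)
  finally have "?T \<bullet> ?T = y \<bullet> y + ((\<alpha> - 1) * (1 + \<alpha>) * (y \<bullet> u)\<^sup>2 + (1 / \<alpha> - 1) * (1 + 1 / \<alpha>) * (y \<bullet> v)\<^sup>2)"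
    unfolding squeeze_inner by (simp add: power2_eq_square algebra_simps)
  also have "(\<alpha> - 1) * (1 + \<alpha>) = \<alpha>\<^sup>2 - 1" by (simp add: power2_eq_square algebra_simps)
  also have "(1 / \<alpha> - 1) * (1 + 1 / \<alpha>) = 1 / \<alpha>\<^sup>2 - 1" by (simp add: power2_eq_square algebra_simps)
  finally show ?thesis by (simp only: power2_norm_eq_inner)
qed

lemma squeeze_inverse: "squeeze u v (1 / \<alpha>) (squeeze u v \<alpha> y) = y"
proof -
  have "squeeze u v (1 / \<alpha>) (squeeze u v \<alpha> y) = squeeze u v \<alpha> y + ((1 / \<alpha> - 1) * (\<alpha> * (y \<bullet> u))) *\<^sub>R u + ((\<alpha> - 1) * ((1 / \<alpha>) * (y \<bullet> v))) *\<^sub>R v"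
    by (subst squeeze_def) (simp add: squeeze_inner)
  also have "(1 / \<alpha> - 1) * (\<alpha> * (y \<bullet> u)) = - ((\<alpha> - 1) * (y \<bullet> u))" using al by (simp add: field_simps)
  also have "(\<alpha> - 1) * ((1 / \<alpha>) * (y \<bullet> v)) = - ((1 / \<alpha> - 1) * (y \<bullet> v))" using al by (simp add: field_simps)
  finally show ?thesis by (simp add: squeeze_def)
qed

text \<open>\<open>c\<close> lies below the scaling factors \<open>\<alpha>\<close>,
  \<open>1 / \<alpha>\<close> and \<open>1\<close>; for the last this follows from the product of
  the first two.\<close>

lemma squeeze_lower:
  assumes c: "0 \<le> c" "c \<le> \<alpha>" "c \<le> 1 / \<alpha>"
  shows "c * norm y \<le> norm (squeeze u v \<alpha> y)"
proof (rule power2_le_imp_le)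
  have c1: "c\<^sup>2 \<le> 1"
  proof -
    have "c * c \<le> \<alpha> * (1 / \<alpha>)" using c al by (intro mult_mono) auto
    then show ?thesis using al by (simp add: power2_eq_square)
  qed
  have ca: "c\<^sup>2 \<le> \<alpha>\<^sup>2" "c\<^sup>2 \<le> 1 / \<alpha>\<^sup>2"
    using power_mono[OF c(2,1), of 2] power_mono[OF c(3,1), of 2] by (simp_all add: power_divide)
  define z where "z = y - (y \<bullet> u) *\<^sub>R u - (y \<bullet> v) *\<^sub>R v"
  have zu: "z \<bullet> u = 0" "z \<bullet> v = 0" using uv by (simp_all add: z_def inner_diff_left inner_commute[of v u])
  have "y \<bullet> y = (norm z)\<^sup>2 + (y \<bullet> u)\<^sup>2 + (y \<bullet> v)\<^sup>2"
  proof -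
    have "y = z + (y \<bullet> u) *\<^sub>R u + (y \<bullet> v) *\<^sub>R v" by (simp add: z_def)
    then have "y \<bullet> y = y \<bullet> z + (y \<bullet> u) * (y \<bullet> u) + (y \<bullet> v) * (y \<bullet> v)" by (metis inner_add_right inner_scaleR_right)
    moreover have "y \<bullet> z = z \<bullet> z"
    proof -
      have "y \<bullet> z = (z + (y \<bullet> u) *\<^sub>R u + (y \<bullet> v) *\<^sub>R v) \<bullet> z" by (simp add: z_def)
      then show ?thesis using zu by (simp add: inner_add_left inner_commute[of u z] inner_commute[of v z])
    qed
    ultimately show ?thesis unfolding power2_norm_eq_inner by (simp add: power2_eq_square)
  qed
  then have y2: "(norm y)\<^sup>2 = (norm z)\<^sup>2 + (y \<bullet> u)\<^sup>2 + (y \<bullet> v)\<^sup>2" by (simp only: power2_norm_eq_inner)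
  have "(c * norm y)\<^sup>2 = c\<^sup>2 * (norm z)\<^sup>2 + c\<^sup>2 * (y \<bullet> u)\<^sup>2 + c\<^sup>2 * (y \<bullet> v)\<^sup>2"
    unfolding power_mult_distrib y2 by (simp add: algebra_simps)
  also have "\<dots> \<le> 1 * (norm z)\<^sup>2 + \<alpha>\<^sup>2 * (y \<bullet> u)\<^sup>2 + 1 / \<alpha>\<^sup>2 * (y \<bullet> v)\<^sup>2"
    using c1 ca by (intro add_mono mult_right_mono) auto
  also have "\<dots> = (norm (squeeze u v \<alpha> y))\<^sup>2" unfolding norm_squeeze y2 by (simp add: algebra_simps)
  finally show "(c * norm y)\<^sup>2 \<le> (norm (squeeze u v \<alpha> y))\<^sup>2" .
qed simp

end

text \<open>In the basis \<open>e\<close> the map is diagonal with determinant one. The full length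
  \<open>k\<close> matters: shorter tuples may change their covolume and are controlled by
  \<open>gdet_linear_lower\<close>.\<close>

lemma gdet_squeeze:
  fixes e b :: "nat \<Rightarrow> 'a::euclidean_space"
  assumes e: "\<And>i j. i < k \<Longrightarrow> j < k \<Longrightarrow> e i \<bullet> e j = (if i = j then 1 else 0)"
    and ij: "i < k" "j < k" "i \<noteq> j" and al: "\<alpha> > 0"
    and b: "\<And>l. l < k \<Longrightarrow> b l \<in> span (e ` {..<k})"
  shows "gdet k (\<lambda>l. squeeze (e i) (e j) \<alpha> (b l)) = gdet k b"
proof -
  let ?T = "squeeze (e i) (e j) \<alpha>"
  define w where "w l = (if l = i then \<alpha> else if l = j then 1 / \<alpha> else 1)" for l
  have Te: "?T (e l) = w l *\<^sub>R e l" if "l < k" for l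
    using e[OF that ij(1)] e[OF that ij(2)] ij(3) by (auto simp: squeeze_def w_def algebra_simps)
  have "\<forall>l. \<exists>u. l < k \<longrightarrow> b l = (\<Sum>m<k. u m *\<^sub>R e m)" using b unfolding span_range_tuple by (auto simp: image_iff)
  from choice[OF this] obtain U where U: "\<forall>l. l < k \<longrightarrow> b l = (\<Sum>m<k. U l m *\<^sub>R e m)" by (rule exE)
  define A where "A = Matrix.mat k k (\<lambda>(l,m). U l m)"
  have A: "A \<in> carrier_mat k k" by (simp add: A_def)
  have gb: "gdet k b = (Determinant.det A)\<^sup>2 * gdet k e" by (rule gdet_base_change[OF A]) (simp add: A_def U)
  have gTb: "gdet k (\<lambda>l. ?T (b l)) = (Determinant.det A)\<^sup>2 * gdet k (\<lambda>l. ?T (e l))"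
  proof (rule gdet_base_change[OF A])
    fix l assume l: "l < k"
    have "?T (b l) = ?T (\<Sum>m<k. U l m *\<^sub>R e m)" using U l by simp
    also have "\<dots> = (\<Sum>m<k. U l m *\<^sub>R ?T (e m))" by (simp add: linear_sum[OF linear_squeeze] linear_scale[OF linear_squeeze])
    finally show "?T (b l) = (\<Sum>m<k. A $$ (l, m) *\<^sub>R ?T (e m))" using l by (simp add: A_def)
  qed
  define D where "D = Matrix.mat k k (\<lambda>(l,m). if l = m then w l else 0)"
  have D: "D \<in> carrier_mat k k" by (simp add: D_def)
  have "gdet k (\<lambda>l. ?T (e l)) = (Determinant.det D)\<^sup>2 * gdet k e"
  proof (rule gdet_base_change[OF D])
    fix l assume l: "l < k"
    have "(\<Sum>m<k. D $$ (l, m) *\<^sub>R e m) = (\<Sum>m<k. if m = l then w l *\<^sub>R e l else 0)"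
      using l by (intro sum.cong) (auto simp: D_def)
    then show "?T (e l) = (\<Sum>m<k. D $$ (l, m) *\<^sub>R e m)" using l by (simp add: Te)
  qed
  moreover have "Determinant.det D = 1"
  proof -
    have "Determinant.det D = (\<Prod>l = 0..<k. w l)"
      by (subst det_lower_triangular[OF _ D]) (auto simp: D_def prod_list_diag_prod)
    also have "\<dots> = w i * (w j * (\<Prod>l\<in>{0..<k} - {i} - {j}. w l))"
      using ij by (simp add: prod.remove[of "{0..<k}" i] prod.remove[of "{0..<k} - {i}" j])
    also have "(\<Prod>l\<in>{0..<k} - {i} - {j}. w l) = 1" by (rule prod.neutral) (auto simp: w_def)
    finally show ?thesis using ij(3) al by (simp add: w_def)
  qed
  ultimately show ?thesis using gb gTb by simp
qed

lemma squeeze_span: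
  assumes "u \<in> span S" "v \<in> span S" "y \<in> span S"
  shows "squeeze u v \<alpha> y \<in> span S"
  unfolding squeeze_def using assms by (intro span_add span_scale)

lemma summable_on_diff_real:
  fixes f g :: "'a \<Rightarrow> real"
  assumes "f summable_on A" "g summable_on A"
  shows "(\<lambda>x. f x - g x) summable_on A"
proof -
  have "(\<lambda>x. - g x) summable_on A" using assms(2) by (simp add: summable_on_uminus)
  from summable_on_add[OF assms(1) this] show ?thesis by simp
qed

lemma infsum_diff_real:
  fixes f g :: "'a \<Rightarrow> real"
  assumes "f summable_on A" "g summable_on A"
  shows "infsum (\<lambda>x. f x - g x) A = infsum f A - infsum g A"
proof -
  have "(\<lambda>x. - g x) summable_on A" using assms(2) by (simp add: summable_on_uminus)
  from infsum_add[OF assms(1) this] show ?thesis by (simp add: infsum_uminus)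
qed

lemma orthonormal_basis_tuple:
  fixes S :: "'a::euclidean_space set"
  obtains e :: "nat \<Rightarrow> 'a" where "\<And>i j. i < dim S \<Longrightarrow> j < dim S \<Longrightarrow> e i \<bullet> e j = (if i = j then 1 else 0)"
    "span (e ` {..<dim S}) = span S"
proof -
  obtain B where B: "B \<subseteq> span S" "pairwise Linear_Algebra.orthogonal B" "\<And>x. x \<in> B \<Longrightarrow> norm x = 1"
    "independent B" "card B = dim (span S)" "span B = span S"
    by (rule orthonormal_basis_subspace[OF subspace_span[of S]]) auto
  have "finite B" using B(4) by (rule independent_imp_finite)
  then obtain e where e: "bij_betw e {..<card B} B" using ex_bij_betw_nat_finite[of B] by (auto simp: atLeast0LessThan)
  have cB: "card B = dim S" using B(5) by simp
  have eB: "e i \<in> B" if "i < dim S" for i using bij_betwE[OF e] that cB by auto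
  show ?thesis
  proof (rule that[of e])
    fix i j assume ij: "i < dim S" "j < dim S"
    show "e i \<bullet> e j = (if i = j then 1 else 0)"
    proof (cases "i = j")
      case True
      then show ?thesis using B(3)[OF eB[OF ij(1)]] by (simp add: norm_eq_1)
    next
      case False
      have "inj_on e {..<dim S}" using e cB by (simp add: bij_betw_def)
      then have "e i \<noteq> e j" using False ij by (simp add: inj_on_eq_iff)
      then have "Linear_Algebra.orthogonal (e i) (e j)" using B(2) eB[OF ij(1)] eB[OF ij(2)] by (simp add: pairwise_def)
      then show ?thesis using False by (simp add: Linear_Algebra.orthogonal_def)
    qed
  next
    show "span (e ` {..<dim S}) = span S" using e cB B(6) by (simp add: bij_betw_def)
  qed
qed

lemma orthonormal_expand:
  fixes e :: "nat \<Rightarrow> 'a::euclidean_space"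
  assumes e: "\<And>i j. i < k \<Longrightarrow> j < k \<Longrightarrow> e i \<bullet> e j = (if i = j then 1 else 0)"
    and y: "y \<in> span (e ` {..<k})"
  shows "(norm y)\<^sup>2 = (\<Sum>i<k. (y \<bullet> e i)\<^sup>2)"
proof -
  obtain u where u: "y = (\<Sum>i<k. u i *\<^sub>R e i)" using y unfolding span_range_tuple by auto
  have yi: "y \<bullet> e i = u i" if "i < k" for i
  proof -
    have "y \<bullet> e i = (\<Sum>j<k. u j * (if j = i then 1 else 0))"
      unfolding u inner_sum_left using e that by (intro sum.cong) auto
    then show ?thesis using that by (simp add: if_distrib[of "\<lambda>x. _ * x"] cong: if_cong)
  qed
  have "y \<bullet> y = (\<Sum>i<k. u i * (y \<bullet> e i))" by (subst (2) u) (simp add: inner_sum_right)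
  also have "\<dots> = (\<Sum>i<k. (y \<bullet> e i)\<^sup>2)" using yi by (intro sum.cong) (auto simp: power2_eq_square)
  finally show ?thesis by (simp only: power2_norm_eq_inner)
qed

lemma orthonormal_pair_le:
  fixes e :: "nat \<Rightarrow> 'a::euclidean_space"
  assumes e: "\<And>i j. i < k \<Longrightarrow> j < k \<Longrightarrow> e i \<bullet> e j = (if i = j then 1 else 0)"
    and y: "y \<in> span (e ` {..<k})" and ij: "i < k" "j < k" "i \<noteq> j"
  shows "(y \<bullet> e i)\<^sup>2 + (y \<bullet> e j)\<^sup>2 \<le> (norm y)\<^sup>2"
proof -
  have "(\<Sum>l\<in>{i,j}. (y \<bullet> e l)\<^sup>2) \<le> (\<Sum>l<k. (y \<bullet> e l)\<^sup>2)" using ij by (intro sum_mono2) auto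
  moreover have "(norm y)\<^sup>2 = (\<Sum>l<k. (y \<bullet> e l)\<^sup>2)" by (rule orthonormal_expand[OF e y])
  ultimately show ?thesis using ij(3) by simp
qed

text \<open>In each proper rank the least nonzero value is attained by \<open>min_gdet\<close>,
  hence exceeds one, and there are finitely many ranks. The value \<open>2\<close> stands in for a
  rank without independent tuples and keeps the minimum defined when there is no proper
  rank.\<close>

lemma proper_det_gap:
  fixes G :: "'a::euclidean_space set"
  assumes G: "good G" and gap: "\<And>m xs. 1 \<le> m \<Longrightarrow> m < k \<Longrightarrow> \<forall>i<m. xs i \<in> G \<Longrightarrow> gdet m xs \<noteq> 1"
  obtains \<gamma> where "\<gamma> > 1" "\<And>m xs. 1 \<le> m \<Longrightarrow> m < k \<Longrightarrow> \<forall>i<m. xs i \<in> G \<Longrightarrow> gdet m xs \<noteq> 0 \<Longrightarrow> gdet m xs \<ge> \<gamma>"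
proof -
  have "\<exists>\<gamma>. \<gamma> > 1 \<and> (\<forall>xs. (\<forall>i<m. xs i \<in> G) \<and> gdet m xs \<noteq> 0 \<longrightarrow> gdet m xs \<ge> \<gamma>)" if m: "m \<in> {1..<k}" for m
  proof (cases "\<exists>xs. (\<forall>i<m. xs i \<in> G) \<and> gdet m xs \<noteq> 0")
    case True
    then obtain xs where xs: "\<forall>i<m. xs i \<in> G" "gdet m xs \<noteq> 0" by auto
    obtain c where c: "\<forall>i<m. c i \<in> G" "gdet m c \<noteq> 0" "\<forall>d. (\<forall>i<m. d i \<in> G) \<and> gdet m d \<noteq> 0 \<longrightarrow> gdet m c \<le> gdet m d"
      by (rule min_gdet[OF good_agroup[OF G] _ good_norm[OF G], of m xs]) (use xs in auto)
    have "gdet m c \<ge> 1" using goodD[OF G, of m c] c by auto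
    moreover have "gdet m c \<noteq> 1" using gap[of m c] m c by auto
    ultimately have "gdet m c > 1" by simp
    then show ?thesis using c(3) by blast
  next
    case False
    then show ?thesis by (intro exI[of _ 2]) auto
  qed
  then have "\<forall>m\<in>{1..<k}. \<exists>\<gamma>. \<gamma> > 1 \<and> (\<forall>xs. (\<forall>i<m. xs i \<in> G) \<and> gdet m xs \<noteq> 0 \<longrightarrow> gdet m xs \<ge> \<gamma>)" by (rule ballI)
  from bchoice[OF this] obtain g where g: "\<forall>m\<in>{1..<k}. g m > 1 \<and> (\<forall>xs. (\<forall>i<m. xs i \<in> G) \<and> gdet m xs \<noteq> 0 \<longrightarrow> gdet m xs \<ge> g m)" by (rule exE)
  define \<gamma> where "\<gamma> = Min (insert 2 (g ` {1..<k}))"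
  have "\<gamma> \<in> insert 2 (g ` {1..<k})" unfolding \<gamma>_def by (intro Min_in) auto
  then have g1: "\<gamma> > 1" using g by auto
  show ?thesis
  proof (rule that[OF g1])
    fix m and xs :: "nat \<Rightarrow> 'a" assume m: "1 \<le> m" "m < k" and xs: "\<forall>i<m. xs i \<in> G" "gdet m xs \<noteq> 0"
    have "\<gamma> \<le> g m" unfolding \<gamma>_def using m by (intro Min_le) auto
    also have "g m \<le> gdet m xs" using g m xs by auto
    finally show "gdet m xs \<ge> \<gamma>" .
  qed
qed

text \<open>Full rank covolumes do not change. Squared covolumes of lower rank \<open>m\<close>
  shrink by at most the factor \<open>(c\<^sup>2) ^ m\<close>, and the margin
  \<open>\<gamma>\<close> pays for that.\<close>

lemma good_squeeze:
  fixes G :: "'a::euclidean_space set" and e :: "nat \<Rightarrow> 'a"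
  assumes G: "good G"
    and e: "\<And>i j. i < k \<Longrightarrow> j < k \<Longrightarrow> e i \<bullet> e j = (if i = j then 1 else 0)"
    and sp: "span G = span (e ` {..<k})" and ij: "i < k" "j < k" "i \<noteq> j"
    and \<gamma>: "\<And>m xs. 1 \<le> m \<Longrightarrow> m < k \<Longrightarrow> \<forall>i<m. xs i \<in> G \<Longrightarrow> gdet m xs \<noteq> 0 \<Longrightarrow> gdet m xs \<ge> \<gamma>"
    and c: "0 < c" "c \<le> 1" "(c\<^sup>2) ^ k * \<gamma> \<ge> 1" "c \<le> \<alpha>" "c \<le> 1 / \<alpha>" and al: "\<alpha> > 0"
  shows "good (squeeze (e i) (e j) \<alpha> ` G)"
  unfolding good_def
proof (intro conjI allI impI)
  let ?T = "squeeze (e i) (e j) \<alpha>"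
  have uv: "e i \<bullet> e i = 1" "e j \<bullet> e j = 1" "e i \<bullet> e j = 0" using e ij by auto
  show "agroup (?T ` G)" by (rule agroup_linear_image[OF linear_squeeze good_agroup[OF G]])
  fix m and ys :: "nat \<Rightarrow> 'a" assume ys: "\<forall>i<m. ys i \<in> ?T ` G"
  have "\<forall>l. \<exists>x. l < m \<longrightarrow> x \<in> G \<and> ys l = ?T x" using ys by auto
  from choice[OF this] obtain xs where xs: "\<forall>l. l < m \<longrightarrow> xs l \<in> G \<and> ys l = ?T (xs l)" by (rule exE)
  have gy: "gdet m ys = gdet m (\<lambda>l. ?T (xs l))" by (rule gdet_cong) (use xs in auto)
  have xG: "\<forall>l<m. xs l \<in> G" using xs by auto
  have xV: "xs l \<in> span (e ` {..<k})" if "l < m" for l using span_base[of "xs l" G] xG that sp by auto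
  have gek: "gdet k e \<noteq> 0" using gdet_orthonormal[OF e] by simp
  have dk: "dim (e ` {..<k}) = k" using dim_span_tuple[OF gek] by simp
  show "gdet m ys = 0 \<or> gdet m ys \<ge> 1"
  proof (cases "gdet m ys = 0 \<or> m = 0")
    case True
    then show ?thesis by auto
  next
    case False
    have "ys l \<in> span (e ` {..<k})" if "l < m" for l
    proof -
      have "ys l = ?T (xs l)" using xs that by auto
      also have "\<dots> \<in> span (e ` {..<k})" by (rule squeeze_span) (use ij xV[OF that] in \<open>auto intro: span_base\<close>)
      finally show ?thesis .
    qed
    then have mk: "m \<le> k" using gdet_nz_le_dim[of m ys "e ` {..<k}"] False dk by simp
    show ?thesis
    proof (cases "m = k")
      case True
      have "gdet k (\<lambda>l. ?T (xs l)) = gdet k xs"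
        by (rule gdet_squeeze[OF e ij al]) (use xV True in auto)
      then have "gdet m ys = gdet m xs" using gy True by simp
      moreover have "gdet m xs = 0 \<or> gdet m xs \<ge> 1" using goodD[OF G, of m xs] xG by auto
      ultimately show ?thesis by simp
    next
      case mk': False
      \<comment> \<open>Squeezing back by \<open>1 / \<alpha>\<close> shows that a dependent
        \<open>xs\<close> would have a dependent image.\<close>
      have xnz: "gdet m xs \<noteq> 0"
      proof
        assume z: "gdet m xs = 0"
        have ial: "1 / \<alpha> > 0" "0 \<le> c" "c \<le> 1 / (1 / \<alpha>)" using al c by auto
        have "(c\<^sup>2) ^ m * gdet m (\<lambda>l. ?T (xs l)) \<le> gdet m (\<lambda>l. squeeze (e i) (e j) (1 / \<alpha>) (?T (xs l)))"
          by (rule gdet_linear_lower[OF linear_squeeze ial(2)]) (rule squeeze_lower[OF uv ial(1,2) c(5) ial(3)])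
        also have "\<dots> = 0" unfolding squeeze_inverse[OF uv al] by (rule z)
        finally have "(c\<^sup>2) ^ m * gdet m ys \<le> 0" unfolding gy .
        moreover have "gdet m ys > 0" using False gdet_nonneg[of m ys] by simp
        then have "(c\<^sup>2) ^ m * gdet m ys > 0" using c(1) by (intro mult_pos_pos) auto
        ultimately show False by simp
      qed
      have "\<gamma> \<le> gdet m xs" using \<gamma>[of m xs] False mk mk' xG xnz by simp
      then have "(c\<^sup>2) ^ m * \<gamma> \<le> (c\<^sup>2) ^ m * gdet m xs" by (intro mult_left_mono) auto
      also have "\<dots> \<le> gdet m (\<lambda>l. ?T (xs l))"
        by (rule gdet_linear_lower[OF linear_squeeze]) (use c(1) in simp, rule squeeze_lower[OF uv al _ c(4,5)], use c(1) in simp)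
      finally have "(c\<^sup>2) ^ m * \<gamma> \<le> gdet m ys" unfolding gy .
      moreover have "(c\<^sup>2) ^ k * \<gamma> \<le> (c\<^sup>2) ^ m * \<gamma>"
      proof (rule mult_right_mono)
        show "(c\<^sup>2) ^ k \<le> (c\<^sup>2) ^ m" using c(1,2) mk by (intro power_decreasing) (auto simp: power_le_one)
        show "0 \<le> \<gamma>"
        proof (rule ccontr)
          assume "\<not> 0 \<le> \<gamma>"
          then have "(c\<^sup>2) ^ k * \<gamma> \<le> 0" by (intro mult_nonneg_nonpos) auto
          then show False using c(3) by simp
        qed
      qed
      ultimately show ?thesis using c(3) by simp
    qed
  qed
qed

text \<open>If no proper sublattice has determinant one, then the proper determinants stay away from one and
  the \<open>squeeze\<close>d lattices with \<open>\<alpha>\<close> near one are still good. Adding the inequalities \<open>max\<close> for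
  \<open>\<alpha>\<close> and \<open>1 / \<alpha>\<close> cancels the first variation and leaves the second one.\<close>

lemma second_variation:
  fixes G :: "'a::euclidean_space set" and e :: "nat \<Rightarrow> 'a"
  assumes t: "t > 0" and G: "good G" and b: "zbasis k b G" and det1: "gdet k b = 1"
    and max: "\<And>d :: nat \<Rightarrow> 'a. good (zspan k d) \<Longrightarrow> gdet k d = 1 \<Longrightarrow> rho t (zspan k d) \<le> rho t G"
    and gap: "\<And>m xs. 1 \<le> m \<Longrightarrow> m < k \<Longrightarrow> \<forall>i<m. xs i \<in> G \<Longrightarrow> gdet m xs \<noteq> 1"
    and e: "\<And>i j. i < k \<Longrightarrow> j < k \<Longrightarrow> e i \<bullet> e j = (if i = j then 1 else 0)"
    and sp: "span G = span (e ` {..<k})" and ij: "i < k" "j < k" "i \<noteq> j"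
  shows "(\<lambda>y. exp (- t * (norm y)\<^sup>2) * (t\<^sup>2 * ((y \<bullet> e i)\<^sup>2 - (y \<bullet> e j)\<^sup>2)\<^sup>2 - t * ((y \<bullet> e i)\<^sup>2 + (y \<bullet> e j)\<^sup>2))) summable_on G" (is "?f summable_on G")
    and "(\<Sum>\<^sub>\<infinity>y\<in>G. exp (- t * (norm y)\<^sup>2) * (t\<^sup>2 * ((y \<bullet> e i)\<^sup>2 - (y \<bullet> e j)\<^sup>2)\<^sup>2 - t * ((y \<bullet> e i)\<^sup>2 + (y \<bullet> e j)\<^sup>2))) \<le> 0"
proof -
  let ?g = "\<lambda>y. exp (- t * (norm y)\<^sup>2) * ((norm y)\<^sup>2) ^ 3"
  have uv: "e i \<bullet> e i = 1" "e j \<bullet> e j = 1" "e i \<bullet> e j = 0" using e ij by auto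
  have cs: "(\<lambda>y. (1 + ((norm y)\<^sup>2) ^ 3) * exp (- t * (norm y)\<^sup>2)) summable_on G" by (rule lattice_cubic_summable[OF b t])
  have yV: "y \<in> span (e ` {..<k})" if "y \<in> G" for y using span_base[OF that] sp by simp
  have pair: "(y \<bullet> e i)\<^sup>2 + (y \<bullet> e j)\<^sup>2 \<le> (norm y)\<^sup>2" if "y \<in> G" for y
    by (rule orthonormal_pair_le[OF e yV[OF that] ij])
  have gsum: "?g summable_on G"
    by (rule summable_on_comparison_test[OF cs]) (simp_all add: algebra_simps)
  show fsum: "?f summable_on G"
  proof (rule abs_summable_summable, rule summable_on_comparison_test)
    show "(\<lambda>y. (t\<^sup>2 + t) * ((1 + ((norm y)\<^sup>2) ^ 3) * exp (- t * (norm y)\<^sup>2))) summable_on G"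
      by (intro summable_on_cmult_right cs)
    fix y assume y: "y \<in> G"
    define r where "r = (norm y)\<^sup>2"
    define A where "A = (y \<bullet> e i)\<^sup>2"
    define B where "B = (y \<bullet> e j)\<^sup>2"
    have AB: "A \<ge> 0" "B \<ge> 0" "A + B \<le> r" using pair[OF y] by (simp_all add: A_def B_def r_def)
    \<comment> \<open>\<open>1 + r ^ 3\<close> dominates both \<open>r\<close> and
      \<open>r\<^sup>2\<close>, so the cubic majorant used for the error term \<open>?g\<close>
      covers \<open>?f\<close> as well.\<close>
    have r1: "r \<le> 1 + r ^ 3 \<and> r\<^sup>2 \<le> 1 + r ^ 3"
    proof (cases "r \<le> 1")
      case True
      then have "r\<^sup>2 \<le> 1" "0 \<le> r ^ 3" using AB by (auto simp: power_le_one)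
      then show ?thesis using True by linarith
    next
      case False
      then have "r ^ 1 \<le> r ^ 3" "r ^ 2 \<le> r ^ 3" by (intro power_increasing; simp)+
      then show ?thesis by (simp add: add_increasing)
    qed
    have "\<bar>A - B\<bar> \<le> r" using AB by linarith
    then have "(A - B)\<^sup>2 \<le> r\<^sup>2" using power_mono[of "\<bar>A - B\<bar>" r 2] by simp
    then have "t\<^sup>2 * (A - B)\<^sup>2 \<le> t\<^sup>2 * (1 + r ^ 3)" using r1 by (intro mult_left_mono) auto
    moreover have "t * (A + B) \<le> t * (1 + r ^ 3)" using r1 AB t by (intro mult_left_mono) auto
    moreover have "t\<^sup>2 * (A - B)\<^sup>2 \<ge> 0" "t * (A + B) \<ge> 0" using AB t by auto
    moreover have "t\<^sup>2 * (1 + r ^ 3) \<ge> 0" "t * (1 + r ^ 3) \<ge> 0" using AB t by auto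
    ultimately have "\<bar>t\<^sup>2 * (A - B)\<^sup>2 - t * (A + B)\<bar> \<le> t\<^sup>2 * (1 + r ^ 3) + t * (1 + r ^ 3)" by linarith
    then have "\<bar>t\<^sup>2 * (A - B)\<^sup>2 - t * (A + B)\<bar> \<le> (t\<^sup>2 + t) * (1 + r ^ 3)" by (simp only: distrib_right)
    then have "exp (- t * r) * \<bar>t\<^sup>2 * (A - B)\<^sup>2 - t * (A + B)\<bar> \<le> exp (- t * r) * ((t\<^sup>2 + t) * (1 + r ^ 3))"
      by (intro mult_left_mono) auto
    then show "norm (?f y) \<le> (t\<^sup>2 + t) * ((1 + ((norm y)\<^sup>2) ^ 3) * exp (- t * (norm y)\<^sup>2))"
      unfolding A_def B_def r_def by (simp add: abs_mult mult_ac)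
  qed simp
  obtain \<gamma> where \<gamma>: "\<gamma> > 1" "\<And>m xs. 1 \<le> m \<Longrightarrow> m < k \<Longrightarrow> \<forall>i<m. xs i \<in> G \<Longrightarrow> gdet m xs \<noteq> 0 \<Longrightarrow> gdet m xs \<ge> \<gamma>"
    by (rule proper_det_gap[OF G gap]) auto
  have k0: "k > 0" using ij by simp
  \<comment> \<open>The second condition on \<open>\<alpha>\<close> says that
    \<open>c = 1 / \<alpha>\<close> meets the margin requirement of \<open>good_squeeze\<close>; the
    third is the requirement \<open>\<sigma> \<le> 1\<close> of
    \<open>exp_second_difference\<close>.\<close>
  have key: "(\<Sum>\<^sub>\<infinity>y\<in>G. ?f y) \<le> (\<alpha>\<^sup>2 + 1 / \<alpha>\<^sup>2 - 2) * (t ^ 3 * (\<Sum>\<^sub>\<infinity>y\<in>G. ?g y))"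
    if al: "\<alpha> > 1" "\<alpha> \<le> root (2 * k) \<gamma>" "\<alpha>\<^sup>2 + 1 / \<alpha>\<^sup>2 - 2 \<le> 1" for \<alpha>
  proof -
    define \<sigma> where "\<sigma> = \<alpha>\<^sup>2 + 1 / \<alpha>\<^sup>2 - 2"
    have a0: "\<alpha> > 0" "1 / \<alpha> > 0" using al by auto
    have sig: "\<sigma> = (\<alpha> - 1 / \<alpha>)\<^sup>2" using a0 by (simp add: \<sigma>_def power2_eq_square field_simps)
    have "\<alpha> - 1 / \<alpha> \<noteq> 0"
    proof -
      have "1 / \<alpha> < 1" using al by simp
      then show ?thesis using al by linarith
    qed
    then have spos: "\<sigma> > 0" unfolding sig by simp
    have c: "0 < 1 / \<alpha>" "1 / \<alpha> \<le> 1" "((1 / \<alpha>)\<^sup>2) ^ k * \<gamma> \<ge> 1" "1 / \<alpha> \<le> \<alpha>" "1 / \<alpha> \<le> 1 / \<alpha>" "1 / \<alpha> \<le> 1 / (1 / \<alpha>)"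
    proof -
      have "1 / \<alpha> < 1" using al by simp
      then have "1 / \<alpha> \<le> 1" "1 / \<alpha> \<le> \<alpha>" using al(1) by linarith+
      then show "0 < 1 / \<alpha>" "1 / \<alpha> \<le> 1" "1 / \<alpha> \<le> \<alpha>" "1 / \<alpha> \<le> 1 / \<alpha>" "1 / \<alpha> \<le> 1 / (1 / \<alpha>)" using a0 by simp_all
      have "\<alpha> ^ (2 * k) \<le> root (2 * k) \<gamma> ^ (2 * k)" using al by (intro power_mono) auto
      also have "\<dots> = \<gamma>" using k0 \<gamma>(1) by (intro real_root_pow_pos2) auto
      finally show "((1 / \<alpha>)\<^sup>2) ^ k * \<gamma> \<ge> 1" using a0 by (simp add: power_divide field_simps flip: power_mult)
    qed
    let ?T = "squeeze (e i) (e j) \<alpha>" and ?T' = "squeeze (e i) (e j) (1 / \<alpha>)"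
    have img: "rho t (squeeze (e i) (e j) \<beta> ` G) \<le> rho t G" "(\<lambda>y. exp (- t * (norm (squeeze (e i) (e j) \<beta> y))\<^sup>2)) summable_on G"
      "rho t (squeeze (e i) (e j) \<beta> ` G) = (\<Sum>\<^sub>\<infinity>y\<in>G. exp (- t * (norm (squeeze (e i) (e j) \<beta> y))\<^sup>2))"
      if \<beta>: "\<beta> = \<alpha> \<or> \<beta> = 1 / \<alpha>" for \<beta>
    proof -
      let ?S = "squeeze (e i) (e j) \<beta>"
      have b0: "\<beta> > 0" using \<beta> a0 by metis
      have gS: "good (?S ` G)"
        by (rule good_squeeze[OF G e sp ij \<gamma>(2) c(1,2,3)]) (use \<beta> c b0 in auto)
      have zS: "?S ` G = zspan k (\<lambda>l. ?S (b l))"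
        using b zspan_image[OF linear_squeeze, of "e i" "e j" \<beta> k b] by (simp add: zbasis_def)
      have bV: "b l \<in> span (e ` {..<k})" if "l < k" for l
        using yV b zspan_base[OF that, of b] by (simp add: zbasis_def)
      have dS: "gdet k (\<lambda>l. ?S (b l)) = 1" using gdet_squeeze[OF e ij b0 bV] det1 by simp
      show "rho t (?S ` G) \<le> rho t G" unfolding zS by (rule max[OF _ dS]) (use gS zS in simp)
      have zb: "zbasis k (\<lambda>l. ?S (b l)) (?S ` G)" using zS dS by (simp add: zbasis_def)
      have inj: "inj_on ?S G" by (rule inj_on_inverseI) (rule squeeze_inverse[OF uv b0])
      show "rho t (?S ` G) = (\<Sum>\<^sub>\<infinity>y\<in>G. exp (- t * (norm (?S y))\<^sup>2))"
        unfolding rho_def infsum_reindex[OF inj] by (simp add: o_def)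
      show "(\<lambda>y. exp (- t * (norm (?S y))\<^sup>2)) summable_on G"
        using lattice_summable[OF zb t] unfolding summable_on_reindex[OF inj] by (simp add: o_def)
    qed
    note i1 = img[of \<alpha>, simplified] and i2 = img[of "1 / \<alpha>", simplified]
    have sG: "(\<lambda>y. exp (- t * (norm y)\<^sup>2)) summable_on G" by (rule lattice_summable[OF b t])
    have s1: "(\<lambda>y. exp (- t * (norm (?T y))\<^sup>2)) summable_on G" and s2: "(\<lambda>y. exp (- t * (norm (?T' y))\<^sup>2)) summable_on G"
      by (rule img(2); simp)+
    have le1: "(\<Sum>\<^sub>\<infinity>y\<in>G. exp (- t * (norm (?T y))\<^sup>2)) \<le> rho t G" using img(1,3)[of \<alpha>] by simp
    have le2: "(\<Sum>\<^sub>\<infinity>y\<in>G. exp (- t * (norm (?T' y))\<^sup>2)) \<le> rho t G" using img(1,3)[of "1 / \<alpha>"] by simp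
    have pt: "\<sigma> * (?f y - \<sigma> * t ^ 3 * ?g y) \<le> (exp (- t * (norm (?T y))\<^sup>2) + exp (- t * (norm (?T' y))\<^sup>2)) - 2 * exp (- t * (norm y)\<^sup>2)"
      if y: "y \<in> G" for y
    proof -
      define r where "r = (norm y)\<^sup>2"
      define A where "A = (y \<bullet> e i)\<^sup>2"
      define B where "B = (y \<bullet> e j)\<^sup>2"
      define p where "p = \<alpha>\<^sup>2 - 1"
      define q where "q = 1 / \<alpha>\<^sup>2 - 1"
      have AB: "A \<ge> 0" "B \<ge> 0" "A + B \<le> r" using pair[OF y] by (simp_all add: A_def B_def r_def)
      have pq: "p + q = \<sigma>" "p * q = - \<sigma>" using a0 by (simp_all add: p_def q_def \<sigma>_def field_simps)
      have "\<sigma> * (t\<^sup>2 * (A - B)\<^sup>2 - t * (A + B) - \<sigma> * t ^ 3 * r ^ 3) \<le> exp (- t * (p * A + q * B)) + exp (- t * (q * A + p * B)) - 2"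
        using exp_second_difference[OF t AB pq] spos al(3) by (simp add: \<sigma>_def)
      then have "exp (- t * r) * (\<sigma> * (t\<^sup>2 * (A - B)\<^sup>2 - t * (A + B) - \<sigma> * t ^ 3 * r ^ 3)) \<le> exp (- t * r) * (exp (- t * (p * A + q * B)) + exp (- t * (q * A + p * B)) - 2)"
        by (rule mult_left_mono) simp
      also have "\<dots> = (exp (- t * (r + (p * A + q * B))) + exp (- t * (r + (q * A + p * B)))) - 2 * exp (- t * r)"
      proof -
        have ex: "exp (- t * (r + X)) = exp (- t * r) * exp (- t * X)" for X by (simp add: distrib_left exp_add exp_diff exp_minus field_simps)
        have gen: "E * (F1 + F2 - 2) = (E * F1 + E * F2) - 2 * E" for E F1 F2 :: real by (simp add: algebra_simps)
        show ?thesis unfolding ex by (rule gen)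
      qed
      also have "r + (p * A + q * B) = (norm (?T y))\<^sup>2"
        unfolding norm_squeeze[OF uv a0(1)] by (simp add: r_def p_def q_def A_def B_def)
      also have "r + (q * A + p * B) = (norm (?T' y))\<^sup>2"
        unfolding norm_squeeze[OF uv a0(2)] by (simp add: r_def p_def q_def A_def B_def power_divide)
      finally show ?thesis unfolding r_def A_def B_def by (simp add: algebra_simps)
    qed
    have "\<sigma> * ((\<Sum>\<^sub>\<infinity>y\<in>G. ?f y) - \<sigma> * t ^ 3 * (\<Sum>\<^sub>\<infinity>y\<in>G. ?g y)) = (\<Sum>\<^sub>\<infinity>y\<in>G. \<sigma> * (?f y - \<sigma> * t ^ 3 * ?g y))"
      unfolding infsum_cmult_right' infsum_diff_real[OF fsum summable_on_cmult_right[OF gsum]] ..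
    also have "\<dots> \<le> (\<Sum>\<^sub>\<infinity>y\<in>G. (exp (- t * (norm (?T y))\<^sup>2) + exp (- t * (norm (?T' y))\<^sup>2)) - 2 * exp (- t * (norm y)\<^sup>2))"
    proof (rule infsum_mono)
      show "(\<lambda>y. \<sigma> * (?f y - \<sigma> * t ^ 3 * ?g y)) summable_on G"
        by (intro summable_on_cmult_right summable_on_diff_real fsum gsum)
      show "(\<lambda>y. (exp (- t * (norm (?T y))\<^sup>2) + exp (- t * (norm (?T' y))\<^sup>2)) - 2 * exp (- t * (norm y)\<^sup>2)) summable_on G"
        by (intro summable_on_add summable_on_diff_real summable_on_cmult_right s1 s2 sG)
    qed (rule pt)
    also have "\<dots> = ((\<Sum>\<^sub>\<infinity>y\<in>G. exp (- t * (norm (?T y))\<^sup>2)) + (\<Sum>\<^sub>\<infinity>y\<in>G. exp (- t * (norm (?T' y))\<^sup>2))) - 2 * rho t G"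
      unfolding rho_def infsum_cmult_right'[symmetric]
      by (subst infsum_diff_real[OF summable_on_add[OF s1 s2] summable_on_cmult_right[OF sG]], subst infsum_add[OF s1 s2]) (rule refl)
    also have "\<dots> \<le> 0" using le1 le2 by simp
    finally have "(\<Sum>\<^sub>\<infinity>y\<in>G. ?f y) - \<sigma> * t ^ 3 * (\<Sum>\<^sub>\<infinity>y\<in>G. ?g y) \<le> 0" using spos by (simp add: mult_le_0_iff)
    then show ?thesis unfolding \<sigma>_def by (simp add: mult_ac)
  qed
  show "(\<Sum>\<^sub>\<infinity>y\<in>G. ?f y) \<le> 0"
  \<comment> \<open>The left side of \<open>key\<close> does not involve \<open>\<alpha>\<close>,
    and the error on the right tends to zero as \<open>\<alpha>\<close> decreases to one.\<close>
  proof (rule tendsto_lowerbound)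
    have "isCont (\<lambda>\<alpha>::real. (\<alpha>\<^sup>2 + 1 / \<alpha>\<^sup>2 - 2) * (t ^ 3 * (\<Sum>\<^sub>\<infinity>y\<in>G. ?g y))) 1" by (intro continuous_intros) auto
    then have "((\<lambda>\<alpha>::real. (\<alpha>\<^sup>2 + 1 / \<alpha>\<^sup>2 - 2) * (t ^ 3 * (\<Sum>\<^sub>\<infinity>y\<in>G. ?g y))) \<longlongrightarrow> 0) (at 1)" by (simp add: isCont_def)
    then show "((\<lambda>\<alpha>::real. (\<alpha>\<^sup>2 + 1 / \<alpha>\<^sup>2 - 2) * (t ^ 3 * (\<Sum>\<^sub>\<infinity>y\<in>G. ?g y))) \<longlongrightarrow> 0) (at_right 1)"
      by (rule filterlim_mono) (auto simp: at_within_le_at)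
    have "isCont (\<lambda>\<alpha>::real. \<alpha>\<^sup>2 + 1 / \<alpha>\<^sup>2 - 2) 1" by (intro continuous_intros) auto
    then have "((\<lambda>\<alpha>::real. \<alpha>\<^sup>2 + 1 / \<alpha>\<^sup>2 - 2) \<longlongrightarrow> 0) (at 1)" by (simp add: isCont_def)
    then have "((\<lambda>\<alpha>::real. \<alpha>\<^sup>2 + 1 / \<alpha>\<^sup>2 - 2) \<longlongrightarrow> 0) (at_right 1)"
      by (rule filterlim_mono) (auto simp: at_within_le_at)
    then have ev1: "\<forall>\<^sub>F \<alpha>::real in at_right 1. \<alpha>\<^sup>2 + 1 / \<alpha>\<^sup>2 - 2 < 1" by (rule order_tendstoD(2)) simp
    have "root (2 * k) \<gamma> > 1" using \<gamma>(1) k0 by simp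
    then have ev2: "\<forall>\<^sub>F \<alpha> in at_right 1. \<alpha> \<in> {1<..<root (2 * k) \<gamma>}" by (rule eventually_at_right_real)
    from ev1 ev2 show "\<forall>\<^sub>F \<alpha> in at_right 1. (\<Sum>\<^sub>\<infinity>y\<in>G. ?f y) \<le> (\<alpha>\<^sup>2 + 1 / \<alpha>\<^sup>2 - 2) * (t ^ 3 * (\<Sum>\<^sub>\<infinity>y\<in>G. ?g y))"
      by eventually_elim (rule key; simp)
  qed simp
qed

section \<open>The bound on the Gaussian mass\<close>

text \<open>\<open>xs\<close> is not given as a basis of the intersection of \<open>G\<close> with
  its span. But a basis of that intersection has squared covolume at least one and at most that of
  \<open>xs\<close>, so again exactly one. Then the projection is good, and the induction hypothesis
  applies to both factors of \<open>rho_split\<close>.\<close>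

lemma split_bound:
  fixes G :: "'a::euclidean_space set"
  assumes t: "t > 0" and G: "good G" and b: "zbasis k b G" and m: "1 \<le> m" "m < k"
    and xs: "\<forall>i<m. xs i \<in> G" "gdet m xs = 1"
    and IH: "\<And>j H (d :: nat \<Rightarrow> 'a). j < k \<Longrightarrow> zbasis j d H \<Longrightarrow> good H \<Longrightarrow> rho t H \<le> theta t ^ j"
  shows "rho t G \<le> theta t ^ k"
proof -
  have ag: "agroup G" by (rule good_agroup[OF G])
  let ?V = "span (xs ` {..<m})"
  have g1: "good (G \<inter> ?V)" by (rule good_subset[OF G agroup_Int[OF ag agroup_span]]) simp
  then obtain m1 b1 where b1: "zbasis m1 b1 (G \<inter> ?V)" by (rule good_has_basis)
  have "span (G \<inter> ?V) \<subseteq> span ?V" by (rule span_mono) simp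
  then have "span (G \<inter> ?V) \<subseteq> ?V" by (simp only: span_span)
  moreover have "?V \<subseteq> span (G \<inter> ?V)" by (rule span_mono) (use xs in \<open>auto intro: span_base\<close>)
  ultimately have sV: "span (G \<inter> ?V) = ?V" by (rule subset_antisym)
  have "dim ?V = m" by (rule dim_span_tuple) (simp add: xs)
  then have "m1 = m" using dim_zbasis[OF b1] dim_span[of "G \<inter> ?V"] sV by simp
  note b1 = b1[unfolded \<open>m1 = m\<close>]
  have sb: "span (b1 ` {..<m}) = ?V" using span_zbasis[OF b1] sV by simp
  have b1': "zbasis m b1 (G \<inter> span (b1 ` {..<m}))" using b1 sb by simp
  have b1G: "b1 i \<in> G" if "i < m" for i using b1 zspan_base[OF that, of b1] by (auto simp: zbasis_def)
  have zb1: "zspan m b1 = G \<inter> ?V" using b1 by (simp add: zbasis_def)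
  have "gdet m xs \<ge> gdet m b1"
  proof (rule gdet_int_ge)
    show "xs i \<in> zspan m b1" if "i < m" for i
      unfolding zb1 using xs that by (auto intro: span_base)
  qed (simp add: xs)
  moreover have "gdet m b1 \<ge> 1" using goodD[OF G, of m b1] b1G b1 by (simp add: zbasis_def)
  ultimately have d1: "gdet m b1 = 1" using xs by simp
  let ?p = "perp (b1 ` {..<m})"
  have g2: "good (?p ` G)" by (rule good_quotient[OF G b1G d1])
  then obtain q d where d: "zbasis q d (?p ` G)" by (rule good_has_basis)
  obtain e where "zbasis (m + q) e G" using zbasis_extend[OF ag b1' d] by (rule exE)
  then have mq: "m + q = k" using zbasis_rank_unique b by metis
  have "rho t G \<le> rho t (G \<inter> span (b1 ` {..<m})) * rho t (?p ` G)" by (rule rho_split[OF t ag b1' d])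
  also have "\<dots> \<le> theta t ^ m * theta t ^ q"
  proof (rule mult_mono)
    show "rho t (G \<inter> span (b1 ` {..<m})) \<le> theta t ^ m" unfolding sb by (rule IH[OF m(2) b1 g1])
    show "rho t (?p ` G) \<le> theta t ^ q" by (rule IH[OF _ d g2]) (use mq m in simp)
    show "0 \<le> theta t ^ m" using theta_ge_1[OF t] by simp
    show "0 \<le> rho t (?p ` G)" unfolding rho_def by (rule infsum_nonneg) simp
  qed
  also have "\<dots> = theta t ^ k" using mq by (simp add: power_add[symmetric])
  finally show ?thesis .
qed

text \<open>The skeleton common to both ranges of \<open>t\<close>: contraction and splitting leave
  only lattices of determinant one to \<open>step\<close>. \<open>N\<close> bounds all ranks that
  occur, so a condition on \<open>t\<close> in terms of \<open>N\<close> suffices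
  throughout.\<close>

lemma mass_bound_induct:
  fixes G :: "'a::euclidean_space set"
  assumes t: "t > 0"
    and step: "\<And>k G (b :: nat \<Rightarrow> 'a). 1 \<le> k \<Longrightarrow> k \<le> N \<Longrightarrow> zbasis k b G \<Longrightarrow> good G \<Longrightarrow> gdet k b = 1 \<Longrightarrow>
      (\<And>j H (d :: nat \<Rightarrow> 'a). j < k \<Longrightarrow> zbasis j d H \<Longrightarrow> good H \<Longrightarrow> rho t H \<le> theta t ^ j) \<Longrightarrow> rho t G \<le> theta t ^ k"
    and k: "k \<le> N" "zbasis k b G" "good G"
  shows "rho t G \<le> theta t ^ k"
  using k
proof (induction k arbitrary: G b rule: less_induct)
  case (less k)
  have IH: "rho t H \<le> theta t ^ j" if "j < k" "zbasis j d H" "good H" for j H and d :: "nat \<Rightarrow> 'a"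
    using less.IH[of j d H] that less.prems(1) by simp
  show ?case
  proof (cases "k = 0")
    case True
    then have "G = {0}" using less.prems(2) by (auto simp: zbasis_def zspan_def)
    then show ?thesis using True by (simp add: rho_zero)
  next
    case False
    then have k1: "1 \<le> k" by simp
    obtain c m xs where c: "c \<ge> 1" "good ((\<lambda>x. x /\<^sub>R c) ` G)" "1 \<le> m" "m \<le> k"
      "\<forall>i<m. xs i \<in> (\<lambda>x. x /\<^sub>R c) ` G" "gdet m xs = 1"
      by (rule good_contraction[OF less.prems(3,2) k1])
    let ?f = "\<lambda>x :: 'a. x /\<^sub>R c"
    let ?G = "?f ` G"
    have lf: "linear ?f" by (rule linear_compose_scale_right[OF linear_id, unfolded id_def])
    have gb: "gdet k b \<noteq> 0" "G = zspan k b" using less.prems(2) by (auto simp: zbasis_def)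
    have "gdet k (\<lambda>i. ?f (b i)) \<noteq> 0" using gb c(1) unfolding gdet_scale by simp
    then have zb: "zbasis k (\<lambda>i. ?f (b i)) ?G" using zspan_image[OF lf, of k b] gb by (simp add: zbasis_def)
    have "rho t ?G \<le> theta t ^ k"
    proof (cases "m < k")
      case True
      show ?thesis by (rule split_bound[OF t c(2) zb c(3) True c(5,6) IH])
    next
      case False
      then have mk: "m = k" using c(4) by simp
      \<comment> \<open>A tuple of full length and determinant one forces the basis to have
        determinant one as well.\<close>
      have "gdet k xs \<ge> gdet k (\<lambda>i. ?f (b i))"
        by (rule gdet_int_ge) (use c(5,6) mk zb in \<open>auto simp: zbasis_def\<close>)
      moreover have "gdet k (\<lambda>i. ?f (b i)) \<ge> 1"
        using goodD[OF c(2), of k "\<lambda>i. ?f (b i)"] zb zspan_base[of _ k "\<lambda>i. ?f (b i)"] by (simp add: zbasis_def)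
      ultimately have "gdet k (\<lambda>i. ?f (b i)) = 1" using c(6) mk by simp
      then show ?thesis by (rule step[OF k1 less.prems(1) zb c(2) _ IH])
    qed
    then show ?thesis using rho_scale_mono[OF t less.prems(2) c(1)] by linarith
  qed
qed

text \<open>For \<open>s i\<close> the squared coordinates of a vector, the two fractions are the
  weighted second variations along the rotated and the original pairs. Relative to
  \<open>1 / 2\<close>, the weight \<open>1 / k\<close> is the one that cancels the sum
  \<open>S\<close> of the squares of the \<open>s i\<close>; the result then depends on the squared
  norm alone, and \<open>(k + 2) / 2\<close> comes out as its threshold.\<close>

lemma pair_sum_identity:
  fixes s :: "nat \<Rightarrow> real"
  assumes k: "k > 0"
  shows "(\<Sum>i<k. \<Sum>j<k. if i = j then 0 else
      (t\<^sup>2 * (4 * (s i * s j)) - t * (s i + s j)) / 2 + (t\<^sup>2 * (s i - s j)\<^sup>2 - t * (s i + s j)) / k)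
    = 2 * (1 - 1 / real k) * t * (\<Sum>i<k. s i) * (t * (\<Sum>i<k. s i) - (real k + 2) / 2)"
proof -
  define r where "r = (\<Sum>i<k. s i)"
  define S where "S = (\<Sum>i<k. (s i)\<^sup>2)"
  define A where "A = 2 * t\<^sup>2 - 2 * t\<^sup>2 / k"
  define B where "B = t / 2 + t / k"
  define C where "C = t\<^sup>2 / k"
  define g where "g i j = A * (s i * s j) - B * (s i + s j) + C * ((s i)\<^sup>2 + (s j)\<^sup>2)" for i j
  have g: "(t\<^sup>2 * (4 * (s i * s j)) - t * (s i + s j)) / 2 + (t\<^sup>2 * (s i - s j)\<^sup>2 - t * (s i + s j)) / k = g i j" for i j
    unfolding g_def A_def B_def C_def using k by (simp add: field_simps power2_eq_square)
  have "(\<Sum>i<k. \<Sum>j<k. if i = j then 0 else g i j) = (\<Sum>i<k. \<Sum>j<k. g i j - (if j = i then g i i else 0))"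
    by (intro sum.cong) auto
  also have "\<dots> = (\<Sum>i<k. \<Sum>j<k. g i j) - (\<Sum>i<k. g i i)"
    by (simp add: sum_subtractf)
  also have "(\<Sum>i<k. g i i) = A * S - 2 * B * r + 2 * C * S"
    by (simp add: g_def sum.distrib sum_subtractf r_def S_def sum_distrib_left power2_eq_square algebra_simps)
  also have "(\<Sum>i<k. \<Sum>j<k. g i j) = A * r\<^sup>2 - 2 * B * k * r + 2 * C * k * S"
  proof -
    have r2: "(\<Sum>i<k. \<Sum>j<k. s i * s j) = r\<^sup>2" by (simp add: r_def sum_product power2_eq_square)
    have "(\<Sum>i<k. \<Sum>j<k. g i j) = A * (\<Sum>i<k. \<Sum>j<k. s i * s j) - B * (\<Sum>i<k. \<Sum>j<k. s i + s j) + C * (\<Sum>i<k. \<Sum>j<k. (s i)\<^sup>2 + (s j)\<^sup>2)"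
    proof -
      have lin: "(\<Sum>i<k. \<Sum>j<k. A * x i j - B * y i j + C * z i j)
        = A * (\<Sum>i<k. \<Sum>j<k. x i j) - B * (\<Sum>i<k. \<Sum>j<k. y i j) + C * (\<Sum>i<k. \<Sum>j<k. z i j)" for x y z :: "nat \<Rightarrow> nat \<Rightarrow> real"
        by (simp add: sum.distrib sum_subtractf sum_distrib_left)
      show ?thesis unfolding g_def by (rule lin)
    qed
    also have "(\<Sum>i<k. \<Sum>j<k. s i + s j) = 2 * k * r"
      by (simp add: sum.distrib r_def sum_distrib_left[symmetric] algebra_simps)
    also have "(\<Sum>i<k. \<Sum>j<k. (s i)\<^sup>2 + (s j)\<^sup>2) = 2 * k * S"
      by (simp add: sum.distrib S_def sum_distrib_left[symmetric] algebra_simps)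
    finally show ?thesis unfolding r2 by (simp add: algebra_simps)
  qed
  also have "A * r\<^sup>2 - 2 * B * k * r + 2 * C * k * S - (A * S - 2 * B * r + 2 * C * S) = 2 * (1 - 1 / real k) * t * r * (t * r - (real k + 2) / 2)"
    unfolding A_def B_def C_def using k by (simp add: field_simps power2_eq_square)
  finally show ?thesis unfolding g r_def .
qed

lemma infsum_finite_sum:
  fixes f :: "'b \<Rightarrow> 'a \<Rightarrow> real"
  assumes "finite I" "\<And>i. i \<in> I \<Longrightarrow> f i summable_on A"
  shows "(\<lambda>x. \<Sum>i\<in>I. f i x) summable_on A" "(\<Sum>\<^sub>\<infinity>x\<in>A. \<Sum>i\<in>I. f i x) = (\<Sum>i\<in>I. \<Sum>\<^sub>\<infinity>x\<in>A. f i x)"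
proof -
  have "(\<lambda>x. \<Sum>i\<in>I. f i x) summable_on A \<and> (\<Sum>\<^sub>\<infinity>x\<in>A. \<Sum>i\<in>I. f i x) = (\<Sum>i\<in>I. \<Sum>\<^sub>\<infinity>x\<in>A. f i x)"
    using assms
  proof (induction I)
    case (insert i I)
    then have *: "f i summable_on A" "(\<lambda>x. \<Sum>i\<in>I. f i x) summable_on A"
      "(\<Sum>\<^sub>\<infinity>x\<in>A. \<Sum>i\<in>I. f i x) = (\<Sum>i\<in>I. \<Sum>\<^sub>\<infinity>x\<in>A. f i x)" by auto
    show ?case using summable_on_add[OF *(1,2)] infsum_add[OF *(1,2)] *(3) insert.hyps by simp
  qed simp
  then show "(\<lambda>x. \<Sum>i\<in>I. f i x) summable_on A" "(\<Sum>\<^sub>\<infinity>x\<in>A. \<Sum>i\<in>I. f i x) = (\<Sum>i\<in>I. \<Sum>\<^sub>\<infinity>x\<in>A. f i x)" by auto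
qed

text \<open>Averaging the second variation over the pairs \<open>(e i, e j)\<close> with weight \<open>1 / k\<close> and the pairs
  \<open>(e i \<plusminus> e j) / \<surd>2\<close> with weight \<open>1 / 2\<close> (that is, over an orthonormal basis of the traceless symmetric
  matrices) leaves a sum of nonnegative terms when \<open>t \<ge> (real k + 2) / 2\<close>.\<close>

lemma no_interior_maximum:
  fixes G :: "'a::euclidean_space set"
  assumes k: "k \<ge> 2" and t: "t \<ge> (real k + 2) / 2" and G: "good G" and b: "zbasis k b G" and det1: "gdet k b = 1"
    and max: "\<And>d :: nat \<Rightarrow> 'a. good (zspan k d) \<Longrightarrow> gdet k d = 1 \<Longrightarrow> rho t (zspan k d) \<le> rho t G"
  obtains m xs where "1 \<le> m" "m < k" "\<forall>i<m. xs i \<in> G" "gdet m xs = 1"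
proof (rule ccontr)
  assume a: "\<not> thesis"
  have gap: "gdet m xs \<noteq> 1" if "1 \<le> m" "m < k" "\<forall>i<m. xs i \<in> G" for m and xs :: "nat \<Rightarrow> 'a"
    using a that(1) that(2) that(3) \<open>\<And>m xs. 1 \<le> m \<Longrightarrow> m < k \<Longrightarrow> \<forall>i<m. xs i \<in> G \<Longrightarrow> gdet m xs = 1 \<Longrightarrow> thesis\<close> by auto
  have t0: "t > 0" using t by (rule less_le_trans[rotated]) simp
  have dk: "dim G = k" by (rule dim_zbasis[OF b])
  obtain e :: "nat \<Rightarrow> 'a" where e: "\<And>i j. i < k \<Longrightarrow> j < k \<Longrightarrow> e i \<bullet> e j = (if i = j then 1 else 0)"
    and sp: "span (e ` {..<k}) = span G"
    by (rule orthonormal_basis_tuple[of G, unfolded dk]) blast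
  define E where "E y = exp (- t * (norm y)\<^sup>2)" for y :: 'a
  define s where "s i y = (y \<bullet> e i)\<^sup>2" for i and y :: 'a
  define f1 where "f1 i j y = E y * (t\<^sup>2 * (s i y - s j y)\<^sup>2 - t * (s i y + s j y))" for i j y
  define f2 where "f2 i j y = E y * (t\<^sup>2 * (4 * (s i y * s j y)) - t * (s i y + s j y))" for i j y
  have f1: "f1 i j summable_on G" "(\<Sum>\<^sub>\<infinity>y\<in>G. f1 i j y) \<le> 0" if ij: "i < k" "j < k" "i \<noteq> j" for i j
  proof -
    show "f1 i j summable_on G"
      unfolding f1_def E_def s_def by (rule second_variation(1)[OF t0 G b det1 max gap e sp[symmetric] ij])
    show "(\<Sum>\<^sub>\<infinity>y\<in>G. f1 i j y) \<le> 0"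
      unfolding f1_def E_def s_def by (rule second_variation(2)[OF t0 G b det1 max gap e sp[symmetric] ij])
  qed
  \<comment> \<open>The variation along the pair turned by 45 degrees: for \<open>u\<close> and
    \<open>v\<close> the difference of the squared coordinates is twice the product of the old
    coordinates, and their sum is unchanged.\<close>
  have f2: "f2 i j summable_on G" "(\<Sum>\<^sub>\<infinity>y\<in>G. f2 i j y) \<le> 0" if ij: "i < k" "j < k" "i \<noteq> j" for i j
  proof -
    define u where "u = (1 / sqrt 2) *\<^sub>R (e i + e j)"
    define v where "v = (1 / sqrt 2) *\<^sub>R (e i - e j)"
    define e' where "e' = e(i := u, j := v)"
    have eij: "e i \<bullet> e i = 1" "e j \<bullet> e j = 1" "e i \<bullet> e j = 0" "e j \<bullet> e i = 0" using e ij by auto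
    have uv: "u \<bullet> u = 1" "v \<bullet> v = 1" "u \<bullet> v = 0" "v \<bullet> u = 0"
      by (simp_all add: u_def v_def inner_add_left inner_add_right inner_diff_left inner_diff_right eij)
    have uvl: "u \<bullet> e l = 0" "v \<bullet> e l = 0" "e l \<bullet> u = 0" "e l \<bullet> v = 0" if "l < k" "l \<noteq> i" "l \<noteq> j" for l
      using e[OF ij(1) that(1)] e[OF ij(2) that(1)] that
      by (simp_all add: u_def v_def inner_add_left inner_diff_left inner_commute[of "e l"] inner_add_right inner_diff_right)
    have e': "e' l \<bullet> e' m = (if l = m then 1 else 0)" if "l < k" "m < k" for l m
      using that e[OF that] uv uvl ij(3) by (auto simp: e'_def)
    have sq2: "(1 / sqrt 2) *\<^sub>R ((1 / sqrt 2) *\<^sub>R x) = (1 / 2) *\<^sub>R x" for x :: 'a by simp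
    have ei: "e i = (1 / sqrt 2) *\<^sub>R (u + v)" "e j = (1 / sqrt 2) *\<^sub>R (u - v)"
      by (simp_all add: u_def v_def scaleR_add_right[symmetric] scaleR_diff_right[symmetric] sq2 del: scaleR_scaleR)
    have sp': "span (e' ` {..<k}) = span (e ` {..<k})"
    proof
      have b1: "e l \<in> span (e ` {..<k})" if "l < k" for l using that by (intro span_base) auto
      have "u \<in> span (e ` {..<k})" "v \<in> span (e ` {..<k})"
        unfolding u_def v_def by (intro span_scale span_add span_diff b1 ij)+
      then show "span (e' ` {..<k}) \<subseteq> span (e ` {..<k})" using b1 by (intro span_minimal) (auto simp: e'_def)
      have b2: "e' l \<in> span (e' ` {..<k})" if "l < k" for l using that by (intro span_base) auto
      have uv2: "u \<in> span (e' ` {..<k})" "v \<in> span (e' ` {..<k})" using b2[OF ij(1)] b2[OF ij(2)] ij(3) by (auto simp: e'_def)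
      have ee: "e i \<in> span (e' ` {..<k})" "e j \<in> span (e' ` {..<k})"
        unfolding ei by (intro span_scale span_add span_diff uv2)+
      have "e l \<in> span (e' ` {..<k})" if "l < k" for l
      proof (cases "l = i \<or> l = j")
        case True
        then show ?thesis using ee by auto
      next
        case False
        then show ?thesis using b2[OF that] by (simp add: e'_def)
      qed
      then show "span (e ` {..<k}) \<subseteq> span (e' ` {..<k})" by (intro span_minimal) auto
    qed
    have sp'': "span G = span (e' ` {..<k})" using sp sp' by simp
    have e'ij: "e' i = u" "e' j = v" using ij(3) by (auto simp: e'_def)
    have sv1: "(\<lambda>y. exp (- t * (norm y)\<^sup>2) * (t\<^sup>2 * ((y \<bullet> u)\<^sup>2 - (y \<bullet> v)\<^sup>2)\<^sup>2 - t * ((y \<bullet> u)\<^sup>2 + (y \<bullet> v)\<^sup>2))) summable_on G"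
      by (rule second_variation(1)[OF t0 G b det1 max gap e' sp'' ij, unfolded e'ij])
    have sv2: "(\<Sum>\<^sub>\<infinity>y\<in>G. exp (- t * (norm y)\<^sup>2) * (t\<^sup>2 * ((y \<bullet> u)\<^sup>2 - (y \<bullet> v)\<^sup>2)\<^sup>2 - t * ((y \<bullet> u)\<^sup>2 + (y \<bullet> v)\<^sup>2))) \<le> 0"
      by (rule second_variation(2)[OF t0 G b det1 max gap e' sp'' ij, unfolded e'ij])
    have yu: "(y \<bullet> u)\<^sup>2 = (y \<bullet> e i + y \<bullet> e j)\<^sup>2 / 2" "(y \<bullet> v)\<^sup>2 = (y \<bullet> e i - y \<bullet> e j)\<^sup>2 / 2" for y
      by (simp_all add: u_def v_def inner_add_right inner_diff_right power_divide)
    have "exp (- t * (norm y)\<^sup>2) * (t\<^sup>2 * ((y \<bullet> u)\<^sup>2 - (y \<bullet> v)\<^sup>2)\<^sup>2 - t * ((y \<bullet> u)\<^sup>2 + (y \<bullet> v)\<^sup>2)) = f2 i j y" for y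
    proof -
      have "(y \<bullet> u)\<^sup>2 - (y \<bullet> v)\<^sup>2 = 2 * ((y \<bullet> e i) * (y \<bullet> e j))" unfolding yu power2_sum power2_diff by (simp add: field_simps)
      then have "((y \<bullet> u)\<^sup>2 - (y \<bullet> v)\<^sup>2)\<^sup>2 = 4 * (s i y * s j y)" by (simp add: s_def power_mult_distrib)
      moreover have "(y \<bullet> u)\<^sup>2 + (y \<bullet> v)\<^sup>2 = s i y + s j y" unfolding yu s_def by (simp add: power2_eq_square field_simps)
      ultimately show ?thesis by (simp add: f2_def E_def)
    qed
    then show "f2 i j summable_on G" "(\<Sum>\<^sub>\<infinity>y\<in>G. f2 i j y) \<le> 0" using sv1 sv2 by (simp_all only:)
  qed
  define F where "F i j y = (if i = j then 0 else f2 i j y / 2 + f1 i j y / real k)" for i j y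
  have F: "F i j summable_on G" "(\<Sum>\<^sub>\<infinity>y\<in>G. F i j y) \<le> 0" if "i < k" "j < k" for i j
  proof -
    have "F i j summable_on G \<and> (\<Sum>\<^sub>\<infinity>y\<in>G. F i j y) \<le> 0"
    proof (cases "i = j")
      case True
      then show ?thesis by (simp add: F_def[abs_def])
    next
      case False
      have s2: "(\<lambda>y. (1/2) * f2 i j y) summable_on G" and s1: "(\<lambda>y. (1 / real k) * f1 i j y) summable_on G"
        by (intro summable_on_cmult_right f1 f2 that False)+
      have FF: "F i j = (\<lambda>y. (1/2) * f2 i j y + (1 / real k) * f1 i j y)" using False by (simp add: F_def[abs_def])
      have "(\<Sum>\<^sub>\<infinity>y\<in>G. F i j y) = (1/2) * (\<Sum>\<^sub>\<infinity>y\<in>G. f2 i j y) + (1 / real k) * (\<Sum>\<^sub>\<infinity>y\<in>G. f1 i j y)"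
        unfolding FF infsum_add[OF s2 s1] infsum_cmult_right' ..
      moreover have "(1/2) * (\<Sum>\<^sub>\<infinity>y\<in>G. f2 i j y) \<le> 0" using f2(2)[OF that False] by simp
      moreover have "(1 / real k) * (\<Sum>\<^sub>\<infinity>y\<in>G. f1 i j y) \<le> 0" using f1(2)[OF that False] by (intro mult_nonneg_nonpos) auto
      ultimately have "(\<Sum>\<^sub>\<infinity>y\<in>G. F i j y) \<le> 0" by linarith
      moreover have "F i j summable_on G" unfolding FF by (rule summable_on_add[OF s2 s1])
      ultimately show ?thesis by simp
    qed
    then show "F i j summable_on G" "(\<Sum>\<^sub>\<infinity>y\<in>G. F i j y) \<le> 0" by auto
  qed
  define T where "T y = (\<Sum>i<k. \<Sum>j<k. F i j y)" for y
  have inner: "(\<lambda>y. \<Sum>j<k. F i j y) summable_on G" "(\<Sum>\<^sub>\<infinity>y\<in>G. \<Sum>j<k. F i j y) \<le> 0" if "i < k" for i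
  proof -
    show "(\<lambda>y. \<Sum>j<k. F i j y) summable_on G" by (rule infsum_finite_sum(1)) (use F(1) that in auto)
    have "(\<Sum>\<^sub>\<infinity>y\<in>G. \<Sum>j<k. F i j y) = (\<Sum>j<k. \<Sum>\<^sub>\<infinity>y\<in>G. F i j y)" by (rule infsum_finite_sum(2)) (use F(1) that in auto)
    also have "\<dots> \<le> 0" by (rule sum_nonpos) (use F(2) that in auto)
    finally show "(\<Sum>\<^sub>\<infinity>y\<in>G. \<Sum>j<k. F i j y) \<le> 0" .
  qed
  have Tsum: "T summable_on G" unfolding T_def[abs_def] by (rule infsum_finite_sum(1)) (use inner(1) in auto)
  have "(\<Sum>\<^sub>\<infinity>y\<in>G. T y) = (\<Sum>i<k. \<Sum>\<^sub>\<infinity>y\<in>G. \<Sum>j<k. F i j y)"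
    unfolding T_def by (rule infsum_finite_sum(2)) (use inner(1) in auto)
  also have "\<dots> \<le> 0" by (rule sum_nonpos) (use inner(2) in auto)
  finally have T0: "(\<Sum>\<^sub>\<infinity>y\<in>G. T y) \<le> 0" .
  have Teq: "T y = E y * (2 * (1 - 1 / real k) * t * (norm y)\<^sup>2 * (t * (norm y)\<^sup>2 - (real k + 2) / 2))" if "y \<in> G" for y
  proof -
    have ys: "y \<in> span (e ` {..<k})" using span_base[OF that] sp by simp
    have ny: "(norm y)\<^sup>2 = (\<Sum>i<k. s i y)" unfolding s_def using ys e by (intro orthonormal_expand) auto
    have "T y = E y * (\<Sum>i<k. \<Sum>j<k. if i = j then 0 else
      (t\<^sup>2 * (4 * (s i y * s j y)) - t * (s i y + s j y)) / 2 + (t\<^sup>2 * (s i y - s j y)\<^sup>2 - t * (s i y + s j y)) / real k)"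
      unfolding T_def sum_distrib_left by (intro sum.cong) (auto simp: F_def f1_def f2_def distrib_left)
    then show ?thesis unfolding ny using pair_sum_identity[of k t "\<lambda>i. s i y"] k by simp
  qed
  have k1: "1 - 1 / real k > 0" using k by simp
  have Tnn: "T y \<ge> 0" if y: "y \<in> G" for y
  proof (cases "y = 0")
    case True
    then show ?thesis unfolding Teq[OF y] by simp
  next
    case False
    have "norm y \<ge> 1" by (rule good_norm_ge[OF G y False])
    then have "(norm y)\<^sup>2 \<ge> 1" by (simp add: one_le_power)
    then have "t * (norm y)\<^sup>2 \<ge> t * 1" using t0 by (intro mult_left_mono) auto
    then have "t * (norm y)\<^sup>2 - (real k + 2) / 2 \<ge> 0" using t by linarith
    then show ?thesis unfolding Teq[OF y] E_def using t0 k1 by (intro mult_nonneg_nonneg) simp_all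
  qed
  \<comment> \<open>A strictly positive term is wanted. For norm one and
    \<open>t = (k + 2) / 2\<close> the summand vanishes, so a doubled lattice vector, of norm at
    least two, is taken.\<close>
  define y0 where "y0 = b 0 + b 0"
  have b0: "b 0 \<in> G" using b zspan_base[of 0 k b] k by (simp add: zbasis_def)
  have y0: "y0 \<in> G" unfolding y0_def by (intro agroupD(2)[OF good_agroup[OF G]] b0)
  have "b 0 \<noteq> 0"
  proof
    assume "b 0 = 0"
    then have "0 \<in> b ` {..<k}" using k by (intro image_eqI[of _ _ 0]) auto
    then have "dependent (b ` {..<k})" by (rule dependent_zero)
    then show False using gdet_nz_imp_independent(2)[of k b] det1 by simp
  qed
  then have "norm (b 0) \<ge> 1" by (rule good_norm_ge[OF G b0])
  then have "norm y0 \<ge> 2" unfolding y0_def by (simp add: scaleR_2[symmetric])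
  then have "(norm y0)\<^sup>2 \<ge> 2\<^sup>2" by (intro power_mono) auto
  then have n4: "(norm y0)\<^sup>2 \<ge> 4" by simp
  then have "t * (norm y0)\<^sup>2 \<ge> t * 4" using t0 by (intro mult_left_mono) auto
  then have "t * (norm y0)\<^sup>2 > (real k + 2) / 2" using t t0 by linarith
  then have pos: "T y0 > 0" unfolding Teq[OF y0] E_def using t0 k1 n4 by (intro mult_pos_pos) auto
  have "sum T {y0} \<le> infsum T G"
    by (rule finite_sum_le_infsum[OF Tsum]) (use y0 Tnn in auto)
  then show False using T0 pos by simp
qed

text \<open>One \<open>R\<close> serves all admissible lattices of rank \<open>k\<close> and
  determinant one, so a maximum over the compact set of tuples is a maximum over all of these
  lattices.\<close>

lemma reduced_representative:
  "\<exists>R. \<forall>d :: nat \<Rightarrow> 'a::euclidean_space. good (zspan k d) \<and> gdet k d = 1 \<longrightarrow> (\<exists>b\<in>reduced_tuples k R. zspan k b = zspan k d)"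
proof -
  obtain R where R: "\<forall>G :: 'a set. agroup G \<and> (\<forall>x\<in>G. x \<noteq> 0 \<longrightarrow> norm x \<ge> 1) \<and> dim G \<le> DIM('a) \<longrightarrow>
      (\<exists>k b. zbasis k b G \<and> (gdet k b \<le> 1 \<longrightarrow> (\<forall>i<k. norm (b i) \<le> R)))"
    using reduced_basis[of 1 "DIM('a)" 1] by auto
  show ?thesis
  proof (intro exI[of _ R] allI impI)
    fix d :: "nat \<Rightarrow> 'a" assume d: "good (zspan k d) \<and> gdet k d = 1"
    then have "\<exists>k' b. zbasis k' b (zspan k d) \<and> (gdet k' b \<le> 1 \<longrightarrow> (\<forall>i<k'. norm (b i) \<le> R))"
      using R[rule_format, of "zspan k d"] good_agroup[of "zspan k d"] good_norm[of "zspan k d"] dim_subset_UNIV[of "zspan k d"] by simp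
    then obtain k' b where b: "zbasis k' b (zspan k d)" "gdet k' b \<le> 1 \<longrightarrow> (\<forall>i<k'. norm (b i) \<le> R)" by auto
    have "zbasis k d (zspan k d)" using d by (simp add: zbasis_def)
    then have kk: "k' = k" using b(1) zbasis_rank_unique by metis
    have zz: "zspan k b = zspan k d" using b(1) kk by (simp add: zbasis_def)
    have g1: "gdet k b = 1" using gdet_basis_unique[OF zz] d by simp
    define c where "c i = (if i < k then b i else 0)" for i
    have "zspan k c = zspan k d" unfolding zz[symmetric] by (rule zspan_cong) (simp add: c_def)
    moreover have "gdet k c = 1" unfolding g1[symmetric] by (rule gdet_cong) (simp add: c_def)
    moreover have "c i \<in> (if i < k then cball 0 R else {0})" for i using b(2) kk g1 by (simp add: c_def)
    ultimately have "c \<in> reduced_tuples k R" using d by (simp add: reduced_tuples_def)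
    then show "\<exists>b\<in>reduced_tuples k R. zspan k b = zspan k d" using \<open>zspan k c = zspan k d\<close> by blast
  qed
qed

text \<open>The bound is shown for a lattice of maximal mass, to which \<open>G\<close> is then
  compared. By maximality and \<open>no_interior_maximum\<close> that lattice contains a proper
  tuple of determinant one, along which it splits.\<close>

lemma mass_bound_det1:
  fixes G :: "'a::euclidean_space set"
  assumes k: "1 \<le> k" and t: "t \<ge> (real k + 2) / 2" and G: "good G" and b: "zbasis k b G" and det1: "gdet k b = 1"
    and IH: "\<And>j H (d :: nat \<Rightarrow> 'a). j < k \<Longrightarrow> zbasis j d H \<Longrightarrow> good H \<Longrightarrow> rho t H \<le> theta t ^ j"
  shows "rho t G \<le> theta t ^ k"
proof -
  have t0: "t > 0" using t by (rule less_le_trans[rotated]) simp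
  obtain R where R: "\<forall>d :: nat \<Rightarrow> 'a. good (zspan k d) \<and> gdet k d = 1 \<longrightarrow> (\<exists>b\<in>reduced_tuples k R. zspan k b = zspan k d)"
    using reduced_representative[of k] by (rule exE)
  have Gb: "G = zspan k b" using b by (simp add: zbasis_def)
  obtain b' where b': "b' \<in> reduced_tuples k R" "zspan k b' = zspan k b"
    using R[rule_format, of b] G det1 Gb by auto
  have ne: "(reduced_tuples k R :: (nat \<Rightarrow> 'a) set) \<noteq> {}" using b' by auto
  have nz: "gdet k d \<noteq> 0" if "d \<in> reduced_tuples k R" for d :: "nat \<Rightarrow> 'a" using that by (simp add: reduced_tuples_def)
  obtain c :: "nat \<Rightarrow> 'a" where c: "c \<in> reduced_tuples k R" "\<And>d :: nat \<Rightarrow> 'a. d \<in> reduced_tuples k R \<Longrightarrow> rho t (zspan k d) \<le> rho t (zspan k c)"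
    by (rule rho_attains_max[OF compact_reduced_tuples nz ne t0]) auto
  have cg: "gdet k c = 1" "good (zspan k c)" "zbasis k c (zspan k c)" using c(1) by (auto simp: reduced_tuples_def zbasis_def)
  have max: "rho t (zspan k d) \<le> rho t (zspan k c)" if d: "good (zspan k d)" "gdet k d = 1" for d :: "nat \<Rightarrow> 'a"
  proof -
    obtain d' where "d' \<in> reduced_tuples k R" "zspan k d' = zspan k d" using R[rule_format, of d] d by auto
    then show ?thesis using c(2)[of d'] by simp
  qed
  have "rho t (zspan k c) \<le> theta t ^ k"
  proof (cases "k = 1")
    case True
    \<comment> \<open>In rank one determinant one says that the generator is a unit vector, so the
      mass equals \<open>theta t\<close>.\<close>
    have "c 0 \<bullet> c 0 = 1" using cg(1) True by (simp add: power2_norm_eq_inner[symmetric])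
    then have "rho t (zspan k c) = theta t ^ k" using True by (intro rho_orthonormal t0) auto
    then show ?thesis by simp
  next
    case False
    then have "k \<ge> 2" using k by simp
    then obtain m xs where "1 \<le> m" "m < k" "\<forall>i<m. xs i \<in> zspan k c" "gdet m xs = 1"
      by (rule no_interior_maximum[OF _ t cg(2,3,1) max])
    then show ?thesis by (rule split_bound[OF t0 cg(2,3) _ _ _ _ IH])
  qed
  moreover have "rho t G \<le> rho t (zspan k c)" unfolding Gb by (rule max) (use G Gb det1 in simp_all)
  ultimately show ?thesis by linarith
qed

lemma mass_bound_large:
  fixes G :: "'a::euclidean_space set"
  assumes t: "t \<ge> (real N + 2) / 2" and k: "k \<le> N" "zbasis k b G" "good G"
  shows "rho t G \<le> theta t ^ k"
proof (rule mass_bound_induct[OF _ _ k])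
  show "t > 0" using t by (rule less_le_trans[rotated]) simp
next
  fix k G and b :: "nat \<Rightarrow> 'a"
  assume *: "1 \<le> k" "k \<le> N" "zbasis k b G" "good G" "gdet k b = 1"
    and IH: "\<And>j H (d :: nat \<Rightarrow> 'a). j < k \<Longrightarrow> zbasis j d H \<Longrightarrow> good H \<Longrightarrow> rho t H \<le> theta t ^ j"
  have "t \<ge> (real k + 2) / 2" using t *(2) by simp
  then show "rho t G \<le> theta t ^ k" by (rule mass_bound_det1[OF *(1) _ *(4,3,5) IH])
qed

text \<open>Under Poisson summation a lattice of determinant one and the power
  \<open>theta t ^ k\<close> acquire the same factor, while \<open>t\<close> becomes
  \<open>pi\<^sup>2 / t\<close>, which lies in the range of \<open>mass_bound_large\<close>.\<close>

lemma mass_bound_small: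
  fixes G :: "'a::euclidean_space set"
  assumes t: "t > 0" "t \<le> 2 * pi\<^sup>2 / (real N + 2)" and k: "k \<le> N" "zbasis k b G" "good G"
  shows "rho t G \<le> theta t ^ k"
proof (rule mass_bound_induct[OF t(1) _ k])
  fix k G and b :: "nat \<Rightarrow> 'a"
  assume *: "1 \<le> k" "k \<le> N" "zbasis k b G" "good G" "gdet k b = 1"
  have gd: "good (dualg G)" by (rule good_dual[OF *(4,3,5)])
  then obtain j d where d: "zbasis j d (dualg G)" by (rule good_has_basis)
  have "dualg G \<subseteq> span G" by (auto simp: dualg_def)
  then have "dim (dualg G) \<le> dim (span G)" by (rule dim_subset)
  \<comment> \<open>This inequality of ranks is enough: \<open>theta_ge_1\<close> raises the
    exponent from \<open>j\<close> to \<open>k\<close>.\<close>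
  then have jk: "j \<le> k" using dim_zbasis[OF d] dim_zbasis[OF *(3)] by simp
  have pt: "pi\<^sup>2 / t \<ge> (real N + 2) / 2" using t by (simp add: field_simps)
  have pt0: "pi\<^sup>2 / t > 0" using t by simp
  have "rho (pi\<^sup>2 / t) (dualg G) \<le> theta (pi\<^sup>2 / t) ^ j" by (rule mass_bound_large[OF pt _ d gd]) (use jk *(2) in simp)
  also have "\<dots> \<le> theta (pi\<^sup>2 / t) ^ k" by (rule power_increasing[OF jk theta_ge_1[OF pt0]])
  finally have "sqrt (pi / t) ^ k * rho (pi\<^sup>2 / t) (dualg G) \<le> sqrt (pi / t) ^ k * theta (pi\<^sup>2 / t) ^ k"
    using t by (intro mult_left_mono) auto
  also have "\<dots> = theta t ^ k" by (simp add: theta_poisson[OF t(1)] power_mult_distrib)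
  finally show "rho t G \<le> theta t ^ k" unfolding rho_poisson[OF *(3) t(1)] *(5) by simp
qed

section \<open>Translation to the notions of the statement\<close>

lemma int_span_eq_zspan: "int_span bs = zspan (length bs) (\<lambda>i. bs ! i)"
  unfolding int_span_def zspan_def by auto

text \<open>\<open>is_int_basis\<close> gives independence over the integers only. The integer
  matrices \<open>A\<close> and \<open>B\<close> of the two changes of basis have products with unit
  diagonal in both orders; equality of the two traces shows that the tuples have the same length,
  and \<open>gdet_basis_unique\<close> finishes.\<close>

lemma int_basis_det:
  fixes xs :: "nat \<Rightarrow> 'a::euclidean_space"
  assumes nz: "gdet m xs \<noteq> 0" and bs: "is_int_basis bs (zspan m xs)"
  shows "Determinant.det (gram_mat bs) = gdet m xs"
proof -
  define p where "p = length bs"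
  define d where "d i = bs ! i" for i
  have zz: "zspan m xs = zspan p d" using bs by (simp add: is_int_basis_def int_span_eq_zspan p_def d_def[abs_def])
  have ind: "c i = 0" if "(\<Sum>i<p. of_int (c i) *\<^sub>R d i) = 0" "i < p" for c :: "nat \<Rightarrow> int" and i
    using bs that by (simp add: is_int_basis_def p_def d_def)
  have "\<forall>i. \<exists>c. i < p \<longrightarrow> d i = (\<Sum>j<m. of_int (c j :: int) *\<^sub>R xs j)"
    using zspan_base[of _ p d] unfolding zz[symmetric] by (auto simp: zspan_def)
  from choice[OF this] obtain A where A: "\<forall>i. i < p \<longrightarrow> d i = (\<Sum>j<m. of_int (A i j :: int) *\<^sub>R xs j)" by (rule exE)
  have "\<forall>i. \<exists>c. i < m \<longrightarrow> xs i = (\<Sum>j<p. of_int (c j :: int) *\<^sub>R d j)"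
    using zspan_base[of _ m xs] unfolding zz by (auto simp: zspan_def)
  from choice[OF this] obtain B where B: "\<forall>i. i < m \<longrightarrow> xs i = (\<Sum>j<p. of_int (B i j :: int) *\<^sub>R d j)" by (rule exE)
  have AB: "(\<Sum>j<m. A i j * B j i) = 1" if i: "i < p" for i
  proof -
    have "d i = (\<Sum>j<m. of_int (A i j) *\<^sub>R xs j)" using A i by blast
    also have "\<dots> = (\<Sum>j<m. of_int (A i j) *\<^sub>R (\<Sum>l<p. of_int (B j l) *\<^sub>R d l))"
      by (rule sum.cong) (use B in auto)
    also have "\<dots> = (\<Sum>l<p. of_int (\<Sum>j<m. A i j * B j l) *\<^sub>R d l)"
      by (simp add: scaleR_sum_right scaleR_sum_left) (rule sum.swap)
    finally have "(\<Sum>l<p. of_int (\<Sum>j<m. A i j * B j l) *\<^sub>R d l) - (\<Sum>l<p. of_int (if l = i then 1 else 0) *\<^sub>R d l) = 0"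
      using i by (simp add: if_distrib[of of_int] if_distrib[of "\<lambda>x. x *\<^sub>R _"] cong: if_cong)
    then have "(\<Sum>l<p. of_int ((\<Sum>j<m. A i j * B j l) - (if l = i then 1 else 0)) *\<^sub>R d l) = 0"
      by (simp only: of_int_diff scaleR_diff_left sum_subtractf)
    from ind[OF this i] show ?thesis by simp
  qed
  have BA: "(\<Sum>j<p. B i j * A j i) = 1" if i: "i < m" for i
  proof -
    have "xs i = (\<Sum>j<p. of_int (B i j) *\<^sub>R d j)" using B i by blast
    also have "\<dots> = (\<Sum>j<p. of_int (B i j) *\<^sub>R (\<Sum>l<m. of_int (A j l) *\<^sub>R xs l))"
      by (rule sum.cong) (use A in auto)
    also have "\<dots> = (\<Sum>l<m. of_int (\<Sum>j<p. B i j * A j l) *\<^sub>R xs l)"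
      by (simp add: scaleR_sum_right scaleR_sum_left) (rule sum.swap)
    finally have "(\<Sum>l<m. of_int (\<Sum>j<p. B i j * A j l) *\<^sub>R xs l) = (\<Sum>l<m. of_int (if l = i then 1 else 0) *\<^sub>R xs l)"
      using i by (simp add: if_distrib[of of_int] if_distrib[of "\<lambda>x. x *\<^sub>R _"] cong: if_cong)
    from gdet_nz_coeff_unique[OF nz this i] show ?thesis by (simp only: of_int_eq_iff) simp
  qed
  have "int p = (\<Sum>i<p. \<Sum>j<m. A i j * B j i)" by (simp add: AB)
  also have "\<dots> = (\<Sum>j<m. \<Sum>i<p. B j i * A i j)" by (subst sum.swap) (simp add: mult.commute)
  also have "\<dots> = int m" by (simp add: BA)
  finally have "p = m" by simp
  have "gdet p d = gdet m xs" using gdet_basis_unique[of m xs d] zz \<open>p = m\<close> by simp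
  then show ?thesis by (simp add: gram_mat_def gdet_def p_def d_def)
qed

text \<open>Whichever basis \<open>SOME\<close> selects, \<open>int_basis_det\<close> fixes its Gram
  determinant; the tuple itself shows that a basis exists.\<close>

lemma lattice_det_zspan:
  fixes xs :: "nat \<Rightarrow> 'a::euclidean_space"
  assumes "gdet m xs \<noteq> 0"
  shows "lattice_det (zspan m xs) = sqrt (gdet m xs)"
proof -
  have "is_int_basis (map xs [0..<m]) (zspan m xs)"
    unfolding is_int_basis_def
  proof (intro conjI allI impI)
    show "zspan m xs = int_span (map xs [0..<m])" unfolding int_span_eq_zspan by (simp, rule zspan_cong) simp
    fix c :: "nat \<Rightarrow> int" and i
    assume c: "(\<Sum>i<length (map xs [0..<m]). real_of_int (c i) *\<^sub>R (map xs [0..<m] ! i)) = 0" and i: "i < length (map xs [0..<m])"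
    have "(\<Sum>i<m. real_of_int (c i) *\<^sub>R xs i) = 0" using c by simp
    from gdet_nz_coeff[OF assms this] i show "c i = 0" by simp
  qed
  then have "is_int_basis (SOME bs. is_int_basis bs (zspan m xs)) (zspan m xs)" by (rule someI)
  then show ?thesis unfolding lattice_det_def by (simp add: int_basis_det[OF assms])
qed

lemma int_lattice_zspan:
  obtains e :: "nat \<Rightarrow> real ^ 'n" where "int_lattice = zspan CARD('n) e"
    "\<And>i j. i < CARD('n) \<Longrightarrow> j < CARD('n) \<Longrightarrow> e i \<bullet> e j = (if i = j then 1 else 0)"
proof -
  obtain h :: "nat \<Rightarrow> 'n" where h: "bij_betw h {..<CARD('n)} UNIV"
    using ex_bij_betw_nat_finite[of "UNIV :: 'n set"] by (auto simp: atLeast0LessThan)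
  have inj: "h i = h j \<longleftrightarrow> i = j" if "i < CARD('n)" "j < CARD('n)" for i j
    using h that by (auto simp: bij_betw_def inj_on_def)
  define e where "e i = (axis (h i) 1 :: real ^ 'n)" for i
  have comp: "(\<Sum>i<CARD('n). c i *\<^sub>R e i) $ l = c (the_inv_into {..<CARD('n)} h l)" for c l
  proof -
    let ?i = "the_inv_into {..<CARD('n)} h l"
    have i: "?i < CARD('n)" "h ?i = l"
      using the_inv_into_into[of h "{..<CARD('n)}" l "{..<CARD('n)}"] f_the_inv_into_f[of h "{..<CARD('n)}" l] h by (auto simp: bij_betw_def)
    have "(\<Sum>i<CARD('n). c i *\<^sub>R e i) $ l = (\<Sum>i<CARD('n). if i = ?i then c i else 0)"
      unfolding sum_component
    proof (rule sum.cong)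
      fix j assume "j \<in> {..<CARD('n)}"
      then have "h j = l \<longleftrightarrow> j = ?i" using inj[of j ?i] i by simp
      then show "(c j *\<^sub>R e j) $ l = (if j = ?i then c j else 0)" by (auto simp: e_def axis_def)
    qed simp
    then show ?thesis using i by simp
  qed
  show ?thesis
  proof (rule that[of e])
    show "e i \<bullet> e j = (if i = j then 1 else 0)" if "i < CARD('n)" "j < CARD('n)" for i j
      unfolding e_def using inj[OF that] by (simp add: inner_axis_axis)
    show "int_lattice = zspan CARD('n) e"
    proof (intro subset_antisym subsetI)
      fix x :: "real ^ 'n" assume "x \<in> int_lattice"
      then have x: "x $ l = of_int \<lfloor>x $ l\<rfloor>" for l by (simp add: int_lattice_def)
      have "x = (\<Sum>i<CARD('n). of_int \<lfloor>x $ h i\<rfloor> *\<^sub>R e i)"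
      proof (subst Finite_Cartesian_Product.vec_eq_iff, rule allI)
        fix l
        have "h (the_inv_into {..<CARD('n)} h l) = l"
          using f_the_inv_into_f[of h "{..<CARD('n)}" l] h by (auto simp: bij_betw_def)
        then show "x $ l = (\<Sum>i<CARD('n). of_int \<lfloor>x $ h i\<rfloor> *\<^sub>R e i) $ l" unfolding comp using x[of l] by simp
      qed
      then show "x \<in> zspan CARD('n) e" by (rule zspanI)
    next
      fix x assume "x \<in> zspan CARD('n) e"
      then obtain c where "x = (\<Sum>i<CARD('n). of_int (c i) *\<^sub>R e i)" by (rule zspanE)
      then show "x \<in> int_lattice" by (simp add: int_lattice_def comp del: sum_component)
    qed
  qed
qed

lemma gauss_mass_eq_rho: "gauss_mass s G = rho (pi / s\<^sup>2) G"
  unfolding gauss_mass_def rho_def by (intro infsum_cong) simp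

theorem theorem1p6:
  fixes L :: "(real ^ 'n) set" and s :: real
  assumes "is_lattice L"
    and "\<And>M. is_sublattice M L \<Longrightarrow> lattice_det M \<ge> 1"
    and "s > 0"
    and "s \<le> sqrt (2 * pi / (real CARD('n) + 2)) \<or> s \<ge> sqrt ((real CARD('n) + 2) / (2 * pi))"
  shows "gauss_mass s L \<le> gauss_mass s (int_lattice :: (real ^ 'n) set)"
proof -
  obtain bs where bs: "length bs = CARD('n)" "distinct bs" "independent (set bs)" "L = int_span bs"
    using assms(1) by (auto simp: is_lattice_def)
  define b where "b i = bs ! i" for i
  have im: "b ` {..<CARD('n)} = set bs" unfolding bs(1)[symmetric] by (auto simp: b_def set_conv_nth)
  have "inj_on b {..<CARD('n)}" using bs(1,2) by (auto simp: inj_on_def b_def nth_eq_iff_index_eq)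
  then have gb: "gdet CARD('n) b \<noteq> 0" using bs(3) im by (intro independent_imp_gdet_nz) simp_all
  have Lz: "L = zspan CARD('n) b" using bs(1,4) by (simp add: int_span_eq_zspan b_def[abs_def])
  then have zb: "zbasis CARD('n) b L" using gb by (simp add: zbasis_def)
  \<comment> \<open>An independent tuple generates a sublattice whose determinant is the square root
    of its \<open>gdet\<close>, so the hypothesis on sublattices applies to it.\<close>
  have good: "good L"
    unfolding good_def
  proof (intro conjI allI impI)
    show ag: "agroup L" unfolding Lz by (rule agroup_zspan)
    fix m and xs :: "nat \<Rightarrow> real ^ 'n" assume xs: "\<forall>i<m. xs i \<in> L"
    show "gdet m xs = 0 \<or> gdet m xs \<ge> 1"
    proof (cases "gdet m xs = 0")
      case False
      have "zspan m xs \<subseteq> L" using xs by (intro zspan_subset ag) simp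
      then have "is_sublattice (zspan m xs) L"
        using agroup_zspan[of m xs] by (simp add: is_sublattice_def agroup_def)
      then have "sqrt (gdet m xs) \<ge> 1" using assms(2) lattice_det_zspan[OF False] by metis
      then show ?thesis by simp
    qed simp
  qed
  define t where "t = pi / s\<^sup>2"
  have t0: "t > 0" using assms(3) by (simp add: t_def)
  have le: "rho t L \<le> theta t ^ CARD('n)"
    using assms(4)
  proof
    assume "s \<le> sqrt (2 * pi / (real CARD('n) + 2))"
    then have "s\<^sup>2 \<le> (sqrt (2 * pi / (real CARD('n) + 2)))\<^sup>2" using assms(3) by (intro power_mono) auto
    then have "s\<^sup>2 \<le> 2 * pi / (real CARD('n) + 2)" by simp
    then have "t \<ge> (real CARD('n) + 2) / 2" unfolding t_def using assms(3) by (simp add: field_simps)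
    then show ?thesis by (rule mass_bound_large[OF _ order_refl zb good])
  next
    assume "s \<ge> sqrt ((real CARD('n) + 2) / (2 * pi))"
    then have "s\<^sup>2 \<ge> (sqrt ((real CARD('n) + 2) / (2 * pi)))\<^sup>2" by (intro power_mono) auto
    then have "s\<^sup>2 \<ge> (real CARD('n) + 2) / (2 * pi)" by simp
    then have "pi * (real CARD('n) + 2) \<le> pi * (2 * pi * s\<^sup>2)" by (intro mult_left_mono) (simp_all add: field_simps)
    then have "t \<le> 2 * pi\<^sup>2 / (real CARD('n) + 2)" unfolding t_def using assms(3) by (simp add: field_simps power2_eq_square)
    then show ?thesis by (rule mass_bound_small[OF t0 _ order_refl zb good])
  qed
  obtain e :: "nat \<Rightarrow> real ^ 'n" where e: "int_lattice = zspan CARD('n) e"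
    "\<And>i j. i < CARD('n) \<Longrightarrow> j < CARD('n) \<Longrightarrow> e i \<bullet> e j = (if i = j then 1 else 0)"
    by (rule int_lattice_zspan) blast
  have "rho t (int_lattice :: (real ^ 'n) set) = theta t ^ CARD('n)"
    unfolding e(1) by (rule rho_orthonormal[OF t0 e(2)])
  with le show ?thesis by (simp add: gauss_mass_eq_rho t_def)
qed

end
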